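(* Let $\Gamma$ be a countable group and let $t\ge1$ be a natural number. Then for any $m\ge1$, $$\tau_m^{L(\bigoplus_tT_1(\Gamma))}=0.$$
   Context: For a countable group $\Gamma$ and $i\ge1$, let $\Gamma_i$ be a copy of $\Gamma$ and $\Lambda_i$ a copy of $\mathbb Z$; let $\tilde\Gamma=\bigoplus_{i\ge1}\Gamma_i$, and let $S_\infty$ be the group of finitely supported permutations of $\{1,2,\dots\}$, acting on $\tilde\Gamma$ by permuting indices. Define $$T_1(\Gamma)=\langle\tilde\Gamma\rtimes S_\infty,(\Lambda_i)_{i\ge1}\mid[\Gamma_i,\Lambda_j]=0\text{ for }i\ge j\rangle,$$ where $[\Gamma_i,\Lambda_j]=0$ means that $\Gamma_i$ and $\Lambda_j$ commute elementwise. $\bigoplus_tG$ is the direct sum of $t$ copies of $G$, and $L(G)$ is the group von Neumann algebra of $G$ with its canonical trace. For a tracial von Neumann algebra $(\mathcal M,\tau)$: $\|x\|_2=\tau(x^*x)^{1/2}$, $[x,y]=xy-yx$, and $r\mathbin{\dot-}s=\max(r-s,0)$. Set $\chi(X,U_1,U_2)=100(\|[X,U_1]\|_2^2+\|[X,U_2]\|_2^2)$. For $m\ge1$, $\psi_m(V_a,V_b)$ is the continuous-logic formula $$\sup_{\vec X,\vec Y}\Big(\big(\inf_U\max_{1\le i,j\le m}\|[UX_iU^*,Y_j]\|_2\big)\mathbin{\dot-}2\max_{1\le i\le m}\sqrt{\chi(X_i,V_a,V_b)}\Big),$$ and $\tau_m=\inf_{V_a,V_b}\psi_m(V_a,V_b)$.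 Here $\vec X=(X_1,\dots,X_m)$ and $\vec Y=(Y_1,\dots,Y_m)$ range over $m$-tuples from the operator-norm unit ball, and $U,V_a,V_b$ range over the unitaries. $\tau_m^{\mathcal M}$ is the value of the sentence $\tau_m$ in $\mathcal M$. *)

theory Defs
  imports
    "HOL-Analysis.Infinite_Sum"
    "HOL-Algebra.Product_Groups"
    "HOL-Algebra.Ring"
    "HOL-Combinatorics.Permutations"
begin

section \<open>The group \<open>T\<^sub>1(\<Gamma>)\<close>\<close>

definition semidirect_product ::
  "('n, 'c) monoid_scheme \<Rightarrow> ('h, 'd) monoid_scheme \<Rightarrow> ('h \<Rightarrow> 'n \<Rightarrow> 'n) \<Rightarrow> ('n \<times> 'h) monoid"
  where "semidirect_product N H act =
    \<lparr>carrier = carrier N \<times> carrier H,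
     mult = (\<lambda>(n, h) (n', h'). (n \<otimes>\<^bsub>N\<^esub> act h n', h \<otimes>\<^bsub>H\<^esub> h')),
     one = (\<one>\<^bsub>N\<^esub>, \<one>\<^bsub>H\<^esub>)\<rparr>"

definition S_infty :: "(nat \<Rightarrow> nat) monoid"
  where "S_infty =
    \<lparr>carrier = {p. p permutes {1..} \<and> finite {i. p i \<noteq> i}}, mult = (\<circ>), one = id\<rparr>"

text \<open>The direct sum of the \<open>\<Gamma>\<^sub>i\<close>, \<open>i \<ge> 1\<close>. Its elements are undefined at index 0, which is fixed by
  \<^const>\<open>S_infty\<close>; so the permutation action below is plain precomposition with the inverse.\<close>

definition direct_power :: "('a, 'b) monoid_scheme \<Rightarrow> (nat \<Rightarrow> 'a) monoid"
  where "direct_power \<Gamma> = sum_group {1..} (\<lambda>_. \<Gamma>)"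

definition permute_indices :: "(nat \<Rightarrow> nat) \<Rightarrow> (nat \<Rightarrow> 'a) \<Rightarrow> nat \<Rightarrow> 'a"
  where "permute_indices p f = f \<circ> inv_into UNIV p"

definition power_semidirect :: "('a, 'b) monoid_scheme \<Rightarrow> ((nat \<Rightarrow> 'a) \<times> (nat \<Rightarrow> nat)) monoid"
  where "power_semidirect \<Gamma> = semidirect_product (direct_power \<Gamma>) S_infty permute_indices"

text \<open>The element of \<open>\<Gamma>\<^sub>i\<close> given by \<open>x \<in> \<Gamma>\<close>, inside the semidirect product.\<close>

definition Gamma_elem ::
    "('a, 'b) monoid_scheme \<Rightarrow> nat \<Rightarrow> 'a \<Rightarrow> (nat \<Rightarrow> 'a) \<times> (nat \<Rightarrow> nat)"
  where "Gamma_elem \<Gamma> i x = ((\<lambda>k\<in>{1..}. if k = i then x else \<one>\<^bsub>\<Gamma>\<^esub>), id)"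

text \<open>\<open>T\<^sub>1(\<Gamma>)\<close> is presented on all elements of its constituent groups: the letter \<open>Base g\<close> is the
  element \<open>g\<close> of the semidirect product, and \<open>Lam j k\<close> is the element \<open>k\<close> of \<open>\<Lambda>\<^sub>j\<close>, a copy of the
  additive group of integers. The relations are the multiplication tables of these groups together
  with the commutation relations. Formal inverses of letters are not needed, since each
  constituent is a group.\<close>

datatype 'k T1_letter = Base 'k | Lam nat int

type_synonym 'a T1_word = "((nat \<Rightarrow> 'a) \<times> (nat \<Rightarrow> nat)) T1_letter list"

definition T1_words :: "('a, 'b) monoid_scheme \<Rightarrow> 'a T1_word set"
  where "T1_words \<Gamma> = lists (Base ` carrier (power_semidirect \<Gamma>) \<union> {Lam j k | j k. 1 \<le> j})"

inductive T1_cong :: "('a, 'b) monoid_scheme \<Rightarrow> 'a T1_word \<Rightarrow> 'a T1_word \<Rightarrow> bool"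
  for \<Gamma> :: "('a, 'b) monoid_scheme"
  where
    refl: "w \<in> T1_words \<Gamma> \<Longrightarrow> T1_cong \<Gamma> w w"
  | sym: "T1_cong \<Gamma> u v \<Longrightarrow> T1_cong \<Gamma> v u"
  | trans: "T1_cong \<Gamma> u v \<Longrightarrow> T1_cong \<Gamma> v w \<Longrightarrow> T1_cong \<Gamma> u w"
  | append: "T1_cong \<Gamma> u v \<Longrightarrow> T1_cong \<Gamma> u' v' \<Longrightarrow> T1_cong \<Gamma> (u @ u') (v @ v')"
  | base_one: "T1_cong \<Gamma> [Base \<one>\<^bsub>power_semidirect \<Gamma>\<^esub>] []"
  | base_mult: "g \<in> carrier (power_semidirect \<Gamma>) \<Longrightarrow> h \<in> carrier (power_semidirect \<Gamma>) \<Longrightarrow>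
      T1_cong \<Gamma> [Base g, Base h] [Base (g \<otimes>\<^bsub>power_semidirect \<Gamma>\<^esub> h)]"
  | lam_one: "1 \<le> j \<Longrightarrow> T1_cong \<Gamma> [Lam j 0] []"
  | lam_mult: "1 \<le> j \<Longrightarrow> T1_cong \<Gamma> [Lam j k, Lam j l] [Lam j (k + l)]"
  | commute: "1 \<le> j \<Longrightarrow> j \<le> i \<Longrightarrow> x \<in> carrier \<Gamma> \<Longrightarrow>
      T1_cong \<Gamma> [Base (Gamma_elem \<Gamma> i x), Lam j k] [Lam j k, Base (Gamma_elem \<Gamma> i x)]"

definition T1_rel :: "('a, 'b) monoid_scheme \<Rightarrow> ('a T1_word \<times> 'a T1_word) set"
  where "T1_rel \<Gamma> = {(u, v). T1_cong \<Gamma> u v}"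

definition T1 :: "('a, 'b) monoid_scheme \<Rightarrow> 'a T1_word set monoid"
  where "T1 \<Gamma> =
    \<lparr>carrier = T1_words \<Gamma> // T1_rel \<Gamma>,
     mult = (\<lambda>A B. \<Union>u\<in>A. \<Union>v\<in>B. T1_rel \<Gamma> `` {u @ v}),
     one = T1_rel \<Gamma> `` {[]}\<rparr>"


subsection \<open>Well-formedness: these are groups\<close>

lemma S_infty_group: "group S_infty"
proof (rule groupI)
  fix p q assume "p \<in> carrier S_infty" "q \<in> carrier S_infty"
  then have *: "p permutes {1..}" "q permutes {1..}" "finite {i. p i \<noteq> i}" "finite {i. q i \<noteq> i}"
    by (auto simp: S_infty_def)
  have "{i. p (q i) \<noteq> i} \<subseteq> {i. p i \<noteq> i} \<union> {i. q i \<noteq> i}"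
    by auto
  with * have "finite {i. p (q i) \<noteq> i}"
    using finite_subset by blast
  with * show "p \<otimes>\<^bsub>S_infty\<^esub> q \<in> carrier S_infty"
    by (auto simp: S_infty_def permutes_compose)
next
  fix p assume "p \<in> carrier S_infty"
  then have *: "p permutes {1..}" "finite {i. p i \<noteq> i}"
    by (auto simp: S_infty_def)
  have "{i. (inv_into UNIV p) i \<noteq> i} = {i. p i \<noteq> i}"
    using permutes_inv_eq[OF *(1)] by metis
  with * show "\<exists>q\<in>carrier S_infty. q \<otimes>\<^bsub>S_infty\<^esub> p = \<one>\<^bsub>S_infty\<^esub>"
    by (intro bexI[of _ "inv_into UNIV p"]) (auto simp: S_infty_def permutes_inv permutes_inv_o)
qed (auto simp: S_infty_def permutes_id o_assoc)

lemma semidirect_product_group: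
  assumes N: "group N" and H: "group H"
    and hom: "\<And>h. h \<in> carrier H \<Longrightarrow> act h \<in> hom N N"
    and one: "\<And>n. n \<in> carrier N \<Longrightarrow> act \<one>\<^bsub>H\<^esub> n = n"
    and mult: "\<And>h h' n. h \<in> carrier H \<Longrightarrow> h' \<in> carrier H \<Longrightarrow> n \<in> carrier N \<Longrightarrow>
                act (h \<otimes>\<^bsub>H\<^esub> h') n = act h (act h' n)"
  shows "group (semidirect_product N H act)"
proof -
  interpret N: group N by (rule N)
  interpret H: group H by (rule H)
  have cl: "act h n \<in> carrier N" if "h \<in> carrier H" "n \<in> carrier N" for h n
    using hom that by (auto simp: hom_def)
  have hm: "act h (n \<otimes>\<^bsub>N\<^esub> n') = act h n \<otimes>\<^bsub>N\<^esub> act h n'"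
    if "h \<in> carrier H" "n \<in> carrier N" "n' \<in> carrier N" for h n n'
    using hom that by (auto simp: hom_def)
  show ?thesis
  proof (rule groupI)
    fix x assume "x \<in> carrier (semidirect_product N H act)"
    then obtain n h where x: "x = (n, h)" "n \<in> carrier N" "h \<in> carrier H"
      by (auto simp: semidirect_product_def)
    show "\<exists>y\<in>carrier (semidirect_product N H act).
            y \<otimes>\<^bsub>semidirect_product N H act\<^esub> x = \<one>\<^bsub>semidirect_product N H act\<^esub>"
      using x cl by (intro bexI[of _ "(inv\<^bsub>N\<^esub> (act (inv\<^bsub>H\<^esub> h) n), inv\<^bsub>H\<^esub> h)"])
        (auto simp: semidirect_product_def)
  qed (use cl in \<open>auto simp: semidirect_product_def N.m_assoc H.m_assoc hm mult one\<close>)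
qed

lemma power_semidirect_group:
  assumes G: "group \<Gamma>"
  shows "group (power_semidirect \<Gamma>)"
  unfolding power_semidirect_def direct_power_def
proof (rule semidirect_product_group)
  fix p assume "p \<in> carrier S_infty"
  then have p: "p permutes {1..}" and bij: "bij p"
    by (auto simp: S_infty_def permutes_bij)
  have ge: "Suc 0 \<le> (inv_into UNIV p) i \<longleftrightarrow> Suc 0 \<le> i" for i
    using permutes_in_image[OF permutes_inv[OF p], of i] by simp
  have fin: "finite {i \<in> {1..}. f ((inv_into UNIV p) i) \<noteq> \<one>\<^bsub>\<Gamma>\<^esub>}"
    if "finite {i \<in> {1..}. f i \<noteq> \<one>\<^bsub>\<Gamma>\<^esub>}" for f
  proof (rule finite_subset)
    show "{i \<in> {1..}. f ((inv_into UNIV p) i) \<noteq> \<one>\<^bsub>\<Gamma>\<^esub>} \<subseteq> p ` {i \<in> {1..}. f i \<noteq> \<one>\<^bsub>\<Gamma>\<^esub>}"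
    proof
      fix i assume "i \<in> {i \<in> {1..}. f ((inv_into UNIV p) i) \<noteq> \<one>\<^bsub>\<Gamma>\<^esub>}"
      then show "i \<in> p ` {i \<in> {1..}. f i \<noteq> \<one>\<^bsub>\<Gamma>\<^esub>}"
        using bij ge by (intro image_eqI[of _ _ "(inv_into UNIV p) i"]) (auto simp: bij_is_surj surj_f_inv_f)
    qed
  qed (use that in simp)
  show "permute_indices p \<in> hom (sum_group {1..} (\<lambda>_. \<Gamma>)) (sum_group {1..} (\<lambda>_. \<Gamma>))"
    using fin ge G
    by (auto simp: hom_def carrier_sum_group permute_indices_def PiE_iff extensional_def
                   fun_eq_iff restrict_def)
next
  fix p q and f :: "nat \<Rightarrow> 'a"
  assume "p \<in> carrier S_infty" "q \<in> carrier S_infty"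
  then have "bij p" "bij q"
    by (auto simp: S_infty_def permutes_bij)
  then show "permute_indices (p \<otimes>\<^bsub>S_infty\<^esub> q) f = permute_indices p (permute_indices q f)"
    by (simp add: S_infty_def permute_indices_def o_inv_distrib o_assoc)
qed (use G S_infty_group in \<open>auto simp: permute_indices_def S_infty_def\<close>)

lemma Gamma_elem_carrier:
  assumes "group \<Gamma>" "x \<in> carrier \<Gamma>"
  shows "Gamma_elem \<Gamma> i x \<in> carrier (power_semidirect \<Gamma>)"
proof -
  have "{k \<in> {1..}. (if k = i then x else \<one>\<^bsub>\<Gamma>\<^esub>) \<noteq> \<one>\<^bsub>\<Gamma>\<^esub>} \<subseteq> {i}"
    by auto
  then have "finite {k \<in> {1..}. (if k = i then x else \<one>\<^bsub>\<Gamma>\<^esub>) \<noteq> \<one>\<^bsub>\<Gamma>\<^esub>}"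
    using finite_subset by blast
  then show ?thesis
    using assms group.is_monoid[OF assms(1)]
    by (auto simp: Gamma_elem_def power_semidirect_def semidirect_product_def direct_power_def
        carrier_sum_group S_infty_def permutes_id cong: conj_cong)
qed

lemma T1_cong_words:
  assumes "group \<Gamma>" "T1_cong \<Gamma> u v"
  shows "u \<in> T1_words \<Gamma> \<and> v \<in> T1_words \<Gamma>"
  using assms(2)
proof induction
  case base_one
  then show ?case
    using group.is_monoid[OF power_semidirect_group[OF assms(1)]] by (auto simp: T1_words_def)
next
  case (base_mult g h)
  then show ?case
    using group.is_monoid[OF power_semidirect_group[OF assms(1)]]
    by (auto simp: T1_words_def monoid.m_closed)
qed (use assms(1) in \<open>auto simp: T1_words_def Gamma_elem_carrier\<close>)

lemma T1_rel_equiv: "group \<Gamma> \<Longrightarrow> equiv (T1_words \<Gamma>) (T1_rel \<Gamma>)"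
  by (rule equivI) (auto simp: refl_on_def sym_def trans_def T1_rel_def
        intro: T1_cong.refl T1_cong.sym T1_cong.trans dest: T1_cong_words)

lemma T1_mult_class:
  assumes "group \<Gamma>" "u \<in> T1_words \<Gamma>" "v \<in> T1_words \<Gamma>"
  shows "T1_rel \<Gamma> `` {u} \<otimes>\<^bsub>T1 \<Gamma>\<^esub> T1_rel \<Gamma> `` {v} = T1_rel \<Gamma> `` {u @ v}"
proof -
  have "T1_rel \<Gamma> `` {u' @ v'} = T1_rel \<Gamma> `` {u @ v}" if "T1_cong \<Gamma> u u'" "T1_cong \<Gamma> v v'" for u' v'
    using equiv_class_eq[OF T1_rel_equiv[OF assms(1)]] T1_cong.append[OF that]
    by (simp add: T1_rel_def)
  then have "(\<Union>u'\<in>T1_rel \<Gamma> `` {u}. \<Union>v'\<in>T1_rel \<Gamma> `` {v}. T1_rel \<Gamma> `` {u' @ v'})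
      = (\<Union>u'\<in>T1_rel \<Gamma> `` {u}. \<Union>v'\<in>T1_rel \<Gamma> `` {v}. T1_rel \<Gamma> `` {u @ v})"
    by (intro SUP_cong) (auto simp: T1_rel_def)
  moreover have "T1_cong \<Gamma> u u" "T1_cong \<Gamma> v v"
    using assms by (auto intro: T1_cong.refl)
  ultimately show ?thesis
    by (auto simp: T1_def T1_rel_def)
qed

lemma T1_group:
  assumes G: "group \<Gamma>"
  shows "group (T1 \<Gamma>)"
proof (rule groupI)
  note eq = T1_rel_equiv[OF G]
  note mc = T1_mult_class[OF G]
  interpret K: group "power_semidirect \<Gamma>" by (rule power_semidirect_group[OF G])
  have car: "carrier (T1 \<Gamma>) = (\<lambda>u. T1_rel \<Gamma> `` {u}) ` T1_words \<Gamma>"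
    by (auto simp: T1_def quotient_def)
  have one: "\<one>\<^bsub>T1 \<Gamma>\<^esub> = T1_rel \<Gamma> `` {[]}" by (simp add: T1_def)
  have nil: "[] \<in> T1_words \<Gamma>" by (simp add: T1_words_def)
  have app: "u @ v \<in> T1_words \<Gamma>" if "u \<in> T1_words \<Gamma>" "v \<in> T1_words \<Gamma>" for u v
    using that by (simp add: T1_words_def)
  show "x \<otimes>\<^bsub>T1 \<Gamma>\<^esub> y \<in> carrier (T1 \<Gamma>)" if "x \<in> carrier (T1 \<Gamma>)" "y \<in> carrier (T1 \<Gamma>)" for x y
    using that by (auto simp: car mc app)
  show "\<one>\<^bsub>T1 \<Gamma>\<^esub> \<in> carrier (T1 \<Gamma>)" using nil by (auto simp: car one)
  show "x \<otimes>\<^bsub>T1 \<Gamma>\<^esub> y \<otimes>\<^bsub>T1 \<Gamma>\<^esub> z = x \<otimes>\<^bsub>T1 \<Gamma>\<^esub> (y \<otimes>\<^bsub>T1 \<Gamma>\<^esub> z)"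
    if "x \<in> carrier (T1 \<Gamma>)" "y \<in> carrier (T1 \<Gamma>)" "z \<in> carrier (T1 \<Gamma>)" for x y z
    using that by (auto simp: car mc app)
  show "\<one>\<^bsub>T1 \<Gamma>\<^esub> \<otimes>\<^bsub>T1 \<Gamma>\<^esub> x = x" if "x \<in> carrier (T1 \<Gamma>)" for x
    using that nil by (auto simp: car mc one)
  have inv: "\<exists>v\<in>T1_words \<Gamma>. T1_cong \<Gamma> (v @ u) []" if "u \<in> T1_words \<Gamma>" for u
    using that
  proof (induction u)
    case Nil
    then show ?case using nil by (auto intro!: bexI[of _ "[]"] T1_cong.refl)
  next
    case (Cons a u)
    then have u: "u \<in> T1_words \<Gamma>" and a: "[a] \<in> T1_words \<Gamma>" by (auto simp: T1_words_def)
    then obtain v where v: "v \<in> T1_words \<Gamma>" "T1_cong \<Gamma> (v @ u) []" using Cons by blast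
    have "\<exists>b. [b] \<in> T1_words \<Gamma> \<and> T1_cong \<Gamma> [b, a] []"
    proof (cases a)
      case (Base g)
      then have g: "g \<in> carrier (power_semidirect \<Gamma>)" using a by (auto simp: T1_words_def)
      show ?thesis
        using g Base T1_cong.trans[OF T1_cong.base_mult[of "inv\<^bsub>power_semidirect \<Gamma>\<^esub> g" \<Gamma> g]]
        by (intro exI[of _ "Base (inv\<^bsub>power_semidirect \<Gamma>\<^esub> g)"])
          (auto simp: T1_words_def T1_cong.base_one)
    next
      case (Lam j k)
      then have "1 \<le> j" using a by (auto simp: T1_words_def)
      then show ?thesis
        using Lam T1_cong.trans[OF T1_cong.lam_mult[of j \<Gamma> "- k" k]]
        by (intro exI[of _ "Lam j (- k)"]) (auto simp: T1_words_def T1_cong.lam_one)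
    qed
    then obtain b where b: "[b] \<in> T1_words \<Gamma>" "T1_cong \<Gamma> [b, a] []" by blast
    have "T1_cong \<Gamma> (v @ [b, a] @ u) (v @ [] @ u)"
      using u v b by (intro T1_cong.append T1_cong.refl) auto
    then have "T1_cong \<Gamma> ((v @ [b]) @ a # u) []"
      using v T1_cong.trans by fastforce
    then show ?case using app[OF v(1) b(1)] by blast
  qed
  show "\<exists>y\<in>carrier (T1 \<Gamma>). y \<otimes>\<^bsub>T1 \<Gamma>\<^esub> x = \<one>\<^bsub>T1 \<Gamma>\<^esub>" if x: "x \<in> carrier (T1 \<Gamma>)" for x
  proof -
    obtain u where u: "u \<in> T1_words \<Gamma>" "x = T1_rel \<Gamma> `` {u}" using x by (auto simp: car)
    then obtain v where v: "v \<in> T1_words \<Gamma>" "T1_cong \<Gamma> (v @ u) []" using inv by blast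
    have "T1_rel \<Gamma> `` {v @ u} = T1_rel \<Gamma> `` {[]}"
      using v equiv_class_eq[OF eq] by (simp add: T1_rel_def)
    with u v show ?thesis by (auto simp: car mc one)
  qed
qed


section \<open>Bounded operators on \<open>\<ell>\<^sup>2\<close>\<close>

text \<open>Vectors are functions vanishing off the index set, and operators are functions that are
  \<^const>\<open>undefined\<close> off \<open>\<ell>\<^sup>2\<close>, so that equality of operators is equality of functions.\<close>

definition ell2 :: "'i set \<Rightarrow> ('i \<Rightarrow> complex) set"
  where "ell2 I = {f. (\<forall>x. x \<notin> I \<longrightarrow> f x = 0) \<and> (\<lambda>x. (cmod (f x))\<^sup>2) summable_on I}"

definition ell2_inner :: "'i set \<Rightarrow> ('i \<Rightarrow> complex) \<Rightarrow> ('i \<Rightarrow> complex) \<Rightarrow> complex"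
  where "ell2_inner I f g = (\<Sum>\<^sub>\<infinity>x\<in>I. f x * cnj (g x))"

definition ell2_norm :: "'i set \<Rightarrow> ('i \<Rightarrow> complex) \<Rightarrow> real"
  where "ell2_norm I f = sqrt (\<Sum>\<^sub>\<infinity>x\<in>I. (cmod (f x))\<^sup>2)"

type_synonym 'i ell2_op = "('i \<Rightarrow> complex) \<Rightarrow> ('i \<Rightarrow> complex)"

definition bounded_ops :: "'i set \<Rightarrow> 'i ell2_op set"
  where "bounded_ops I = {T \<in> ell2 I \<rightarrow>\<^sub>E ell2 I.
    (\<forall>f\<in>ell2 I. \<forall>g\<in>ell2 I. T (\<lambda>x. f x + g x) = (\<lambda>x. T f x + T g x)) \<and>
    (\<forall>c. \<forall>f\<in>ell2 I. T (\<lambda>x. c * f x) = (\<lambda>x. c * T f x)) \<and>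
    (\<exists>C. \<forall>f\<in>ell2 I. ell2_norm I (T f) \<le> C * ell2_norm I f)}"

definition op_norm :: "'i set \<Rightarrow> 'i ell2_op \<Rightarrow> real"
  where "op_norm I T = (SUP f\<in>{f \<in> ell2 I. ell2_norm I f \<le> 1}. ell2_norm I (T f))"

definition op_adjoint :: "'i set \<Rightarrow> 'i ell2_op \<Rightarrow> 'i ell2_op"
  where "op_adjoint I T = (THE S. S \<in> bounded_ops I \<and>
    (\<forall>f\<in>ell2 I. \<forall>g\<in>ell2 I. ell2_inner I (T f) g = ell2_inner I f (S g)))"

definition commutant :: "'i set \<Rightarrow> 'i ell2_op set \<Rightarrow> 'i ell2_op set"
  where "commutant I \<S> =
    {T \<in> bounded_ops I. \<forall>S\<in>\<S>. compose (ell2 I) T S = compose (ell2 I) S T}"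


section \<open>Group von Neumann algebras\<close>

text \<open>The signature of tracial von Neumann algebras, as far as the sentences below need it.\<close>

record 'x tracial_algebra = "'x ring" +
  star :: "'x \<Rightarrow> 'x"
  operator_norm :: "'x \<Rightarrow> real"
  vn_trace :: "'x \<Rightarrow> complex"

definition left_translation :: "('g, 'b) monoid_scheme \<Rightarrow> 'g \<Rightarrow> 'g ell2_op"
  where "left_translation G g =
    (\<lambda>f\<in>ell2 (carrier G). \<lambda>x. if x \<in> carrier G then f (inv\<^bsub>G\<^esub> g \<otimes>\<^bsub>G\<^esub> x) else 0)"

definition delta_one :: "('g, 'b) monoid_scheme \<Rightarrow> 'g \<Rightarrow> complex"
  where "delta_one G x = (if x = \<one>\<^bsub>G\<^esub> then 1 else 0)"

text \<open>The von Neumann algebra generated by the left regular representation is realized as its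
  double commutant.\<close>

definition group_vN_algebra :: "('g, 'b) monoid_scheme \<Rightarrow> 'g ell2_op tracial_algebra"
  where "group_vN_algebra G = (let I = carrier G in
    \<lparr>carrier = commutant I (commutant I (left_translation G ` carrier G)),
     mult = compose (ell2 I),
     one = (\<lambda>f\<in>ell2 I. f),
     zero = (\<lambda>f\<in>ell2 I. \<lambda>_. 0),
     add = (\<lambda>S T. \<lambda>f\<in>ell2 I. \<lambda>x. S f x + T f x),
     star = op_adjoint I,
     operator_norm = op_norm I,
     vn_trace = (\<lambda>T. ell2_inner I (T (delta_one G)) (delta_one G))\<rparr>)"


section \<open>The sentences \<open>\<tau>\<^sub>m\<close>\<close>

definition norm2 :: "('x, 'c) tracial_algebra_scheme \<Rightarrow> 'x \<Rightarrow> real"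
  where "norm2 M x = sqrt (Re (vn_trace M (star M x \<otimes>\<^bsub>M\<^esub> x)))"

definition commutator :: "('x, 'c) tracial_algebra_scheme \<Rightarrow> 'x \<Rightarrow> 'x \<Rightarrow> 'x"
  where "commutator M x y = (x \<otimes>\<^bsub>M\<^esub> y) \<ominus>\<^bsub>M\<^esub> (y \<otimes>\<^bsub>M\<^esub> x)"

definition unit_ball :: "('x, 'c) tracial_algebra_scheme \<Rightarrow> 'x set"
  where "unit_ball M = {x \<in> carrier M. operator_norm M x \<le> 1}"

definition unitaries :: "('x, 'c) tracial_algebra_scheme \<Rightarrow> 'x set"
  where "unitaries M =
    {u \<in> carrier M. star M u \<otimes>\<^bsub>M\<^esub> u = \<one>\<^bsub>M\<^esub> \<and> u \<otimes>\<^bsub>M\<^esub> star M u = \<one>\<^bsub>M\<^esub>}"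

definition monus :: "real \<Rightarrow> real \<Rightarrow> real"
  where "monus r s = max (r - s) 0"

definition chi :: "('x, 'c) tracial_algebra_scheme \<Rightarrow> 'x \<Rightarrow> 'x \<Rightarrow> 'x \<Rightarrow> real"
  where "chi M x u1 u2 =
    100 * ((norm2 M (commutator M x u1))\<^sup>2 + (norm2 M (commutator M x u2))\<^sup>2)"

definition psi :: "nat \<Rightarrow> ('x, 'c) tracial_algebra_scheme \<Rightarrow> 'x \<Rightarrow> 'x \<Rightarrow> real"
  where "psi m M va vb =
    (SUP (x, y) \<in> ({1..m} \<rightarrow>\<^sub>E unit_ball M) \<times> ({1..m} \<rightarrow>\<^sub>E unit_ball M).
       monus
         (INF u\<in>unitaries M. MAX (i, j)\<in>{1..m} \<times> {1..m}.
            norm2 M (commutator M (u \<otimes>\<^bsub>M\<^esub> x i \<otimes>\<^bsub>M\<^esub> star M u) (y j)))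
         (2 * (MAX i\<in>{1..m}. sqrt (chi M (x i) va vb))))"

definition tau :: "nat \<Rightarrow> ('x, 'c) tracial_algebra_scheme \<Rightarrow> real"
  where "tau m M = (INF (va, vb) \<in> unitaries M \<times> unitaries M. psi m M va vb)"

end

theory Submission
  imports Defs "HOL-Analysis.L2_Norm"
begin

text \<open>
  Let \<open>C\<close> be the subgroup \<open>\<Oplus>\<^sub>i\<^sub>\<ge>\<^sub>4 \<Gamma>\<^sub>i\<close> of \<open>T\<^sub>1(\<Gamma>)\<close>, let \<open>a\<close> be the 3-cycle \<open>(1 2 3)\<close> in \<open>S\<^sub>\<infinity>\<close>
  and \<open>b\<close> a generator of \<open>\<Lambda>\<^sub>4\<close>; both commute with \<open>C\<close>. The group is an HNN extension of the
  semidirect product with stable letters the generators of the \<open>\<Lambda>\<^sub>j\<close>. Let \<open>F\<close> be the set of elements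
  whose Britton normal form starts with a nonzero power of \<open>b\<close>. Then \<open>F\<close>, \<open>a F a\<inverse>\<close> and \<open>a\<inverse> F a\<close> are
  disjoint, while \<open>F \<union> b F b\<inverse>\<close> is the whole complement of \<open>C\<close>. Such a paradoxical set survives the
  passage to \<open>t\<close> copies (look at the first coordinate outside \<open>C\<close>), and it gives, for the unitaries
  \<open>V\<^sub>a\<close>, \<open>V\<^sub>b\<close> of \<open>a\<close>, \<open>b\<close>, the estimate \<open>\<parallel>X - E\<^sub>C(X)\<parallel>\<^sub>2\<^sup>2 \<le> \<chi>(X, V\<^sub>a, V\<^sub>b)\<close>. On the other hand, for
  finite subsets \<open>A\<close> of \<open>C\<close> and \<open>E\<close> of the group, a permutation far out conjugates \<open>A\<close> into the centralizer
  of \<open>E\<close>. Hence a unitary \<open>U\<close> makes \<open>U E\<^sub>C(X\<^sub>i) U\<^sup>*\<close> almost commute with all \<open>Y\<^sub>j\<close>, and the remainder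
  \<open>X\<^sub>i - E\<^sub>C(X\<^sub>i)\<close> contributes at most twice its 2-norm to the commutators. So \<open>\<psi>\<^sub>m(V\<^sub>a, V\<^sub>b) = 0\<close>.
  Conditional expectations are avoided by arguing with the vectors \<open>X \<delta>\<^sub>1\<close> in \<open>\<ell>\<^sup>2\<close>, restricted to
  subsets of the group.
\<close>

subsection \<open>Square-summable functions\<close>

lemma L2_set_square: "(L2_set f F)\<^sup>2 = (\<Sum>x\<in>F. (f x)\<^sup>2)"
  by (simp add: L2_set_def sum_nonneg)

text \<open>Bounds on finite subsets of the index set suffice for membership and for the norm.
  Through this lemma the \<open>L2_set\<close> inequalities give the triangle inequality, domination
  and the bound for adjoints.\<close>

lemma ell2_bound:
  assumes "\<And>x. x \<notin> I \<Longrightarrow> f x = 0"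
    and "\<And>F. finite F \<Longrightarrow> F \<subseteq> I \<Longrightarrow> L2_set (\<lambda>x. cmod (f x)) F \<le> c"
  shows "f \<in> ell2 I" "ell2_norm I f \<le> c"
proof -
  have c: "0 \<le> c" using assms(2)[of "{}"] by simp
  have b: "(\<Sum>x\<in>F. (cmod (f x))\<^sup>2) \<le> c\<^sup>2" if "finite F" "F \<subseteq> I" for F
    using power_mono[OF assms(2)[OF that] L2_set_nonneg, of 2] by (simp add: L2_set_square)
  have s: "(\<lambda>x. (cmod (f x))\<^sup>2) summable_on I"
    by (rule nonneg_bdd_above_summable_on) (auto intro!: bdd_aboveI b)
  then show "f \<in> ell2 I" using assms(1) by (simp add: ell2_def)
  have "(\<Sum>\<^sub>\<infinity>x\<in>I. (cmod (f x))\<^sup>2) \<le> c\<^sup>2"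
    by (rule infsum_le_finite_sums[OF s]) (use b in auto)
  then show "ell2_norm I f \<le> c"
    unfolding ell2_norm_def using c real_le_lsqrt by blast
qed

lemma ell2_zero_outside: "f \<in> ell2 I \<Longrightarrow> x \<notin> I \<Longrightarrow> f x = 0"
  by (simp add: ell2_def)

lemma ell2_norm_nonneg [simp]: "0 \<le> ell2_norm I f"
  by (simp add: ell2_norm_def infsum_nonneg)

lemma ell2_norm_square: "(ell2_norm I f)\<^sup>2 = (\<Sum>\<^sub>\<infinity>x\<in>I. (cmod (f x))\<^sup>2)"
  by (simp add: ell2_norm_def infsum_nonneg)

lemma L2_set_le_ell2_norm:
  assumes "f \<in> ell2 I" "finite F" "F \<subseteq> I"
  shows "L2_set (\<lambda>x. cmod (f x)) F \<le> ell2_norm I f"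
  unfolding ell2_norm_def L2_set_def
  using assms by (intro real_sqrt_le_mono finite_sum_le_infsum) (auto simp: ell2_def)

lemma ell2_norm_point: "f \<in> ell2 I \<Longrightarrow> cmod (f x) \<le> ell2_norm I f"
  using L2_set_le_ell2_norm[of f I "{x}"] by (cases "x \<in> I") (auto simp: ell2_zero_outside)

lemma ell2_zero [simp]: "(\<lambda>_. 0) \<in> ell2 I" and ell2_norm_zero [simp]: "ell2_norm I (\<lambda>_. 0) = 0"
  by (auto simp: ell2_def ell2_norm_def)

lemma ell2_norm_eq_0: "f \<in> ell2 I \<Longrightarrow> ell2_norm I f = 0 \<Longrightarrow> f = (\<lambda>_. 0)"
  using ell2_norm_point[of f I] by fastforce

lemma ell2_add:
  assumes "f \<in> ell2 I" "g \<in> ell2 I"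
  shows "(\<lambda>x. f x + g x) \<in> ell2 I"
    and "ell2_norm I (\<lambda>x. f x + g x) \<le> ell2_norm I f + ell2_norm I g"
proof -
  have "L2_set (\<lambda>x. cmod (f x + g x)) F \<le> ell2_norm I f + ell2_norm I g"
    if "finite F" "F \<subseteq> I" for F
  proof -
    have "L2_set (\<lambda>x. cmod (f x + g x)) F \<le> L2_set (\<lambda>x. cmod (f x) + cmod (g x)) F"
      by (rule L2_set_mono) (auto simp: norm_triangle_ineq)
    also have "\<dots> \<le> L2_set (\<lambda>x. cmod (f x)) F + L2_set (\<lambda>x. cmod (g x)) F"
      by (rule L2_set_triangle_ineq)
    finally show ?thesis
      using L2_set_le_ell2_norm[OF assms(1) that] L2_set_le_ell2_norm[OF assms(2) that] by linarith
  qed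
  moreover have "f x + g x = 0" if "x \<notin> I" for x
    using assms that by (simp add: ell2_zero_outside)
  ultimately show "(\<lambda>x. f x + g x) \<in> ell2 I"
    and "ell2_norm I (\<lambda>x. f x + g x) \<le> ell2_norm I f + ell2_norm I g"
    using ell2_bound[of I "\<lambda>x. f x + g x" "ell2_norm I f + ell2_norm I g"] by blast+
qed

lemma ell2_scale:
  assumes "f \<in> ell2 I"
  shows "(\<lambda>x. c * f x) \<in> ell2 I" and "ell2_norm I (\<lambda>x. c * f x) = cmod c * ell2_norm I f"
  using assms
  by (auto simp: ell2_def ell2_norm_def norm_mult power_mult_distrib infsum_cmult_right'
      real_sqrt_mult summable_on_cmult_right)

lemma ell2_uminus:
  assumes "f \<in> ell2 I"
  shows "(\<lambda>x. - f x) \<in> ell2 I" and "ell2_norm I (\<lambda>x. - f x) = ell2_norm I f"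
  using ell2_scale[OF assms, of "-1"] by auto

lemma ell2_diff:
  assumes "f \<in> ell2 I" "g \<in> ell2 I"
  shows "(\<lambda>x. f x - g x) \<in> ell2 I"
    and "ell2_norm I (\<lambda>x. f x - g x) \<le> ell2_norm I f + ell2_norm I g"
  using ell2_add[OF assms(1) ell2_uminus(1)[OF assms(2)]] ell2_uminus(2)[OF assms(2)]
  by (simp_all)

lemma ell2_norm_diff_le:
  assumes "f \<in> ell2 I" "g \<in> ell2 I"
  shows "\<bar>ell2_norm I f - ell2_norm I g\<bar> \<le> ell2_norm I (\<lambda>x. f x - g x)"
proof -
  have "ell2_norm I f \<le> ell2_norm I (\<lambda>x. f x - g x) + ell2_norm I g"
    using ell2_add(2)[OF ell2_diff(1)[OF assms] assms(2)] by simp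
  moreover have "ell2_norm I g \<le> ell2_norm I (\<lambda>x. f x - g x) + ell2_norm I f"
    using ell2_add(2)[OF ell2_uminus(1)[OF ell2_diff(1)[OF assms]] assms(1)]
      ell2_uminus(2)[OF ell2_diff(1)[OF assms]] by simp
  ultimately show ?thesis by linarith
qed

lemma ell2_sum:
  assumes "\<And>a. a \<in> A \<Longrightarrow> f a \<in> ell2 I"
  shows "(\<lambda>x. \<Sum>a\<in>A. f a x) \<in> ell2 I"
    and "ell2_norm I (\<lambda>x. \<Sum>a\<in>A. f a x) \<le> (\<Sum>a\<in>A. ell2_norm I (f a))"
  using assms
proof (induction A rule: infinite_finite_induct)
  case (insert a A)
  have f: "f a \<in> ell2 I" and F: "(\<lambda>x. \<Sum>a\<in>A. f a x) \<in> ell2 I"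
    and le: "ell2_norm I (\<lambda>x. \<Sum>a\<in>A. f a x) \<le> (\<Sum>a\<in>A. ell2_norm I (f a))"
    if "\<And>b. b \<in> insert a A \<Longrightarrow> f b \<in> ell2 I"
    using insert that by simp_all
  { case 1 then show ?case using ell2_add(1)[OF f F] insert(1,2) by simp }
  { case 2 then show ?case using ell2_add(2)[OF f F] le insert(1,2) by simp }
qed auto

lemma ell2_dominated:
  assumes "f \<in> ell2 I" "\<And>x. cmod (g x) \<le> cmod (f x)"
  shows "g \<in> ell2 I" and "ell2_norm I g \<le> ell2_norm I f"
proof -
  have "L2_set (\<lambda>x. cmod (g x)) F \<le> ell2_norm I f" if "finite F" "F \<subseteq> I" for F
    using L2_set_mono[of F "\<lambda>x. cmod (g x)" "\<lambda>x. cmod (f x)"]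
      L2_set_le_ell2_norm[OF assms(1) that] assms(2)
    by auto
  moreover have "g x = 0" if "x \<notin> I" for x
    using assms(2)[of x] ell2_zero_outside[OF assms(1) that] by simp
  ultimately show "g \<in> ell2 I" and "ell2_norm I g \<le> ell2_norm I f"
    using ell2_bound[of I g "ell2_norm I f"] by blast+
qed

lemma ell2_reindex:
  assumes p: "bij_betw p I I" and f: "f \<in> ell2 I"
  shows "(\<lambda>x. if x \<in> I then f (p x) else 0) \<in> ell2 I"
    and "ell2_norm I (\<lambda>x. if x \<in> I then f (p x) else 0) = ell2_norm I f"
proof -
  have "(\<lambda>x. (cmod (f x))\<^sup>2) summable_on I" using f by (simp add: ell2_def)
  then have "(\<lambda>x. (cmod (f (p x)))\<^sup>2) summable_on I"
    using summable_on_reindex_bij_betw[OF p, of "\<lambda>x. (cmod (f x))\<^sup>2"] by simp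
  then show "(\<lambda>x. if x \<in> I then f (p x) else 0) \<in> ell2 I"
    by (simp add: ell2_def cong: summable_on_cong)
  show "ell2_norm I (\<lambda>x. if x \<in> I then f (p x) else 0) = ell2_norm I f"
    using infsum_reindex_bij_betw[OF p, of "\<lambda>x. (cmod (f x))\<^sup>2"]
    by (simp add: ell2_norm_def cong: infsum_cong)
qed

text \<open>The orthogonal projection onto the functions supported in \<open>A\<close>. If
  \<open>A\<close> is a subgroup, it takes the vector of an operator \<open>X\<close> to the vector
  of the conditional expectation of \<open>X\<close> onto the algebra of \<open>A\<close>.\<close>

definition restr :: "'i set \<Rightarrow> ('i \<Rightarrow> complex) \<Rightarrow> 'i \<Rightarrow> complex"
  where "restr A f = (\<lambda>x. if x \<in> A then f x else 0)"

lemma ell2_restr: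
  assumes "f \<in> ell2 I"
  shows "restr A f \<in> ell2 I" and "ell2_norm I (restr A f) \<le> ell2_norm I f"
  using ell2_dominated[OF assms, of "restr A f"] by (auto simp: restr_def)

lemma ell2_restr_mono:
  assumes "f \<in> ell2 I" "A \<subseteq> B"
  shows "ell2_norm I (restr A f) \<le> ell2_norm I (restr B f)"
  using assms by (intro ell2_dominated(2) ell2_restr) (auto simp: restr_def)

lemma ell2_norm_restr_square:
  "(ell2_norm I (restr A f))\<^sup>2 = (\<Sum>\<^sub>\<infinity>x\<in>I \<inter> A. (cmod (f x))\<^sup>2)"
  unfolding ell2_norm_square by (rule infsum_cong_neutral) (auto simp: restr_def)

lemma ell2_norm_restr_Un:
  assumes "f \<in> ell2 I" "A \<inter> B = {}"
  shows "(ell2_norm I (restr (A \<union> B) f))\<^sup>2 = (ell2_norm I (restr A f))\<^sup>2 + (ell2_norm I (restr B f))\<^sup>2"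
proof -
  have s: "(\<lambda>x. (cmod (f x))\<^sup>2) summable_on I \<inter> A" for A
    by (rule summable_on_subset_banach[where A = I]) (use assms(1) in \<open>auto simp: ell2_def\<close>)
  show ?thesis
    unfolding ell2_norm_restr_square Int_Un_distrib using assms(2) s
    by (intro infsum_Un_disjoint) auto
qed

lemma ell2_norm_restr_Un_le:
  assumes "f \<in> ell2 I"
  shows "(ell2_norm I (restr (A \<union> B) f))\<^sup>2 \<le> (ell2_norm I (restr A f))\<^sup>2 + (ell2_norm I (restr B f))\<^sup>2"
proof -
  have "(ell2_norm I (restr (A \<union> B) f))\<^sup>2 = (ell2_norm I (restr A f))\<^sup>2 + (ell2_norm I (restr (B - A) f))\<^sup>2"
    using ell2_norm_restr_Un[OF assms, of A "B - A"] by simp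
  moreover have "(ell2_norm I (restr (B - A) f))\<^sup>2 \<le> (ell2_norm I (restr B f))\<^sup>2"
    by (intro power_mono ell2_restr_mono assms) auto
  ultimately show ?thesis by simp
qed

lemma ell2_finite_approx:
  assumes "f \<in> ell2 I" "0 < e"
  obtains F where "finite F" "F \<subseteq> I" "ell2_norm I (\<lambda>x. f x - restr F f x) \<le> e"
proof -
  have s: "(\<lambda>x. (cmod (f x))\<^sup>2) summable_on I" using assms by (simp add: ell2_def)
  obtain F where F: "finite F" "F \<subseteq> I"
    and d: "dist (\<Sum>x\<in>F. (cmod (f x))\<^sup>2) (\<Sum>\<^sub>\<infinity>x\<in>I. (cmod (f x))\<^sup>2) \<le> e\<^sup>2"
    using infsum_finite_approximation[OF s, of "e\<^sup>2"] assms(2) by auto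
  \<comment> \<open>The error is the restriction to the complement of \<open>F\<close>, so
    Pythagoras turns closeness of the sums of squares into closeness in norm.\<close>
  have eq: "(\<lambda>x. f x - restr F f x) = restr (- F) f" by (auto simp: restr_def)
  have "restr (F \<union> - F) f = f" by (auto simp: restr_def)
  then have "(ell2_norm I f)\<^sup>2 = (ell2_norm I (restr F f))\<^sup>2 + (ell2_norm I (restr (- F) f))\<^sup>2"
    using ell2_norm_restr_Un[OF assms(1), of F "- F"] by simp
  moreover have "(ell2_norm I (restr F f))\<^sup>2 = (\<Sum>x\<in>F. (cmod (f x))\<^sup>2)"
    using F by (simp add: ell2_norm_restr_square Int_absorb1)
  ultimately have "(ell2_norm I (restr (- F) f))\<^sup>2 \<le> e\<^sup>2"
    using d unfolding ell2_norm_square[of I f] dist_real_def by linarith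
  then have "ell2_norm I (\<lambda>x. f x - restr F f x) \<le> e"
    unfolding eq by (rule power2_le_imp_le) (use assms(2) in simp)
  then show ?thesis by (rule that[OF F])
qed

subsection \<open>The inner product\<close>

lemma ell2_inner_summable:
  assumes "f \<in> ell2 I" "g \<in> ell2 I"
  shows "(\<lambda>x. f x * cnj (g x)) abs_summable_on I"
    and "cmod (ell2_inner I f g) \<le> ell2_norm I f * ell2_norm I g"
proof -
  have b: "(\<Sum>x\<in>F. cmod (f x * cnj (g x))) \<le> ell2_norm I f * ell2_norm I g"
    if "finite F" "F \<subseteq> I" for F
  proof -
    have "(\<Sum>x\<in>F. cmod (f x * cnj (g x))) \<le>
        L2_set (\<lambda>x. cmod (f x)) F * L2_set (\<lambda>x. cmod (g x)) F"
      using L2_set_mult_ineq[of "\<lambda>x. cmod (f x)" "\<lambda>x. cmod (g x)" F] by (simp add: norm_mult)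
    also have "\<dots> \<le> ell2_norm I f * ell2_norm I g"
      using that assms by (intro mult_mono L2_set_le_ell2_norm) auto
    finally show ?thesis .
  qed
  show s: "(\<lambda>x. f x * cnj (g x)) abs_summable_on I"
    by (rule nonneg_bdd_above_summable_on) (auto intro!: bdd_aboveI b)
  have "cmod (ell2_inner I f g) \<le> (\<Sum>\<^sub>\<infinity>x\<in>I. cmod (f x * cnj (g x)))"
    unfolding ell2_inner_def by (rule norm_infsum_bound[OF s])
  also have "\<dots> \<le> ell2_norm I f * ell2_norm I g"
    by (rule infsum_le_finite_sums[OF s]) (use b in auto)
  finally show "cmod (ell2_inner I f g) \<le> ell2_norm I f * ell2_norm I g" .
qed

lemma ell2_inner_add_left:
  assumes "f \<in> ell2 I" "f' \<in> ell2 I" "g \<in> ell2 I"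
  shows "ell2_inner I (\<lambda>x. f x + f' x) g = ell2_inner I f g + ell2_inner I f' g"
  using infsum_add[OF abs_summable_summable[OF ell2_inner_summable(1)[OF assms(1,3)]]
      abs_summable_summable[OF ell2_inner_summable(1)[OF assms(2,3)]]]
  by (simp add: ell2_inner_def distrib_right)

lemma ell2_inner_scale_left:
  "ell2_inner I (\<lambda>x. c * f x) g = c * ell2_inner I f g"
  unfolding ell2_inner_def by (simp add: mult.assoc infsum_cmult_right')

lemma ell2_inner_diff_left:
  assumes "f \<in> ell2 I" "f' \<in> ell2 I" "g \<in> ell2 I"
  shows "ell2_inner I (\<lambda>x. f x - f' x) g = ell2_inner I f g - ell2_inner I f' g"
  using ell2_inner_add_left[OF assms(1) ell2_uminus(1)[OF assms(2)] assms(3)]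
    ell2_inner_scale_left[of I "-1" f' g] by simp

lemma ell2_inner_cnj: "ell2_inner I g f = cnj (ell2_inner I f g)"
  unfolding ell2_inner_def infsum_cnj[symmetric] by (simp add: mult.commute)

lemma ell2_inner_self:
  assumes "f \<in> ell2 I"
  shows "ell2_inner I f f = of_real ((ell2_norm I f)\<^sup>2)"
proof -
  have "((\<lambda>x. (cmod (f x))\<^sup>2) has_sum (ell2_norm I f)\<^sup>2) I"
    unfolding ell2_norm_square using assms by (intro has_sum_infsum) (simp add: ell2_def)
  then have "((\<lambda>x. f x * cnj (f x)) has_sum of_real ((ell2_norm I f)\<^sup>2)) I"
    unfolding complex_norm_square[symmetric] by (rule has_sum_of_real)
  then show ?thesis
    unfolding ell2_inner_def by (rule infsumI)
qed

lemma ell2_inner_sum_left: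
  assumes "\<And>a. a \<in> A \<Longrightarrow> f a \<in> ell2 I" "g \<in> ell2 I"
  shows "ell2_inner I (\<lambda>x. \<Sum>a\<in>A. f a x) g = (\<Sum>a\<in>A. ell2_inner I (f a) g)"
  using assms
  by (induction A rule: infinite_finite_induct)
    (auto simp: ell2_inner_add_left ell2_sum ell2_inner_def[of I "\<lambda>_. 0"])

definition delta :: "'i \<Rightarrow> 'i \<Rightarrow> complex"
  where "delta a = (\<lambda>x. if x = a then 1 else 0)"

lemma delta_ell2 [simp]: "a \<in> I \<Longrightarrow> delta a \<in> ell2 I"
  and ell2_norm_delta [simp]: "a \<in> I \<Longrightarrow> ell2_norm I (delta a) = 1"
proof -
  assume a: "a \<in> I"
  have eq: "(\<lambda>x. (cmod (delta a x))\<^sup>2) = (\<lambda>x. if x = a then 1 else 0)"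
    by (auto simp: delta_def)
  have "((\<lambda>x. (cmod (delta a x))\<^sup>2) has_sum 1) I"
    by (rule has_sum_finite_neutralI[of "{a}"]) (use a in \<open>auto simp: delta_def\<close>)
  then show "delta a \<in> ell2 I" "ell2_norm I (delta a) = 1"
    using a by (auto simp: ell2_def ell2_norm_def has_sum_iff delta_def)
qed

lemma ell2_inner_delta: "a \<in> I \<Longrightarrow> ell2_inner I f (delta a) = f a"
  unfolding ell2_inner_def
  by (intro infsumI has_sum_finite_neutralI[of "{a}"]) (auto simp: delta_def)

lemma restr_finite_eq_sum:
  "finite F \<Longrightarrow> restr F f = (\<lambda>x. \<Sum>a\<in>F. f a * delta a x)"
proof
  fix x assume F: "finite F"
  have "(\<Sum>a\<in>F. f a * delta a x) = (\<Sum>a\<in>F. if x = a then f a else 0)"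
    by (rule sum.cong) (auto simp: delta_def)
  then show "restr F f x = (\<Sum>a\<in>F. f a * delta a x)"
    using F by (simp add: restr_def)
qed

subsection \<open>Bounded operators and adjoints\<close>

context
  fixes I :: "'i set" and T :: "'i ell2_op"
  assumes T: "T \<in> bounded_ops I"
begin

lemma bounded_ops_closed: "f \<in> ell2 I \<Longrightarrow> T f \<in> ell2 I"
  using T by (auto simp: bounded_ops_def)

lemma bounded_ops_extensional: "T \<in> extensional (ell2 I)"
  using T by (auto simp: bounded_ops_def PiE_def)

lemma bounded_ops_add:
  "f \<in> ell2 I \<Longrightarrow> g \<in> ell2 I \<Longrightarrow> T (\<lambda>x. f x + g x) = (\<lambda>x. T f x + T g x)"
  using T by (simp add: bounded_ops_def)

lemma bounded_ops_scale: "f \<in> ell2 I \<Longrightarrow> T (\<lambda>x. c * f x) = (\<lambda>x. c * T f x)"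
  using T by (simp add: bounded_ops_def)

lemma bounded_ops_zero: "T (\<lambda>_. 0) = (\<lambda>_. 0)"
  using bounded_ops_scale[of "\<lambda>_. 0" 0] by simp

lemma bounded_ops_diff:
  "f \<in> ell2 I \<Longrightarrow> g \<in> ell2 I \<Longrightarrow> T (\<lambda>x. f x - g x) = (\<lambda>x. T f x - T g x)"
  using bounded_ops_add[of f "\<lambda>x. - g x"] bounded_ops_scale[of g "-1"] ell2_uminus(1)[of g I]
  by simp

lemma bounded_ops_sum:
  assumes "\<And>a. a \<in> A \<Longrightarrow> f a \<in> ell2 I"
  shows "T (\<lambda>x. \<Sum>a\<in>A. f a x) = (\<lambda>x. \<Sum>a\<in>A. T (f a) x)"
  using assms
proof (induction A rule: infinite_finite_induct)
  case (insert a A)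
  then have "T (\<lambda>x. f a x + (\<Sum>a\<in>A. f a x)) = (\<lambda>x. T (f a) x + T (\<lambda>x. \<Sum>a\<in>A. f a x) x)"
    using ell2_sum(1)[of A f I] by (intro bounded_ops_add) auto
  with insert show ?case by simp
qed (simp_all add: bounded_ops_zero)

text \<open>A supremum of reals dominates its members only if the set is bounded, which the constant
  \<open>C\<close> from \<open>bounded_ops\<close> ensures; scaling \<open>f\<close> to norm 1 then
  gives the inequality.\<close>

lemma op_norm_bound:
  assumes f: "f \<in> ell2 I"
  shows "ell2_norm I (T f) \<le> op_norm I T * ell2_norm I f"
proof (cases "ell2_norm I f = 0")
  case True
  then show ?thesis using f ell2_norm_eq_0 bounded_ops_zero by fastforce
next
  case False
  obtain C where C: "\<And>f. f \<in> ell2 I \<Longrightarrow> ell2_norm I (T f) \<le> C * ell2_norm I f"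
    using T unfolding bounded_ops_def by blast
  have bdd: "bdd_above ((\<lambda>f. ell2_norm I (T f)) ` {f \<in> ell2 I. ell2_norm I f \<le> 1})"
  proof (rule bdd_aboveI2)
    fix f assume f: "f \<in> {f \<in> ell2 I. ell2_norm I f \<le> 1}"
    then have "ell2_norm I (T f) \<le> C * ell2_norm I f" using C by simp
    also have "\<dots> \<le> \<bar>C\<bar> * 1" using f by (intro mult_mono) auto
    finally show "ell2_norm I (T f) \<le> \<bar>C\<bar>" by simp
  qed
  define c where "c = ell2_norm I f"
  have c: "c > 0" using False unfolding c_def by (simp add: order_less_le)
  let ?g = "\<lambda>x. of_real (1 / c) * f x"
  have "ell2_norm I ?g = 1"
    using ell2_scale(2)[OF f, of "of_real (1 / c)"] c
    by (simp add: c_def[symmetric] norm_divide)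
  then have "?g \<in> {f \<in> ell2 I. ell2_norm I f \<le> 1}"
    using ell2_scale(1)[OF f, of "of_real (1 / c)"] by simp
  then have "ell2_norm I (T ?g) \<le> op_norm I T"
    unfolding op_norm_def by (rule cSUP_upper[OF _ bdd])
  moreover have "ell2_norm I (T ?g) = 1 / c * ell2_norm I (T f)"
    using ell2_scale(2)[OF bounded_ops_closed[OF f], of "of_real (1 / c)"] c
    unfolding bounded_ops_scale[OF f] by (simp add: norm_divide)
  ultimately have "1 / c * ell2_norm I (T f) \<le> op_norm I T" by simp
  then show ?thesis using c by (simp add: c_def[symmetric] field_simps)
qed

lemma op_norm_nonneg: "0 \<le> op_norm I T" if "I \<noteq> {}"
proof -
  obtain a where "a \<in> I" using \<open>I \<noteq> {}\<close> by blast
  then have "ell2_norm I (T (delta a)) \<le> op_norm I T"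
    using op_norm_bound[of "delta a"] by simp
  then show ?thesis using ell2_norm_nonneg[of I "T (delta a)"] by linarith
qed

end

lemma bounded_opsI:
  assumes "T \<in> extensional (ell2 I)"
    and "\<And>f. f \<in> ell2 I \<Longrightarrow> T f \<in> ell2 I"
    and "\<And>f g. f \<in> ell2 I \<Longrightarrow> g \<in> ell2 I \<Longrightarrow> T (\<lambda>x. f x + g x) = (\<lambda>x. T f x + T g x)"
    and "\<And>c f. f \<in> ell2 I \<Longrightarrow> T (\<lambda>x. c * f x) = (\<lambda>x. c * T f x)"
    and "\<And>f. f \<in> ell2 I \<Longrightarrow> ell2_norm I (T f) \<le> c * ell2_norm I f"
  shows "T \<in> bounded_ops I"
  using assms unfolding bounded_ops_def PiE_def by blast

lemma bounded_ops_eqI: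
  assumes "S \<in> bounded_ops I" "T \<in> bounded_ops I"
    and "\<And>f y. f \<in> ell2 I \<Longrightarrow> y \<in> I \<Longrightarrow> S f y = T f y"
  shows "S = T"
proof (rule extensionalityI)
  show "S \<in> extensional (ell2 I)" "T \<in> extensional (ell2 I)"
    using assms bounded_ops_extensional by blast+
  show "S f = T f" if "f \<in> ell2 I" for f
    using that assms by (metis bounded_ops_closed ell2_zero_outside ext)
qed

lemma bounded_ops_compose:
  assumes S: "S \<in> bounded_ops I" and T: "T \<in> bounded_ops I"
  shows "compose (ell2 I) S T \<in> bounded_ops I"
\<comment> \<open>The constant \<open>op_norm I S * op_norm I T\<close> relies on
  \<open>op_norm_nonneg\<close>, hence on a nonempty index set; over the empty one zero is the only
  vector.\<close>
proof (cases "I = {}")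
  case True
  then have "ell2 I = {\<lambda>_. 0}" by (auto simp: ell2_def)
  with True S T show ?thesis
    by (auto simp: compose_def bounded_ops_def ell2_norm_def)
next
  case False
  show ?thesis
  proof (rule bounded_opsI[where c = "op_norm I S * op_norm I T"])
    fix f assume f: "f \<in> ell2 I"
    have "ell2_norm I (S (T f)) \<le> op_norm I S * ell2_norm I (T f)"
      by (intro op_norm_bound S bounded_ops_closed[OF T] f)
    also have "\<dots> \<le> op_norm I S * (op_norm I T * ell2_norm I f)"
      by (intro mult_left_mono op_norm_bound T f op_norm_nonneg S False)
    finally show "ell2_norm I (compose (ell2 I) S T f) \<le> op_norm I S * op_norm I T * ell2_norm I f"
      using f by (simp add: compose_def mult.assoc)
  qed (simp_all add: compose_def bounded_ops_closed[OF S] bounded_ops_closed[OF T]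
      bounded_ops_add[OF S] bounded_ops_add[OF T] bounded_ops_scale[OF S] bounded_ops_scale[OF T]
      ell2_add ell2_scale)
qed

lemma bounded_ops_add_op:
  assumes S: "S \<in> bounded_ops I" and T: "T \<in> bounded_ops I"
  shows "(\<lambda>f\<in>ell2 I. \<lambda>x. S f x + T f x) \<in> bounded_ops I"
proof (rule bounded_opsI[where c = "op_norm I S + op_norm I T"])
  fix f assume f: "f \<in> ell2 I"
  have "ell2_norm I (\<lambda>x. S f x + T f x) \<le> ell2_norm I (S f) + ell2_norm I (T f)"
    by (intro ell2_add bounded_ops_closed[OF S] bounded_ops_closed[OF T] f)
  with op_norm_bound[OF S f] op_norm_bound[OF T f]
  show "ell2_norm I ((\<lambda>f\<in>ell2 I. \<lambda>x. S f x + T f x) f) \<le> (op_norm I S + op_norm I T) * ell2_norm I f"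
    using f by (simp add: distrib_right)
qed (auto simp: ell2_add ell2_scale bounded_ops_closed[OF S] bounded_ops_closed[OF T]
      bounded_ops_add[OF S] bounded_ops_add[OF T] bounded_ops_scale[OF S] bounded_ops_scale[OF T]
      distrib_left)

lemma bounded_ops_uminus:
  assumes T: "T \<in> bounded_ops I"
  shows "(\<lambda>f\<in>ell2 I. \<lambda>x. - T f x) \<in> bounded_ops I"
proof (rule bounded_opsI[where c = "op_norm I T"])
  fix f assume f: "f \<in> ell2 I"
  show "ell2_norm I ((\<lambda>f\<in>ell2 I. \<lambda>x. - T f x) f) \<le> op_norm I T * ell2_norm I f"
    using op_norm_bound[OF T f] f ell2_uminus(2)[OF bounded_ops_closed[OF T f]] by simp
qed (auto simp: ell2_add ell2_scale ell2_uminus bounded_ops_closed[OF T]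
      bounded_ops_add[OF T] bounded_ops_scale[OF T])

lemma op_adjoint_exists:
  assumes T: "T \<in> bounded_ops I"
  obtains S where "S \<in> bounded_ops I"
    and "\<And>f g. f \<in> ell2 I \<Longrightarrow> g \<in> ell2 I \<Longrightarrow> ell2_inner I (T f) g = ell2_inner I f (S g)"
    and "\<And>g. g \<in> ell2 I \<Longrightarrow> ell2_norm I (S g) \<le> op_norm I T * ell2_norm I g"
proof -
  \<comment> \<open>Forced by the adjoint identity at \<open>f = delta y\<close>, since pairing with
    \<open>delta y\<close> reads off a coordinate.\<close>
  define S where
    "S = (\<lambda>g\<in>ell2 I. \<lambda>y. if y \<in> I then ell2_inner I g (T (delta y)) else 0)"
  have S_apply: "S g y = ell2_inner I g (T (delta y))" if "g \<in> ell2 I" "y \<in> I" for g y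
    using that by (simp add: S_def)
  have fin_ell2: "restr A f \<in> ell2 I" if "finite A" "A \<subseteq> I" for A f
    unfolding restr_finite_eq_sum[OF that(1)] using that by (intro ell2_sum ell2_scale) auto
  \<comment> \<open>On finitely supported vectors the adjoint identity is finite linearity. It
    serves first to bound \<open>S g\<close> and is then extended by density.\<close>
  have fin: "ell2_inner I (T (restr A f)) g = (\<Sum>y\<in>A. f y * cnj (S g y))"
    if A: "finite A" "A \<subseteq> I" and g: "g \<in> ell2 I" for A f g
  proof -
    have "T (restr A f) = (\<lambda>x. \<Sum>y\<in>A. f y * T (delta y) x)"
      unfolding restr_finite_eq_sum[OF A(1)]
      using A by (subst bounded_ops_sum[OF T])
        (auto simp: ell2_scale bounded_ops_scale[OF T] subset_iff intro!: sum.cong)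
    then have "ell2_inner I (T (restr A f)) g = (\<Sum>y\<in>A. f y * ell2_inner I (T (delta y)) g)"
      using A g ell2_inner_sum_left[of A "\<lambda>y x. f y * T (delta y) x" I g]
      by (auto simp: ell2_scale bounded_ops_closed[OF T] ell2_inner_scale_left subset_iff)
    also have "\<dots> = (\<Sum>y\<in>A. f y * cnj (S g y))"
      using A g by (intro sum.cong refl) (auto simp: S_apply ell2_inner_cnj[of I g])
    finally show ?thesis .
  qed
  have bound: "S g \<in> ell2 I \<and> ell2_norm I (S g) \<le> op_norm I T * ell2_norm I g" if g: "g \<in> ell2 I" for g
  proof -
    have "L2_set (\<lambda>y. cmod (S g y)) A \<le> op_norm I T * ell2_norm I g" if A: "finite A" "A \<subseteq> I" for A
    proof -
      \<comment> \<open>Testing \<open>T\<close> on the restriction of \<open>S g\<close> itself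
        gives \<open>L\<^sup>2 \<le> op_norm I T * L * ell2_norm I g\<close>; dividing by
        \<open>L\<close> bounds \<open>S g\<close>.\<close>
      define L where "L = L2_set (\<lambda>y. cmod (S g y)) A"
      have "(ell2_norm I (restr A (S g)))\<^sup>2 = L\<^sup>2"
        using A by (simp add: ell2_norm_restr_square L_def L2_set_square Int_absorb1)
      then have n: "ell2_norm I (restr A (S g)) = L"
        by (simp add: L_def)
      have "complex_of_real (L\<^sup>2) = ell2_inner I (T (restr A (S g))) g"
        unfolding fin[OF A g] complex_norm_square[symmetric] by (simp add: L_def L2_set_square)
      then have "L\<^sup>2 = cmod (ell2_inner I (T (restr A (S g))) g)"
        by (metis norm_of_real abs_power2)
      also have "\<dots> \<le> ell2_norm I (T (restr A (S g))) * ell2_norm I g"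
        by (intro ell2_inner_summable bounded_ops_closed[OF T] fin_ell2 A g)
      also have "\<dots> \<le> op_norm I T * L * ell2_norm I g"
        using op_norm_bound[OF T fin_ell2[OF A], of "S g"] by (intro mult_right_mono) (auto simp: n)
      finally have *: "L * L \<le> (op_norm I T * ell2_norm I g) * L"
        by (simp add: power2_eq_square mult_ac)
      have "0 \<le> L" by (simp add: L_def)
      show ?thesis
      proof (cases "L = 0")
        case True
        have "0 \<le> op_norm I T * ell2_norm I g"
          using op_norm_bound[OF T g] ell2_norm_nonneg order_trans by blast
        with True show ?thesis by (simp add: L_def)
      next
        case False
        with * \<open>0 \<le> L\<close> have "L \<le> op_norm I T * ell2_norm I g"
          by (simp add: mult_le_cancel_right)
        then show ?thesis by (simp add: L_def)
      qed
    qed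
    moreover have "S g y = 0" if "y \<notin> I" for y using that g by (simp add: S_def)
    ultimately show ?thesis using ell2_bound[of I "S g"] by blast
  qed
  have "S \<in> bounded_ops I"
  proof (rule bounded_opsI[where c = "op_norm I T"])
    fix f g assume "f \<in> ell2 I" "g \<in> ell2 I"
    then show "S (\<lambda>x. f x + g x) = (\<lambda>x. S f x + S g x)"
      by (auto simp: S_def ell2_add fun_eq_iff intro!: ell2_inner_add_left bounded_ops_closed[OF T])
  next
    fix c f assume "f \<in> ell2 I"
    then show "S (\<lambda>x. c * f x) = (\<lambda>x. c * S f x)"
      by (auto simp: S_def ell2_scale fun_eq_iff ell2_inner_scale_left)
  qed (use bound in \<open>auto simp: S_def\<close>)
  moreover have "ell2_inner I (T f) g = ell2_inner I f (S g)" if f: "f \<in> ell2 I" and g: "g \<in> ell2 I" for f g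
  proof -
    \<comment> \<open>Both sides of the identity change by at most \<open>K\<close> times the norm
      of the truncation error in total; the summand 1 makes \<open>K\<close> positive, so that
      \<open>e / K\<close> is a legitimate precision.\<close>
    define K where "K = 2 * op_norm I T * ell2_norm I g + 1"
    have "0 \<le> op_norm I T * ell2_norm I g"
      using op_norm_bound[OF T g] ell2_norm_nonneg order_trans by blast
    then have K: "K > 0" by (simp add: K_def)
    have Sg: "S g \<in> ell2 I" using bound g by blast
    have "cmod (ell2_inner I (T f) g - ell2_inner I f (S g)) \<le> 0 + e" if e: "e > 0" for e
    proof -
      obtain A where A: "finite A" "A \<subseteq> I" and le: "ell2_norm I (\<lambda>x. f x - restr A f x) \<le> e / K"
        using ell2_finite_approx[OF f, of "e / K"] e K by auto
      let ?r = "\<lambda>x. f x - restr A f x"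
      have r: "?r \<in> ell2 I" by (intro ell2_diff f fin_ell2 A)
      have "ell2_inner I (restr A f) (S g) = (\<Sum>y\<in>A. f y * cnj (S g y))"
        unfolding ell2_inner_def using A
        by (intro infsumI has_sum_finite_neutralI[of A]) (auto simp: restr_def)
      then have "ell2_inner I (T f) g - ell2_inner I f (S g) = ell2_inner I (T ?r) g - ell2_inner I ?r (S g)"
        by (simp add: bounded_ops_diff[OF T f fin_ell2[OF A]] ell2_inner_diff_left
            bounded_ops_closed[OF T] f g Sg fin_ell2[OF A] fin[OF A g])
      also have "cmod \<dots> \<le> cmod (ell2_inner I (T ?r) g) + cmod (ell2_inner I ?r (S g))"
        by (rule norm_triangle_ineq4)
      also have "\<dots> \<le> ell2_norm I (T ?r) * ell2_norm I g + ell2_norm I ?r * ell2_norm I (S g)"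
        by (intro add_mono ell2_inner_summable r g Sg bounded_ops_closed[OF T])
      also have "\<dots> \<le> (op_norm I T * ell2_norm I ?r) * ell2_norm I g
          + ell2_norm I ?r * (op_norm I T * ell2_norm I g)"
        using bound g by (intro add_mono mult_left_mono mult_right_mono op_norm_bound T r) auto
      also have "\<dots> \<le> ell2_norm I ?r * K"
        by (simp add: K_def algebra_simps)
      also have "\<dots> \<le> e / K * K"
        using le K by (intro mult_right_mono) auto
      finally show ?thesis using K by simp
    qed
    then have "cmod (ell2_inner I (T f) g - ell2_inner I f (S g)) \<le> 0"
      by (rule field_le_epsilon)
    then show ?thesis by simp
  qed
  ultimately show ?thesis using that bound by blast
qed

lemma op_adjoint_eqI:
  assumes S: "S \<in> bounded_ops I"
    and eq: "\<And>f g. f \<in> ell2 I \<Longrightarrow> g \<in> ell2 I \<Longrightarrow> ell2_inner I (T f) g = ell2_inner I f (S g)"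
  shows "op_adjoint I T = S"
  unfolding op_adjoint_def
proof (rule the_equality)
  fix S' assume S': "S' \<in> bounded_ops I \<and>
    (\<forall>f\<in>ell2 I. \<forall>g\<in>ell2 I. ell2_inner I (T f) g = ell2_inner I f (S' g))"
  show "S' = S"
  proof (rule bounded_ops_eqI)
    fix g y assume "g \<in> ell2 I" "y \<in> I"
    then have "ell2_inner I (delta y) (S' g) = ell2_inner I (delta y) (S g)"
      using S' eq by simp
    then have "ell2_inner I (S' g) (delta y) = ell2_inner I (S g) (delta y)"
      by (metis ell2_inner_cnj)
    then show "S' g y = S g y" using \<open>y \<in> I\<close> by (simp add: ell2_inner_delta)
  qed (use S S' in auto)
qed (use S eq in blast)

lemma op_adjoint:
  assumes T: "T \<in> bounded_ops I"
  shows op_adjoint_bounded: "op_adjoint I T \<in> bounded_ops I"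
    and op_adjoint_inner: "f \<in> ell2 I \<Longrightarrow> g \<in> ell2 I \<Longrightarrow>
      ell2_inner I (T f) g = ell2_inner I f (op_adjoint I T g)"
    and op_adjoint_norm: "g \<in> ell2 I \<Longrightarrow>
      ell2_norm I (op_adjoint I T g) \<le> op_norm I T * ell2_norm I g"
proof -
  obtain S where S: "S \<in> bounded_ops I"
    "\<And>f g. f \<in> ell2 I \<Longrightarrow> g \<in> ell2 I \<Longrightarrow> ell2_inner I (T f) g = ell2_inner I f (S g)"
    "\<And>g. g \<in> ell2 I \<Longrightarrow> ell2_norm I (S g) \<le> op_norm I T * ell2_norm I g"
    using op_adjoint_exists[OF T] by blast
  moreover have "op_adjoint I T = S" using S by (intro op_adjoint_eqI) auto
  ultimately show "op_adjoint I T \<in> bounded_ops I"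
    "f \<in> ell2 I \<Longrightarrow> g \<in> ell2 I \<Longrightarrow> ell2_inner I (T f) g = ell2_inner I f (op_adjoint I T g)"
    "g \<in> ell2 I \<Longrightarrow> ell2_norm I (op_adjoint I T g) \<le> op_norm I T * ell2_norm I g"
    by auto
qed

subsection \<open>Commutants\<close>

lemma commutantD: "T \<in> commutant I \<S> \<Longrightarrow> S \<in> \<S> \<Longrightarrow> f \<in> ell2 I \<Longrightarrow> T (S f) = S (T f)"
  by (auto simp: commutant_def compose_def dest!: bspec fun_cong[of _ _ f])

lemma commutant_bounded: "T \<in> commutant I \<S> \<Longrightarrow> T \<in> bounded_ops I"
  by (simp add: commutant_def)

lemma commutantI:
  assumes "T \<in> bounded_ops I" "\<And>S f. S \<in> \<S> \<Longrightarrow> f \<in> ell2 I \<Longrightarrow> T (S f) = S (T f)"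
  shows "T \<in> commutant I \<S>"
  using assms by (auto simp: commutant_def compose_def fun_eq_iff)

lemma double_commutant_superset: "\<S> \<subseteq> bounded_ops I \<Longrightarrow> \<S> \<subseteq> commutant I (commutant I \<S>)"
  by (auto intro!: commutantI simp: commutantD)

lemma commutant_compose:
  assumes b: "\<S> \<subseteq> bounded_ops I" and "T \<in> commutant I \<S>" "T' \<in> commutant I \<S>"
  shows "compose (ell2 I) T T' \<in> commutant I \<S>"
proof (rule commutantI)
  fix S f assume "S \<in> \<S>" "f \<in> ell2 I"
  moreover from this have "S f \<in> ell2 I" "T' f \<in> ell2 I"
    using b bounded_ops_closed commutant_bounded[OF assms(3)] by blast+
  ultimately show "compose (ell2 I) T T' (S f) = S (compose (ell2 I) T T' f)"
    using assms by (simp add: compose_def commutantD)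
qed (use assms commutant_bounded bounded_ops_compose in blast)

lemma commutant_uminus:
  assumes b: "\<S> \<subseteq> bounded_ops I" and T: "T \<in> commutant I \<S>"
  shows "(\<lambda>f\<in>ell2 I. \<lambda>x. - T f x) \<in> commutant I \<S>"
proof (rule commutantI)
  fix S f assume S: "S \<in> \<S>" and f: "f \<in> ell2 I"
  have S': "S \<in> bounded_ops I" using S b by blast
  have Tf: "T f \<in> ell2 I" by (rule bounded_ops_closed[OF commutant_bounded[OF T] f])
  show "(\<lambda>f\<in>ell2 I. \<lambda>x. - T f x) (S f) = S ((\<lambda>f\<in>ell2 I. \<lambda>x. - T f x) f)"
    using f S commutantD[OF T S f] bounded_ops_closed[OF S' f] bounded_ops_scale[OF S' Tf, of "-1"]
    by simp
qed (use T commutant_bounded bounded_ops_uminus in blast)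

text \<open>Moving operators across the inner product turns commutation of the adjoint of
  \<open>T\<close> with \<open>S\<close> into commutation of \<open>T\<close> with the adjoint of
  \<open>S\<close>, which lies in \<open>\<S>\<close> again.\<close>

lemma commutant_adjoint:
  assumes b: "\<And>S. S \<in> \<S> \<Longrightarrow> S \<in> bounded_ops I \<and> op_adjoint I S \<in> \<S>" and T: "T \<in> commutant I \<S>"
  shows "op_adjoint I T \<in> commutant I \<S>"
proof (rule commutantI)
  have T': "T \<in> bounded_ops I" using T by (rule commutant_bounded)
  then show T'': "op_adjoint I T \<in> bounded_ops I" by (rule op_adjoint_bounded)
  fix S f assume S: "S \<in> \<S>" and f: "f \<in> ell2 I"
  have S': "S \<in> bounded_ops I" "op_adjoint I S \<in> \<S>" using S b by auto
  have S'': "op_adjoint I S \<in> bounded_ops I" by (rule op_adjoint_bounded[OF S'(1)])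
  have adj: "ell2_inner I (op_adjoint I V h) g = ell2_inner I h (V g)"
    if "V \<in> bounded_ops I" "g \<in> ell2 I" "h \<in> ell2 I" for V g h
    using op_adjoint_inner[OF that] ell2_inner_cnj by metis
  show "op_adjoint I T (S f) = S (op_adjoint I T f)"
  proof
    fix y
    show "op_adjoint I T (S f) y = S (op_adjoint I T f) y"
    proof (cases "y \<in> I")
      case True
      let ?d = "delta y"
      have d: "?d \<in> ell2 I" using True by simp
      note cl = bounded_ops_closed[OF S'(1)] bounded_ops_closed[OF S''] bounded_ops_closed[OF T']
        bounded_ops_closed[OF T''] d f
      have "ell2_inner I (op_adjoint I T (S f)) ?d = ell2_inner I (S f) (T ?d)"
        by (intro adj T' cl)
      also have "\<dots> = ell2_inner I f (op_adjoint I S (T ?d))"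
        by (intro op_adjoint_inner S' cl)
      also have "op_adjoint I S (T ?d) = T (op_adjoint I S ?d)"
        by (rule commutantD[OF T S'(2) d, symmetric])
      also have "ell2_inner I f (T (op_adjoint I S ?d)) = ell2_inner I (op_adjoint I T f) (op_adjoint I S ?d)"
        by (intro adj[symmetric] T' cl)
      also have "\<dots> = ell2_inner I (S (op_adjoint I T f)) ?d"
        by (intro op_adjoint_inner[symmetric] S' cl)
      finally show ?thesis using True by (simp add: ell2_inner_delta)
    next
      case False
      then show ?thesis
        using ell2_zero_outside bounded_ops_closed[OF S'(1)] bounded_ops_closed[OF T''] f by metis
    qed
  qed
qed

subsection \<open>Group von Neumann algebras\<close>

text \<open>Normalized so that \<open>delta v\<close> goes to \<open>delta (v \<otimes> h)\<close>.
  It is the right regular representation at the inverse of \<open>h\<close> and therefore reverses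
  products.\<close>

definition right_translation :: "('g, 'b) monoid_scheme \<Rightarrow> 'g \<Rightarrow> 'g ell2_op"
  where "right_translation G h =
    (\<lambda>f\<in>ell2 (carrier G). \<lambda>x. if x \<in> carrier G then f (x \<otimes>\<^bsub>G\<^esub> inv\<^bsub>G\<^esub> h) else 0)"

text \<open>The modular conjugation of the trace: it takes the vector of an element of the algebra
  to the vector of its adjoint.\<close>

definition flip :: "('g, 'b) monoid_scheme \<Rightarrow> ('g \<Rightarrow> complex) \<Rightarrow> 'g \<Rightarrow> complex"
  where "flip G f = (\<lambda>x. if x \<in> carrier G then cnj (f (inv\<^bsub>G\<^esub> x)) else 0)"

definition conj_by :: "('g, 'b) monoid_scheme \<Rightarrow> 'g \<Rightarrow> 'g \<Rightarrow> 'g"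
  where "conj_by G u g = u \<otimes>\<^bsub>G\<^esub> g \<otimes>\<^bsub>G\<^esub> inv\<^bsub>G\<^esub> u"

context group
begin

abbreviation "vN \<equiv> group_vN_algebra G"
abbreviation "lt \<equiv> left_translation G"
abbreviation "rt \<equiv> right_translation G"
abbreviation "H \<equiv> ell2 (carrier G)"
abbreviation "nrm \<equiv> ell2_norm (carrier G)"

section \<open>Translations, inversion and conjugation on square-summable functions\<close>

lemma bij_left_mult: "u \<in> carrier G \<Longrightarrow> bij_betw (\<lambda>x. u \<otimes> x) (carrier G) (carrier G)"
  by (rule bij_betw_byWitness[where f' = "\<lambda>x. inv u \<otimes> x"]) (auto simp: m_assoc[symmetric])

lemma bij_right_mult: "u \<in> carrier G \<Longrightarrow> bij_betw (\<lambda>x. x \<otimes> u) (carrier G) (carrier G)"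
  by (rule bij_betw_byWitness[where f' = "\<lambda>x. x \<otimes> inv u"]) (auto simp: m_assoc)

lemma bij_inv: "bij_betw (\<lambda>x. inv x) (carrier G) (carrier G)"
  by (rule bij_betw_byWitness[where f' = "\<lambda>x. inv x"]) auto

lemma conj_by_closed [simp]: "u \<in> carrier G \<Longrightarrow> g \<in> carrier G \<Longrightarrow> conj_by G u g \<in> carrier G"
  by (simp add: conj_by_def)

lemma conj_by_mult:
  "u \<in> carrier G \<Longrightarrow> v \<in> carrier G \<Longrightarrow> g \<in> carrier G \<Longrightarrow>
    conj_by G u (conj_by G v g) = conj_by G (u \<otimes> v) g"
  by (simp add: conj_by_def inv_mult_group m_assoc)

lemma conj_by_one: "g \<in> carrier G \<Longrightarrow> conj_by G \<one> g = g"
  by (simp add: conj_by_def)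

lemma bij_conj_by: "u \<in> carrier G \<Longrightarrow> bij_betw (conj_by G u) (carrier G) (carrier G)"
  by (rule bij_betw_byWitness[where f' = "conj_by G (inv u)"]) (auto simp: conj_by_mult conj_by_one)

lemma translation_apply:
  assumes "f \<in> H"
  shows "lt u f x = (if x \<in> carrier G then f (inv u \<otimes> x) else 0)"
    and "rt u f x = (if x \<in> carrier G then f (x \<otimes> inv u) else 0)"
  using assms by (simp_all add: left_translation_def right_translation_def)

lemma translation_ell2:
  assumes u: "u \<in> carrier G" and f: "f \<in> H"
  shows "lt u f \<in> H" "nrm (lt u f) = nrm f" "rt u f \<in> H" "nrm (rt u f) = nrm f"
  using ell2_reindex[OF bij_left_mult[of "inv u"] f] ell2_reindex[OF bij_right_mult[of "inv u"] f] u f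
  by (simp_all add: left_translation_def right_translation_def)

lemma flip_ell2:
  assumes f: "f \<in> H"
  shows "flip G f \<in> H" "nrm (flip G f) = nrm f"
proof -
  let ?g = "\<lambda>x. if x \<in> carrier G then f (inv x) else 0"
  note g = ell2_reindex[OF bij_inv f]
  have eq: "(cmod (flip G f x)) = cmod (?g x)" for x by (simp add: flip_def)
  show "flip G f \<in> H" by (rule ell2_dominated(1)[OF g(1)]) (simp add: eq)
  show "nrm (flip G f) = nrm f"
    unfolding g(2)[symmetric] unfolding ell2_norm_def eq by simp
qed

lemma flip_add: "flip G (\<lambda>x. f x + g x) = (\<lambda>x. flip G f x + flip G g x)"
  and flip_scale: "flip G (\<lambda>x. c * f x) = (\<lambda>x. cnj c * flip G f x)"
  by (auto simp: flip_def fun_eq_iff)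

lemma translation_bounded:
  assumes "u \<in> carrier G"
  shows "lt u \<in> bounded_ops (carrier G)" "rt u \<in> bounded_ops (carrier G)"
proof -
  show "lt u \<in> bounded_ops (carrier G)"
    by (rule bounded_opsI[where c = 1])
      (use assms in \<open>auto simp: translation_ell2, auto simp: left_translation_def ell2_add ell2_scale fun_eq_iff\<close>)
  show "rt u \<in> bounded_ops (carrier G)"
    by (rule bounded_opsI[where c = 1])
      (use assms in \<open>auto simp: translation_ell2, auto simp: right_translation_def ell2_add ell2_scale fun_eq_iff\<close>)
qed

lemma translation_delta:
  assumes "u \<in> carrier G" "v \<in> carrier G"
  shows "lt u (delta v) = delta (u \<otimes> v)" "rt u (delta v) = delta (v \<otimes> u)"
proof -
  have "inv u \<otimes> x = v \<longleftrightarrow> x = u \<otimes> v" "x \<otimes> inv u = v \<longleftrightarrow> x = v \<otimes> u" if "x \<in> carrier G" for x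
    using that assms by (auto simp: inv_solve_left' inv_solve_right')
  then show "lt u (delta v) = delta (u \<otimes> v)" "rt u (delta v) = delta (v \<otimes> u)"
    using assms by (auto simp: translation_apply fun_eq_iff) (auto simp: delta_def)
qed

lemma lt_mult:
  assumes "u \<in> carrier G" "v \<in> carrier G" "f \<in> H"
  shows "lt u (lt v f) = lt (u \<otimes> v) f"
  using assms by (simp add: fun_eq_iff translation_apply translation_ell2 inv_mult_group m_assoc)

lemma lt_one: "f \<in> H \<Longrightarrow> lt \<one> f = f"
  by (auto simp: translation_apply fun_eq_iff ell2_zero_outside)

lemma lt_rt_commute:
  assumes "u \<in> carrier G" "v \<in> carrier G" "f \<in> H"
  shows "lt u (rt v f) = rt v (lt u f)"
  using assms by (simp add: fun_eq_iff translation_apply translation_ell2 m_assoc)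

lemma lt_adjoint:
  assumes u: "u \<in> carrier G"
  shows "op_adjoint (carrier G) (lt u) = lt (inv u)"
proof (rule op_adjoint_eqI)
  fix f g assume "f \<in> H" "g \<in> H"
  then show "ell2_inner (carrier G) (lt u f) g = ell2_inner (carrier G) f (lt (inv u) g)"
    using u infsum_reindex_bij_betw[OF bij_left_mult[OF u], of "\<lambda>x. f (inv u \<otimes> x) * cnj (g x)"]
    by (simp add: ell2_inner_def translation_apply m_assoc[symmetric] cong: infsum_cong)
qed (use u translation_bounded in auto)

section \<open>Operations of the algebra, 2-norms and commutators\<close>

lemma vN_simps:
  "carrier vN = commutant (carrier G) (commutant (carrier G) (lt ` carrier G))"
  "mult vN = compose H" "\<one>\<^bsub>vN\<^esub> = (\<lambda>f\<in>H. f)" "\<zero>\<^bsub>vN\<^esub> = (\<lambda>f\<in>H. \<lambda>_. 0)"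
  "add vN = (\<lambda>S T. \<lambda>f\<in>H. \<lambda>x. S f x + T f x)" "star vN = op_adjoint (carrier G)"
  "operator_norm vN = op_norm (carrier G)"
  "vn_trace vN = (\<lambda>T. ell2_inner (carrier G) (T (delta_one G)) (delta_one G))"
  by (simp_all add: group_vN_algebra_def Let_def)

lemma delta_one_eq: "delta_one G = delta \<one>"
  by (auto simp: delta_one_def delta_def)

lemma lt_commutant_bounded: "commutant (carrier G) (lt ` carrier G) \<subseteq> bounded_ops (carrier G)"
  by (auto dest: commutant_bounded)

lemma vN_bounded: "X \<in> carrier vN \<Longrightarrow> X \<in> bounded_ops (carrier G)"
  by (simp add: vN_simps commutant_bounded)

lemma vN_ell2: "X \<in> carrier vN \<Longrightarrow> f \<in> H \<Longrightarrow> X f \<in> H"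
  by (rule bounded_ops_closed[OF vN_bounded])

lemma vN_mult: "X \<in> carrier vN \<Longrightarrow> Y \<in> carrier vN \<Longrightarrow> compose H X Y \<in> carrier vN"
  unfolding vN_simps by (rule commutant_compose[OF lt_commutant_bounded])

lemma vN_uminus: "X \<in> carrier vN \<Longrightarrow> (\<lambda>f\<in>H. \<lambda>x. - X f x) \<in> carrier vN"
  unfolding vN_simps by (rule commutant_uminus[OF lt_commutant_bounded])

text \<open>The commutant of a set closed under adjoints is closed under adjoints. This is used
  twice, starting from the translations, whose adjoints are translations by inverses.\<close>

lemma vN_star: "X \<in> carrier vN \<Longrightarrow> op_adjoint (carrier G) X \<in> carrier vN"
  unfolding vN_simps
proof (rule commutant_adjoint)
  fix S assume S: "S \<in> commutant (carrier G) (lt ` carrier G)"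
  then have "op_adjoint (carrier G) S \<in> commutant (carrier G) (lt ` carrier G)"
    by (rule commutant_adjoint[rotated]) (auto simp: translation_bounded lt_adjoint)
  with S show "S \<in> bounded_ops (carrier G) \<and>
      op_adjoint (carrier G) S \<in> commutant (carrier G) (lt ` carrier G)"
    by (simp add: commutant_bounded)
qed

lemma vN_lt: "u \<in> carrier G \<Longrightarrow> lt u \<in> carrier vN"
  unfolding vN_simps using double_commutant_superset[of "lt ` carrier G" "carrier G"]
  by (force simp: translation_bounded)

text \<open>Right translations lie in the commutant of the left ones. Hence an element of the
  algebra is determined by its value at \<open>delta \<one>\<close>, which \<open>vN_delta\<close>
  makes explicit and on which the later arguments rely.\<close>

lemma vN_rt_commute:
  assumes "X \<in> carrier vN" "u \<in> carrier G" "f \<in> H"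
  shows "X (rt u f) = rt u (X f)"
proof (rule commutantD)
  show "rt u \<in> commutant (carrier G) (lt ` carrier G)"
    using assms by (intro commutantI) (auto simp: translation_bounded lt_rt_commute)
qed (use assms in \<open>simp_all add: vN_simps\<close>)

lemma vN_delta: "X \<in> carrier vN \<Longrightarrow> u \<in> carrier G \<Longrightarrow> X (delta u) = rt u (X (delta \<one>))"
  using vN_rt_commute[of X u "delta \<one>"] by (simp add: translation_delta)

text \<open>The adjoint identity turns the trace into the inner product of
  \<open>X (delta \<one>)\<close> with itself, so that 2-norms become norms of vectors.\<close>

lemma norm2_eq:
  assumes X: "X \<in> bounded_ops (carrier G)"
  shows "norm2 vN X = nrm (X (delta \<one>))"
proof -
  let ?d = "delta \<one>" and ?S = "op_adjoint (carrier G) X"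
  have d: "?d \<in> H" by simp
  have Xd: "X ?d \<in> H" by (rule bounded_ops_closed[OF X d])
  have "ell2_inner (carrier G) (?S (X ?d)) ?d = cnj (ell2_inner (carrier G) ?d (?S (X ?d)))"
    by (rule ell2_inner_cnj)
  also have "\<dots> = of_real ((nrm (X ?d))\<^sup>2)"
    unfolding op_adjoint_inner[OF X d Xd, symmetric] ell2_inner_self[OF Xd] by simp
  finally show ?thesis
    by (simp add: norm2_def vN_simps delta_one_eq compose_def)
qed

text \<open>\<open>a_inv\<close> is a definite description, so uniqueness of the negative has to be
  shown; evaluation at vectors yields it without the ring axioms.\<close>

lemma vN_a_inv:
  assumes X: "X \<in> carrier vN"
  shows "\<ominus>\<^bsub>vN\<^esub> X = (\<lambda>f\<in>H. \<lambda>x. - X f x)"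
  unfolding a_inv_def m_inv_def
proof (rule the_equality)
  show "(\<lambda>f\<in>H. \<lambda>x. - X f x) \<in> carrier (add_monoid vN) \<and>
    X \<otimes>\<^bsub>add_monoid vN\<^esub> (\<lambda>f\<in>H. \<lambda>x. - X f x) = \<one>\<^bsub>add_monoid vN\<^esub> \<and>
    (\<lambda>f\<in>H. \<lambda>x. - X f x) \<otimes>\<^bsub>add_monoid vN\<^esub> X = \<one>\<^bsub>add_monoid vN\<^esub>"
    using vN_uminus[OF X] by (auto simp: vN_simps(2-) fun_eq_iff)
next
  fix Y assume Y: "Y \<in> carrier (add_monoid vN) \<and> X \<otimes>\<^bsub>add_monoid vN\<^esub> Y = \<one>\<^bsub>add_monoid vN\<^esub> \<and>
    Y \<otimes>\<^bsub>add_monoid vN\<^esub> X = \<one>\<^bsub>add_monoid vN\<^esub>"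
  show "Y = (\<lambda>f\<in>H. \<lambda>x. - X f x)"
  proof (rule bounded_ops_eqI)
    fix f y assume f: "f \<in> H"
    have "(\<lambda>f\<in>H. \<lambda>x. X f x + Y f x) f = (\<lambda>f\<in>H. \<lambda>_. 0) f"
      using Y by (simp add: vN_simps)
    then have "X f y + Y f y = 0"
      using f by (simp add: fun_eq_iff)
    then show "Y f y = (\<lambda>f\<in>H. \<lambda>x. - X f x) f y"
      using f by (simp add: add_eq_0_iff)
  qed (use Y X vN_uminus vN_bounded in auto)
qed

lemma commutator_eq:
  assumes "X \<in> carrier vN" "Y \<in> carrier vN"
  shows "commutator vN X Y = (\<lambda>f\<in>H. \<lambda>x. X (Y f) x - Y (X f) x)"
  using vN_a_inv[OF vN_mult[OF assms(2,1)]]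
  by (simp add: commutator_def a_minus_def vN_simps(2-) compose_def fun_eq_iff)

lemma norm2_commutator:
  assumes X: "X \<in> carrier vN" and Y: "Y \<in> carrier vN"
  shows "norm2 vN (commutator vN X Y) = nrm (\<lambda>x. X (Y (delta \<one>)) x - Y (X (delta \<one>)) x)"
proof -
  define Z where "Z = (\<lambda>f\<in>H. \<lambda>x. - compose H Y X f x)"
  have "commutator vN X Y = (\<lambda>f\<in>H. \<lambda>x. compose H X Y f x + Z f x)"
    by (simp add: commutator_eq[OF X Y] Z_def compose_def fun_eq_iff)
  moreover have "Z \<in> carrier vN"
    unfolding Z_def by (rule vN_uminus[OF vN_mult[OF Y X]])
  ultimately have "commutator vN X Y \<in> bounded_ops (carrier G)"
    using vN_mult[OF X Y] by (simp add: bounded_ops_add_op vN_bounded)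
  then show ?thesis
    by (simp add: norm2_eq commutator_eq[OF X Y])
qed

text \<open>The commutator is the displacement of \<open>X\<close> under conjugation by
  \<open>lt u\<close>, multiplied on the right by \<open>lt u\<close>. On vectors that factor is the
  isometry \<open>rt u\<close>, so only the displacement of \<open>X (delta \<one>)\<close> under
  conjugation in the group remains.\<close>

lemma norm2_commutator_lt:
  assumes X: "X \<in> carrier vN" and u: "u \<in> carrier G"
  shows "norm2 vN (commutator vN X (lt u)) =
    nrm (\<lambda>g. X (delta \<one>) g - (if g \<in> carrier G then X (delta \<one>) (conj_by G (inv u) g) else 0))"
proof -
  define x where "x = X (delta \<one>)"
  let ?y = "\<lambda>g. if g \<in> carrier G then x (conj_by G (inv u) g) else 0"
  have x: "x \<in> H" using vN_ell2[OF X] by (simp add: x_def)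
  have y: "?y \<in> H" using ell2_reindex(1)[OF bij_conj_by[of "inv u"] x] u by simp
  have d: "(\<lambda>g. x g - ?y g) \<in> H" by (rule ell2_diff(1)[OF x y])
  have "X (lt u (delta \<one>)) = rt u x"
    using u by (simp add: translation_delta vN_delta[OF X u] x_def)
  then have "norm2 vN (commutator vN X (lt u)) = nrm (\<lambda>g. rt u x g - lt u x g)"
    by (simp add: norm2_commutator[OF X vN_lt[OF u]] x_def)
  also have "(\<lambda>g. rt u x g - lt u x g) = rt u (\<lambda>g. x g - ?y g)"
    unfolding fun_eq_iff translation_apply[OF x] translation_apply[OF d]
    using u by (simp add: conj_by_def m_assoc)
  also have "nrm \<dots> = nrm (\<lambda>g. x g - ?y g)"
    by (rule translation_ell2(4)[OF u d])
  finally show ?thesis unfolding x_def .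
qed

lemma lt_unitary:
  assumes "u \<in> carrier G"
  shows "lt u \<in> unitaries vN"
  using assms vN_lt[OF assms] lt_mult[of "inv u" u] lt_mult[of u "inv u"] lt_one
  by (auto simp: unitaries_def vN_simps(2-) lt_adjoint compose_def fun_eq_iff)

text \<open>Right multiplication by \<^term>\<open>Y\<close> is the conjugate of \<^term>\<open>op_adjoint (carrier G) Y\<close> by the
  antiunitary \<^const>\<open>flip\<close>; it is therefore bounded on all of \<open>\<ell>\<^sup>2\<close>.\<close>

lemma vN_right_mult:
  assumes A: "A \<in> carrier vN" and Y: "Y \<in> carrier vN"
  shows "A (Y (delta \<one>)) = flip G (op_adjoint (carrier G) Y (flip G (A (delta \<one>))))"
proof
  define a where "a = A (delta \<one>)"
  define y where "y = Y (delta \<one>)"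
  let ?S = "op_adjoint (carrier G) Y"
  have d: "delta h \<in> H" if "h \<in> carrier G" for h using that by simp
  have aH: "a \<in> H" and yH: "y \<in> H"
    unfolding a_def y_def using vN_ell2[OF A] vN_ell2[OF Y] d by blast+
  have bA: "A \<in> bounded_ops (carrier G)" and bY: "Y \<in> bounded_ops (carrier G)"
    using A Y vN_bounded by auto
  fix g
  show "A (Y (delta \<one>)) g = flip G (?S (flip G (A (delta \<one>)))) g"
  proof (cases "g \<in> carrier G")
    case g: True
    have "A y g = ell2_inner (carrier G) (A y) (delta g)"
      using g by (simp add: ell2_inner_delta)
    also have "\<dots> = ell2_inner (carrier G) y (op_adjoint (carrier G) A (delta g))"
      by (rule op_adjoint_inner[OF bA yH d[OF g]])
    \<comment> \<open>The convolution product of \<open>a\<close> and \<open>y\<close>, evaluated at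
      \<open>g\<close>.\<close>
    also have "\<dots> = (\<Sum>\<^sub>\<infinity>h\<in>carrier G. y h * a (g \<otimes> inv h))"
      unfolding ell2_inner_def
    proof (rule infsum_cong)
      fix h assume h: "h \<in> carrier G"
      have "cnj (op_adjoint (carrier G) A (delta g) h)
          = cnj (ell2_inner (carrier G) (op_adjoint (carrier G) A (delta g)) (delta h))"
        using h by (simp add: ell2_inner_delta)
      also have "\<dots> = ell2_inner (carrier G) (delta h) (op_adjoint (carrier G) A (delta g))"
        by (rule ell2_inner_cnj[symmetric])
      also have "\<dots> = A (delta h) g"
        using op_adjoint_inner[OF bA d[OF h] d[OF g]] g by (simp add: ell2_inner_delta)
      also have "\<dots> = a (g \<otimes> inv h)"
        using vN_delta[OF A h] g translation_apply(2)[OF aH] by (simp add: a_def)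
      finally show "y h * cnj (op_adjoint (carrier G) A (delta g) h) = y h * a (g \<otimes> inv h)"
        by simp
    qed
    \<comment> \<open>Shifting the summation variable makes \<open>y (h \<otimes> g)\<close> a value
      of \<open>Y (delta (inv g))\<close> and \<open>a (inv h)\<close> a conjugated value of
      \<open>flip G a\<close>.\<close>
    also have "\<dots> = (\<Sum>\<^sub>\<infinity>h\<in>carrier G. y (h \<otimes> g) * a (inv h))"
      using infsum_reindex_bij_betw[OF bij_right_mult[OF g], of "\<lambda>h. y h * a (g \<otimes> inv h)"] g
      by (simp add: inv_mult_group m_assoc[symmetric] cong: infsum_cong)
    also have "\<dots> = ell2_inner (carrier G) (Y (delta (inv g))) (flip G a)"
      unfolding ell2_inner_def using g vN_delta[OF Y, of "inv g"] translation_apply(2)[OF yH]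
      by (intro infsum_cong) (simp add: flip_def y_def)
    also have "\<dots> = ell2_inner (carrier G) (delta (inv g)) (?S (flip G a))"
      using g by (intro op_adjoint_inner bY flip_ell2 aH) simp
    also have "\<dots> = cnj (?S (flip G a) (inv g))"
      using g ell2_inner_cnj[of "carrier G" "delta (inv g)" "?S (flip G a)"] by (simp add: ell2_inner_delta)
    finally show ?thesis
      using g by (simp add: flip_def[of G "?S _"] y_def a_def)
  next
    case False
    then show ?thesis
      using ell2_zero_outside[OF vN_ell2[OF A vN_ell2[OF Y d[OF one_closed]]]] by (simp add: flip_def)
  qed
qed

text \<open>At \<open>f = X (delta \<one>)\<close> this is the vector of the commutator of
  \<open>X\<close> and \<open>Y\<close>. Since it makes sense for every square-summable
  \<open>f\<close>, it can also be applied to restrictions of such vectors, which need not come from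
  elements of the algebra.\<close>

definition bracket :: "'a ell2_op \<Rightarrow> ('a \<Rightarrow> complex) \<Rightarrow> 'a \<Rightarrow> complex"
  where "bracket Y f = (\<lambda>x. flip G (op_adjoint (carrier G) Y (flip G f)) x - Y f x)"

lemma norm2_commutator_bracket:
  assumes X: "X \<in> carrier vN" and Y: "Y \<in> carrier vN"
  shows "norm2 vN (commutator vN X Y) = nrm (bracket Y (X (delta \<one>)))"
  unfolding norm2_commutator[OF X Y] bracket_def vN_right_mult[OF X Y] ..

lemma conjugated_vector:
  assumes X: "X \<in> carrier vN" and u: "u \<in> carrier G"
  shows "(lt u \<otimes>\<^bsub>vN\<^esub> X \<otimes>\<^bsub>vN\<^esub> star vN (lt u)) (delta \<one>) =
    (\<lambda>g. if g \<in> carrier G then X (delta \<one>) (conj_by G (inv u) g) else 0)"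
proof -
  have x: "X (delta \<one>) \<in> H" using vN_ell2[OF X] by simp
  have "(lt u \<otimes>\<^bsub>vN\<^esub> X \<otimes>\<^bsub>vN\<^esub> star vN (lt u)) (delta \<one>) = lt u (rt (inv u) (X (delta \<one>)))"
    using u vN_delta[OF X, of "inv u"]
    by (simp add: vN_simps(2-) lt_adjoint compose_def translation_delta)
  also have "\<dots> = (\<lambda>g. if g \<in> carrier G then X (delta \<one>) (conj_by G (inv u) g) else 0)"
    using u x translation_ell2(3)[OF _ x, of "inv u"]
    by (auto simp: translation_apply fun_eq_iff conj_by_def)
  finally show ?thesis .
qed

section \<open>Bounds for commutators with elements of the unit ball\<close>

context
  fixes Y assumes Y: "Y \<in> unit_ball vN"
begin

lemma unit_ball_carrier: "Y \<in> carrier vN" and unit_ball_norm: "op_norm (carrier G) Y \<le> 1"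
  using Y by (simp_all add: unit_ball_def vN_simps(7))

lemma bracket_ell2: "f \<in> H \<Longrightarrow> bracket Y f \<in> H"
  unfolding bracket_def
  by (intro ell2_diff flip_ell2 vN_ell2[OF unit_ball_carrier] vN_ell2[OF vN_star[OF unit_ball_carrier]])

lemma bracket_norm:
  assumes f: "f \<in> H"
  shows "nrm (bracket Y f) \<le> 2 * nrm f"
proof -
  let ?S = "op_adjoint (carrier G) Y"
  note c = unit_ball_carrier
  note cl = flip_ell2 vN_ell2[OF c] vN_ell2[OF vN_star[OF c]] f
  have "nrm (bracket Y f) \<le> nrm (flip G (?S (flip G f))) + nrm (Y f)"
    unfolding bracket_def by (intro ell2_diff cl)
  also have "nrm (flip G (?S (flip G f))) = nrm (?S (flip G f))"
    by (intro cl)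
  also have "\<dots> \<le> op_norm (carrier G) Y * nrm (flip G f)"
    by (intro op_adjoint_norm vN_bounded c flip_ell2 f)
  also have "\<dots> = op_norm (carrier G) Y * nrm f"
    by (simp add: flip_ell2 f)
  also have "nrm (Y f) \<le> op_norm (carrier G) Y * nrm f"
    by (intro op_norm_bound vN_bounded c f)
  also have "op_norm (carrier G) Y * nrm f \<le> 1 * nrm f"
    using unit_ball_norm by (intro mult_right_mono) auto
  finally show ?thesis by simp
qed

lemma bracket_add:
  assumes "f \<in> H" "g \<in> H"
  shows "bracket Y (\<lambda>x. f x + g x) = (\<lambda>x. bracket Y f x + bracket Y g x)"
  using assms flip_ell2
  by (simp add: bracket_def flip_add bounded_ops_add[OF vN_bounded[OF unit_ball_carrier]]
      bounded_ops_add[OF vN_bounded[OF vN_star[OF unit_ball_carrier]]] fun_eq_iff)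

lemma bracket_scale:
  assumes "f \<in> H"
  shows "bracket Y (\<lambda>x. c * f x) = (\<lambda>x. c * bracket Y f x)"
  using assms flip_ell2
  by (simp add: bracket_def flip_scale bounded_ops_scale[OF vN_bounded[OF unit_ball_carrier]]
      bounded_ops_scale[OF vN_bounded[OF vN_star[OF unit_ball_carrier]]] fun_eq_iff algebra_simps)

lemma bracket_sum:
  assumes "\<And>a. a \<in> A \<Longrightarrow> f a \<in> H"
  shows "bracket Y (\<lambda>x. \<Sum>a\<in>A. f a x) = (\<lambda>x. \<Sum>a\<in>A. bracket Y (f a) x)"
  using assms
proof (induction A rule: infinite_finite_induct)
  case (insert a A)
  then show ?case using ell2_sum(1)[of A f] bracket_add[of "f a" "\<lambda>x. \<Sum>a\<in>A. f a x"] by simp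
qed (use bracket_scale[of "\<lambda>_. 0" 0] in simp_all)

lemma bracket_delta:
  assumes k: "k \<in> carrier G"
  shows "bracket Y (delta k) = (\<lambda>x. lt k (Y (delta \<one>)) x - rt k (Y (delta \<one>)) x)"
  using vN_right_mult[OF vN_lt[OF k] unit_ball_carrier] vN_delta[OF unit_ball_carrier k] k
  by (simp add: bracket_def translation_delta)

text \<open>Elements of \<open>E\<close> commute with \<open>k\<close>, so left and right
  translation by \<open>k\<close> agree on the part of \<open>Y (delta \<one>)\<close> supported in
  \<open>E\<close> and cancel. Each of the two translates of the rest contributes its norm.\<close>

lemma bracket_delta_norm:
  assumes k: "k \<in> carrier G" and E: "finite E" "E \<subseteq> carrier G"
    and comm: "\<And>e. e \<in> E \<Longrightarrow> k \<otimes> e = e \<otimes> k"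
  shows "nrm (bracket Y (delta k)) \<le> 2 * nrm (\<lambda>x. Y (delta \<one>) x - restr E (Y (delta \<one>)) x)"
proof -
  define y where "y = Y (delta \<one>)"
  have y: "y \<in> H" using vN_ell2[OF unit_ball_carrier] by (simp add: y_def)
  let ?r = "\<lambda>x. y x - restr E y x"
  have r: "?r \<in> H" by (intro ell2_diff ell2_restr y)
  have iff: "inv k \<otimes> x \<in> E \<longleftrightarrow> x \<otimes> inv k \<in> E"
    and eq: "inv k \<otimes> x \<in> E \<Longrightarrow> inv k \<otimes> x = x \<otimes> inv k" if x: "x \<in> carrier G" for x
  proof -
    have *: "inv k \<otimes> x = x \<otimes> inv k" if "inv k \<otimes> x \<in> E"
    proof -
      have "x = (inv k \<otimes> x) \<otimes> k"
        using comm[OF that] x k by (simp add: m_assoc[symmetric])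
      then show ?thesis using x k by (metis inv_solve_right inv_closed m_closed)
    qed
    moreover have "inv k \<otimes> x = x \<otimes> inv k" if "x \<otimes> inv k \<in> E"
    proof -
      have "x = k \<otimes> (x \<otimes> inv k)"
        using comm[OF that] x k by (simp add: m_assoc)
      then show ?thesis using x k by (metis inv_solve_left inv_closed m_closed)
    qed
    ultimately show "inv k \<otimes> x \<in> E \<longleftrightarrow> x \<otimes> inv k \<in> E" by auto
    show "inv k \<otimes> x \<in> E \<Longrightarrow> inv k \<otimes> x = x \<otimes> inv k" by (rule *)
  qed
  have br: "bracket Y (delta k) = (\<lambda>x. lt k ?r x - rt k ?r x)"
    unfolding bracket_delta[OF k] y_def[symmetric] using y r iff eq
    by (auto simp: translation_apply restr_def fun_eq_iff)
  have "nrm (bracket Y (delta k)) \<le> nrm (lt k ?r) + nrm (rt k ?r)"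
    unfolding br by (rule ell2_diff(2)[OF translation_ell2(1)[OF k r] translation_ell2(3)[OF k r]])
  also have "\<dots> = 2 * nrm ?r"
    unfolding translation_ell2(2,4)[OF k r] by (rule mult_2[symmetric])
  finally show ?thesis
    unfolding y_def .
qed

text \<open>Conjugation by \<open>u\<close> preserves the norm of the part of
  \<open>X (delta \<one>)\<close> off \<open>A\<close>, to which \<open>bracket_norm\<close>
  applies. The part on \<open>A\<close> becomes a finite combination of functions
  \<open>delta (conj_by G u h)\<close>, each controlled by
  \<open>bracket_delta_norm\<close>.\<close>

lemma commutator_estimate:
  assumes X: "X \<in> carrier vN" and u: "u \<in> carrier G"
    and A: "finite A" "A \<subseteq> carrier G" and E: "finite E" "E \<subseteq> carrier G"
    and comm: "\<And>h e. h \<in> A \<Longrightarrow> e \<in> E \<Longrightarrow> conj_by G u h \<otimes> e = e \<otimes> conj_by G u h"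
  shows "norm2 vN (commutator vN (lt u \<otimes>\<^bsub>vN\<^esub> X \<otimes>\<^bsub>vN\<^esub> star vN (lt u)) Y) \<le>
    2 * nrm (\<lambda>x. X (delta \<one>) x - restr A (X (delta \<one>)) x) +
    (\<Sum>h\<in>A. cmod (X (delta \<one>) h)) * (2 * nrm (\<lambda>x. Y (delta \<one>) x - restr E (Y (delta \<one>)) x))"
proof -
  define x where "x = X (delta \<one>)"
  define r where "r = (\<lambda>g. x g - restr A x g)"
  define r' where "r' = (\<lambda>g. if g \<in> carrier G then r (conj_by G (inv u) g) else 0)"
  define s where "s = (\<lambda>g. \<Sum>h\<in>A. x h * delta (conj_by G u h) g)"
  have x: "x \<in> H" using vN_ell2[OF X] by (simp add: x_def)
  have r: "r \<in> H" unfolding r_def by (intro ell2_diff ell2_restr x)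
  have r': "r' \<in> H" "nrm r' = nrm r"
    unfolding r'_def using ell2_reindex[OF bij_conj_by[of "inv u"] r] u by auto
  have dH: "(\<lambda>g. x h * delta (conj_by G u h) g) \<in> H" if "h \<in> A" for h
    using that A u by (intro ell2_scale) auto
  have s: "s \<in> H" unfolding s_def by (rule ell2_sum(1)[OF dH])
  have X': "lt u \<otimes>\<^bsub>vN\<^esub> X \<otimes>\<^bsub>vN\<^esub> star vN (lt u) \<in> carrier vN"
    using X u by (simp add: vN_simps(2,6) vN_mult vN_lt vN_star)
  have conj_iff: "g = conj_by G u h \<longleftrightarrow> conj_by G (inv u) g = h" if "g \<in> carrier G" "h \<in> carrier G" for g h
    using that u conj_by_mult[of "inv u" u h] conj_by_mult[of u "inv u" g] by (auto simp: conj_by_one)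
  have "(lt u \<otimes>\<^bsub>vN\<^esub> X \<otimes>\<^bsub>vN\<^esub> star vN (lt u)) (delta \<one>) = (\<lambda>g. r' g + s g)"
  proof
    fix g
    show "(lt u \<otimes>\<^bsub>vN\<^esub> X \<otimes>\<^bsub>vN\<^esub> star vN (lt u)) (delta \<one>) g = r' g + s g"
    proof (cases "g \<in> carrier G")
      case g: True
      have "s g = (\<Sum>h\<in>A. x h * delta h (conj_by G (inv u) g))"
        unfolding s_def using A conj_iff[OF g] by (intro sum.cong) (auto simp: delta_def)
      also have "\<dots> = restr A x (conj_by G (inv u) g)"
        by (simp add: restr_finite_eq_sum[OF A(1)])
      finally show ?thesis
        using g by (simp add: conjugated_vector[OF X u] r'_def r_def x_def)
    next
      case False
      then show ?thesis
        using ell2_zero_outside[OF s False]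
        by (simp add: conjugated_vector[OF X u] r'_def)
    qed
  qed
  then have "norm2 vN (commutator vN (lt u \<otimes>\<^bsub>vN\<^esub> X \<otimes>\<^bsub>vN\<^esub> star vN (lt u)) Y)
      = nrm (\<lambda>g. bracket Y r' g + bracket Y s g)"
    by (simp add: norm2_commutator_bracket[OF X' unit_ball_carrier] bracket_add[OF r'(1) s])
  also have "\<dots> \<le> nrm (bracket Y r') + nrm (bracket Y s)"
    by (intro ell2_add bracket_ell2 r' s)
  also have "nrm (bracket Y r') \<le> 2 * nrm r"
    using bracket_norm[OF r'(1)] r'(2) by simp
  also have "nrm (bracket Y s) \<le> (\<Sum>h\<in>A. nrm (\<lambda>g. x h * bracket Y (delta (conj_by G u h)) g))"
  proof -
    have k: "delta (conj_by G u h) \<in> H" if "h \<in> A" for h using that A u by auto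
    have "bracket Y s = (\<lambda>g. \<Sum>h\<in>A. bracket Y (\<lambda>g. x h * delta (conj_by G u h) g) g)"
      unfolding s_def by (rule bracket_sum) (rule dH)
    also have "\<dots> = (\<lambda>g. \<Sum>h\<in>A. x h * bracket Y (delta (conj_by G u h)) g)"
      using bracket_scale[OF k] by (intro ext sum.cong) auto
    finally have "bracket Y s = (\<lambda>g. \<Sum>h\<in>A. x h * bracket Y (delta (conj_by G u h)) g)" .
    moreover have "(\<lambda>g. x h * bracket Y (delta (conj_by G u h)) g) \<in> H" if "h \<in> A" for h
      by (intro ell2_scale bracket_ell2 k that)
    ultimately show ?thesis
      using ell2_sum(2)[of A "\<lambda>h g. x h * bracket Y (delta (conj_by G u h)) g"] by simp
  qed
  also have "\<dots> \<le> (\<Sum>h\<in>A. cmod (x h) * (2 * nrm (\<lambda>x. Y (delta \<one>) x - restr E (Y (delta \<one>)) x)))"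
  proof (rule sum_mono)
    fix h assume h: "h \<in> A"
    then have k: "conj_by G u h \<in> carrier G" using A u by auto
    then have "nrm (\<lambda>g. x h * bracket Y (delta (conj_by G u h)) g) =
        cmod (x h) * nrm (bracket Y (delta (conj_by G u h)))"
      by (intro ell2_scale bracket_ell2) simp
    also have "\<dots> \<le> cmod (x h) * (2 * nrm (\<lambda>x. Y (delta \<one>) x - restr E (Y (delta \<one>)) x))"
      by (intro mult_left_mono bracket_delta_norm k E comm h) auto
    finally show "nrm (\<lambda>g. x h * bracket Y (delta (conj_by G u h)) g) \<le>
        cmod (x h) * (2 * nrm (\<lambda>x. Y (delta \<one>) x - restr E (Y (delta \<one>)) x))" .
  qed
  finally show ?thesis
    by (simp add: r_def x_def sum_distrib_right)
qed

end

end

subsection \<open>Spectral gap from a paradoxical set\<close>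

text \<open>The reindexed function, restricted to the preimage of \<open>E\<close>, has exactly the
  norm of \<open>restr E x\<close>. Replacing it by \<open>x\<close> costs at most the distance
  between the two functions.\<close>

lemma norm_restr_vimage:
  assumes p: "bij_betw p I I" and x: "x \<in> ell2 I"
  shows "\<bar>ell2_norm I (restr {g \<in> I. p g \<in> E} x) - ell2_norm I (restr E x)\<bar> \<le>
    ell2_norm I (\<lambda>g. x g - (if g \<in> I then x (p g) else 0))"
proof -
  let ?y = "\<lambda>g. if g \<in> I then x (p g) else 0" and ?E = "{g \<in> I. p g \<in> E}"
  have y: "?y \<in> ell2 I" by (rule ell2_reindex(1)[OF p x])
  have "restr ?E ?y = (\<lambda>g. if g \<in> I then restr E x (p g) else 0)"
    by (auto simp: restr_def fun_eq_iff)
  then have "ell2_norm I (restr E x) = ell2_norm I (restr ?E ?y)"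
    using ell2_reindex(2)[OF p ell2_restr(1)[OF x, of E]] by simp
  then have "\<bar>ell2_norm I (restr ?E x) - ell2_norm I (restr E x)\<bar> \<le>
      ell2_norm I (\<lambda>g. restr ?E x g - restr ?E ?y g)"
    using ell2_norm_diff_le[OF ell2_restr(1)[OF x, of ?E] ell2_restr(1)[OF y, of ?E]] by simp
  also have "\<dots> \<le> ell2_norm I (\<lambda>g. x g - ?y g)"
    by (rule ell2_dominated(2)[OF ell2_diff(1)[OF x y]]) (auto simp: restr_def)
  finally show ?thesis .
qed

text \<open>Here \<open>s\<close>, \<open>s1\<close>, \<open>s2\<close>, \<open>t\<close> are the
  norms of a vector on a paradoxical set and its conjugates, \<open>N\<close> is the norm on the
  whole complement, and \<open>e1\<close>, \<open>e2\<close> are displacements. The decompositions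
  force \<open>s1\<^sup>2 + s2\<^sup>2 \<le> t\<^sup>2\<close>: two pieces almost as heavy as
  \<open>s\<close> fit into one, so \<open>s\<close> is at most a multiple of the
  displacement.\<close>

lemma paradox_arith:
  fixes s s1 s2 t N e1 e2 :: real
  assumes "0 \<le> s" "0 \<le> s1" "0 \<le> s2" "0 \<le> t" "0 \<le> e1" "0 \<le> e2"
    and up: "N\<^sup>2 \<le> s\<^sup>2 + t\<^sup>2" and low: "s\<^sup>2 + s1\<^sup>2 + s2\<^sup>2 \<le> N\<^sup>2"
    and "s - e1 \<le> s1" "s - e1 \<le> s2" "t \<le> s + e2"
  shows "N\<^sup>2 \<le> 100 * (e1\<^sup>2 + e2\<^sup>2)"
proof -
  define e where "e = sqrt (e1\<^sup>2 + e2\<^sup>2)"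
  have e: "e\<^sup>2 = e1\<^sup>2 + e2\<^sup>2" "0 \<le> e" by (simp_all add: e_def)
  have le: "e1 \<le> e" "e2 \<le> e"
    unfolding e_def by (auto intro!: real_le_rsqrt)
  have t2: "t\<^sup>2 \<le> (s + e)\<^sup>2" using assms le by (intro power_mono) auto
  \<comment> \<open>Two pieces in one give \<open>2 * (s - e)\<^sup>2 \<le> (s + e)\<^sup>2\<close>
    once \<open>s\<close> exceeds \<open>e\<close>, and this means
    \<open>s \<le> (3 + 2 * sqrt 2) * e\<close>, where the factor is below 6.\<close>
  have "s \<le> 6 * e"
  proof (rule ccontr)
    assume *: "\<not> s \<le> 6 * e"
    then have "(s - e)\<^sup>2 \<le> s1\<^sup>2" "(s - e)\<^sup>2 \<le> s2\<^sup>2"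
      using assms le e(2) by (intro power_mono; linarith)+
    then have "2 * (s - e)\<^sup>2 \<le> (s + e)\<^sup>2" using up low t2 by linarith
    then have "s * s + e * e \<le> 6 * e * s" by (simp add: power2_eq_square algebra_simps)
    moreover have "6 * e * s \<le> s * s" using * e assms(1) by (intro mult_right_mono) auto
    ultimately have "e * e \<le> 0" by linarith
    then have "e = 0" using e by (metis mult_eq_0_iff zero_le_square antisym)
    then have "s * s \<le> 0" "0 < s"
      using \<open>s * s + e * e \<le> 6 * e * s\<close> * by simp_all
    then show False using mult_pos_pos[of s s] by linarith
  qed
  then have "s\<^sup>2 \<le> (6 * e)\<^sup>2" "(s + e)\<^sup>2 \<le> (7 * e)\<^sup>2"
    using assms(1) e(2) by (intro power_mono; linarith)+
  \<comment> \<open>The bounds \<open>6 * e\<close> and \<open>7 * e\<close> give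
    \<open>36 + 49 = 85\<close>, below the factor 100 of \<open>chi\<close>.\<close>
  then have "N\<^sup>2 \<le> 85 * e\<^sup>2" using up t2 by (simp add: power_mult_distrib)
  also have "\<dots> \<le> 100 * e\<^sup>2" by simp
  finally show ?thesis using e by simp
qed

text \<open>By \<open>cover\<close>, \<open>F\<close> and its conjugate by \<open>b\<close> cover
  the complement of \<open>C\<close>. By \<open>disj1\<close> and \<open>disj2\<close>,
  \<open>F\<close> and its conjugates by \<open>a\<close> and by the inverse of \<open>a\<close> are
  pairwise disjoint; the square of \<open>a\<close> enters because the two conjugates differ by it.
  By \<open>absorb\<close>, finite parts of \<open>C\<close> can be conjugated into centralizers of
  finite sets.\<close>

locale conj_paradox = group +
  fixes C F :: "'a set" and a b :: 'a
  assumes a: "a \<in> carrier G" and b: "b \<in> carrier G"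
    and C: "C \<subseteq> carrier G" and F: "F \<subseteq> carrier G - C"
    and a_C: "h \<in> C \<Longrightarrow> a \<otimes> h = h \<otimes> a"
    and cover: "g \<in> carrier G \<Longrightarrow> g \<notin> C \<Longrightarrow> g \<notin> F \<Longrightarrow> conj_by G (inv b) g \<in> F"
    and disj1: "g \<in> F \<Longrightarrow> conj_by G a g \<notin> F"
    and disj2: "g \<in> F \<Longrightarrow> conj_by G a (conj_by G a g) \<notin> F"
    and absorb: "finite A \<Longrightarrow> A \<subseteq> C \<Longrightarrow> finite E \<Longrightarrow> E \<subseteq> carrier G \<Longrightarrow>
      \<exists>u\<in>carrier G. \<forall>h\<in>A. \<forall>e\<in>E. conj_by G u h \<otimes> e = e \<otimes> conj_by G u h"
begin

lemma conj_inv_a: "g \<in> carrier G \<Longrightarrow> conj_by G (inv a) (conj_by G a g) = g"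
  "g \<in> carrier G \<Longrightarrow> conj_by G a (conj_by G (inv a) g) = g"
  using a by (simp_all add: conj_by_mult conj_by_one)

lemma conj_a_C: "h \<in> C \<Longrightarrow> conj_by G a h = h"
  using a C a_C by (auto simp: conj_by_def m_assoc)

lemma conj_a_C_iff: "g \<in> carrier G \<Longrightarrow> conj_by G a g \<in> C \<longleftrightarrow> g \<in> C"
  using conj_a_C[of g] conj_a_C[of "conj_by G a g"] conj_inv_a(1)[of g] a
  by (metis conj_by_closed conj_inv_a(1))

text \<open>The disjoint sets \<open>F\<close>, \<open>F1\<close>, \<open>F2\<close> lie in the
  complement of \<open>C\<close>, which bounds its mass from below; \<open>F\<close> and
  \<open>F3\<close> cover it, which bounds its mass from above. The norms on the conjugates differ
  from the norm on \<open>F\<close> by at most the displacements, and \<open>paradox_arith\<close>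
  concludes.\<close>

lemma spectral_gap:
  assumes x: "x \<in> H"
  shows "(nrm (restr (carrier G - C) x))\<^sup>2 \<le> 100 *
    ((nrm (\<lambda>g. x g - (if g \<in> carrier G then x (conj_by G (inv a) g) else 0)))\<^sup>2 +
     (nrm (\<lambda>g. x g - (if g \<in> carrier G then x (conj_by G (inv b) g) else 0)))\<^sup>2)"
    (is "_ \<le> 100 * ((nrm ?da)\<^sup>2 + (nrm ?db)\<^sup>2)")
proof -
  let ?I = "carrier G"
  define F1 where "F1 = {g \<in> ?I. conj_by G (inv a) g \<in> F}"
  define F2 where "F2 = {g \<in> ?I. conj_by G a g \<in> F}"
  define F3 where "F3 = {g \<in> ?I. conj_by G (inv b) g \<in> F}"
  have FI: "F \<subseteq> ?I" using F by auto
  \<comment> \<open>The preimage of \<open>F2\<close> under conjugation by the inverse of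
    \<open>a\<close> is \<open>F\<close>, so the displacement that compares \<open>F1\<close> with
    \<open>F\<close> also compares \<open>F2\<close> with \<open>F\<close>.\<close>
  have F2': "{g \<in> ?I. conj_by G (inv a) g \<in> F2} = F"
    using FI a by (auto simp: F2_def conj_inv_a)
  note pa = bij_conj_by[OF inv_closed[OF a]] and pb = bij_conj_by[OF inv_closed[OF b]]
  note n1 = norm_restr_vimage[OF pa x, of F, folded F1_def]
    and n2 = norm_restr_vimage[OF pa x, of F2, unfolded F2']
    and n3 = norm_restr_vimage[OF pb x, of F, folded F3_def]
  have d: "F \<inter> F1 = {}" "(F \<union> F1) \<inter> F2 = {}"
  proof -
    show "F \<inter> F1 = {}"
    proof (rule ccontr)
      assume "F \<inter> F1 \<noteq> {}"
      then obtain g where "g \<in> F" "g \<in> F1" by blast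
      then show False using disj1[of "conj_by G (inv a) g"] by (auto simp: F1_def conj_inv_a)
    qed
    show "(F \<union> F1) \<inter> F2 = {}"
    proof (rule ccontr)
      assume "(F \<union> F1) \<inter> F2 \<noteq> {}"
      then obtain g where "g \<in> F \<or> g \<in> F1" "g \<in> F2" by blast
      then show False using disj1[of g] disj2[of "conj_by G (inv a) g"]
        by (auto simp: F1_def F2_def conj_inv_a)
    qed
  qed
  have sub: "F \<union> F1 \<union> F2 \<subseteq> ?I - C"
  proof -
    have "g \<notin> C" if "g \<in> F1" for g
      using that F conj_a_C[of g] conj_inv_a(1)[of g] by (auto simp: F1_def)
    moreover have "g \<notin> C" if "g \<in> F2" for g
      using that F conj_a_C[of g] by (auto simp: F2_def)
    ultimately show ?thesis using F by (auto simp: F1_def F2_def)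
  qed
  have "(nrm (restr F x))\<^sup>2 + (nrm (restr F1 x))\<^sup>2 + (nrm (restr F2 x))\<^sup>2 = (nrm (restr (F \<union> F1 \<union> F2) x))\<^sup>2"
    by (simp add: ell2_norm_restr_Un[OF x d(1)] ell2_norm_restr_Un[OF x d(2)])
  also have "\<dots> \<le> (nrm (restr (?I - C) x))\<^sup>2"
    by (intro power_mono ell2_restr_mono x sub) simp
  finally have low: "(nrm (restr F x))\<^sup>2 + (nrm (restr F1 x))\<^sup>2 + (nrm (restr F2 x))\<^sup>2 \<le>
    (nrm (restr (?I - C) x))\<^sup>2" .
  have "?I - C \<subseteq> F \<union> F3" using cover by (auto simp: F3_def)
  then have "(nrm (restr (?I - C) x))\<^sup>2 \<le> (nrm (restr (F \<union> F3) x))\<^sup>2"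
    by (intro power_mono ell2_restr_mono x) simp_all
  also have "\<dots> \<le> (nrm (restr F x))\<^sup>2 + (nrm (restr F3 x))\<^sup>2"
    by (rule ell2_norm_restr_Un_le[OF x])
  finally have up: "(nrm (restr (?I - C) x))\<^sup>2 \<le> (nrm (restr F x))\<^sup>2 + (nrm (restr F3 x))\<^sup>2" .
  show ?thesis
    by (rule paradox_arith[OF _ _ _ _ _ _ up low]) ((rule ell2_norm_nonneg)+, (use n1 n2 n3 in linarith)+)
qed

text \<open>The displacements in \<open>spectral_gap\<close> are the commutator norms in
  \<open>chi\<close>, by \<open>norm2_commutator_lt\<close>.\<close>

lemma gap_chi:
  assumes X: "X \<in> carrier vN"
  shows "nrm (restr (carrier G - C) (X (delta \<one>))) \<le> sqrt (chi vN X (lt a) (lt b))"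
  unfolding chi_def norm2_commutator_lt[OF X a] norm2_commutator_lt[OF X b]
  using vN_ell2[OF X] by (intro real_le_rsqrt spectral_gap) simp

end

subsection \<open>The sentences \<open>\<tau>\<^sub>m\<close>\<close>

definition twisted :: "nat \<Rightarrow> ('x, 'c) tracial_algebra_scheme \<Rightarrow> (nat \<Rightarrow> 'x) \<Rightarrow> (nat \<Rightarrow> 'x) \<Rightarrow> 'x \<Rightarrow> real"
  where "twisted m M x y u = (MAX (i, j)\<in>{1..m} \<times> {1..m}.
            norm2 M (commutator M (u \<otimes>\<^bsub>M\<^esub> x i \<otimes>\<^bsub>M\<^esub> star M u) (y j)))"

lemma twisted_le_iff:
  assumes "1 \<le> m"
  shows "twisted m M x y u \<le> c \<longleftrightarrow> (\<forall>i\<in>{1..m}. \<forall>j\<in>{1..m}.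
    norm2 M (commutator M (u \<otimes>\<^bsub>M\<^esub> x i \<otimes>\<^bsub>M\<^esub> star M u) (y j)) \<le> c)"
  unfolding twisted_def using assms by (subst Max_le_iff) auto

lemma twisted_ge:
  assumes "i \<in> {1..m}" "j \<in> {1..m}"
  shows "norm2 M (commutator M (u \<otimes>\<^bsub>M\<^esub> x i \<otimes>\<^bsub>M\<^esub> star M u) (y j)) \<le> twisted m M x y u"
  using twisted_le_iff[of m M x y u "twisted m M x y u"] assms by auto

lemma chi_Max_nonneg:
  fixes m :: nat
  assumes "1 \<le> m"
  shows "0 \<le> (MAX i\<in>{1..m}. sqrt (chi M (x i) va vb))"
proof -
  have "0 \<le> sqrt (chi M (x 1) va vb)" by (simp add: chi_def)
  also have "\<dots> \<le> (MAX i\<in>{1..m}. sqrt (chi M (x i) va vb))"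
    by (intro Max_ge finite_imageI finite_atLeastAtMost image_eqI[OF HOL.refl]) (use assms in simp_all)
  finally show ?thesis .
qed

lemma psi_eq:
  "psi m M va vb =
    (SUP (x, y) \<in> ({1..m} \<rightarrow>\<^sub>E unit_ball M) \<times> ({1..m} \<rightarrow>\<^sub>E unit_ball M).
       monus (INF u\<in>unitaries M. twisted m M x y u)
         (2 * (MAX i\<in>{1..m}. sqrt (chi M (x i) va vb))))"
  by (simp add: psi_def twisted_def)

context group
begin

lemma unitaries_carrier: "U \<in> unitaries vN \<Longrightarrow> U \<in> carrier vN"
  by (simp add: unitaries_def)

lemma twisted_nonneg:
  assumes m: "1 \<le> m" and x: "x \<in> {1..m} \<rightarrow>\<^sub>E unit_ball vN" and y: "y \<in> {1..m} \<rightarrow>\<^sub>E unit_ball vN"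
    and U: "U \<in> unitaries vN"
  shows "0 \<le> twisted m vN x y U"
proof -
  have 1: "1 \<in> {1..m}" using m by simp
  have "x 1 \<in> carrier vN" "y 1 \<in> carrier vN"
    using PiE_mem[OF x 1] PiE_mem[OF y 1] by (simp_all add: unit_ball_def)
  then have "0 \<le> norm2 vN (commutator vN (U \<otimes>\<^bsub>vN\<^esub> x 1 \<otimes>\<^bsub>vN\<^esub> star vN U) (y 1))"
    using unitaries_carrier[OF U]
    by (subst norm2_commutator) (auto simp: vN_simps(2,6) intro!: vN_mult vN_star)
  also have "\<dots> \<le> twisted m vN x y U" by (rule twisted_ge[OF 1 1])
  finally show ?thesis .
qed

lemma id_in_unit_ball: "(\<lambda>f\<in>H. f) \<in> unit_ball vN"
proof -
  have eq: "(\<lambda>f\<in>H. f) = lt \<one>"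
    by (rule extensionalityI[of _ H]) (auto simp: lt_one, simp add: left_translation_def)
  have "op_norm (carrier G) (lt \<one>) \<le> 1"
    unfolding op_norm_def by (rule cSUP_least) (auto simp: lt_one intro!: exI[of _ "\<lambda>_. 0"])
  then show ?thesis
    unfolding eq unit_ball_def by (simp add: vN_lt vN_simps(7))
qed

text \<open>With \<open>A\<close> and \<open>E\<close> empty, \<open>commutator_estimate\<close>
  leaves twice the norm of \<open>x i (delta \<one>)\<close>. This uniform bound makes the supremum
  in \<open>psi\<close> one over a bounded set.\<close>

lemma twisted_one_le:
  assumes m: "1 \<le> m" and x: "x \<in> {1..m} \<rightarrow>\<^sub>E unit_ball vN" and y: "y \<in> {1..m} \<rightarrow>\<^sub>E unit_ball vN"
  shows "twisted m vN x y (lt \<one>) \<le> 2"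
  unfolding twisted_le_iff[OF m]
proof (intro ballI)
  fix i j assume "i \<in> {1..m}" "j \<in> {1..m}"
  then have xi: "x i \<in> unit_ball vN" and yj: "y j \<in> unit_ball vN" using x y by auto
  have c: "x i \<in> carrier vN" by (rule unit_ball_carrier[OF xi])
  have "nrm (x i (delta \<one>)) \<le> op_norm (carrier G) (x i) * nrm (delta \<one>)"
    by (rule op_norm_bound[OF vN_bounded[OF c]]) simp
  also have "\<dots> \<le> 1" using unit_ball_norm[OF xi] by simp
  finally have "nrm (x i (delta \<one>)) \<le> 1" .
  then show "norm2 vN (commutator vN (lt \<one> \<otimes>\<^bsub>vN\<^esub> x i \<otimes>\<^bsub>vN\<^esub> star vN (lt \<one>)) (y j)) \<le> 2"
    using commutator_estimate[OF yj c one_closed, of "{}" "{}"] by (simp add: restr_def)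
qed

text \<open>Every truncated difference is nonnegative, so one member of a bounded family suffices;
  the constant tuples of the identity provide it.\<close>

lemma psi_nonneg:
  assumes m: "1 \<le> m"
  shows "0 \<le> psi m vN va vb"
proof -
  let ?B = "{1..m} \<rightarrow>\<^sub>E unit_ball vN"
  let ?f = "\<lambda>(x, y). monus (INF u\<in>unitaries vN. twisted m vN x y u)
         (2 * (MAX i\<in>{1..m}. sqrt (chi vN (x i) va vb)))"
  have "?f p \<le> 2" if p: "p \<in> ?B \<times> ?B" for p
  proof -
    obtain x y where xy: "p = (x, y)" "x \<in> ?B" "y \<in> ?B" using p by auto
    have "(INF u\<in>unitaries vN. twisted m vN x y u) \<le> twisted m vN x y (lt \<one>)"
      using twisted_nonneg[OF m xy(2,3)]
      by (intro cINF_lower lt_unitary bdd_belowI2[of _ 0]) auto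
    also have "\<dots> \<le> 2" by (rule twisted_one_le[OF m xy(2,3)])
    finally show ?thesis
      using chi_Max_nonneg[OF m, of vN x va vb] by (simp add: xy(1) monus_def)
  qed
  then have bdd: "bdd_above (?f ` (?B \<times> ?B))" by (rule bdd_aboveI2)
  let ?i = "\<lambda>k\<in>{1..m}. (\<lambda>f\<in>H. f)"
  have "(?i, ?i) \<in> ?B \<times> ?B" using id_in_unit_ball by auto
  then have "?f (?i, ?i) \<le> (SUP p \<in> ?B \<times> ?B. ?f p)" by (rule cSUP_upper[OF _ bdd])
  moreover have "0 \<le> ?f (?i, ?i)" by (simp add: monus_def)
  ultimately show ?thesis unfolding psi_eq by linarith
qed

end

section \<open>Vanishing of the sentences for a group with a paradoxical set\<close>

context conj_paradox
begin

text \<open>The part of \<open>x i (delta \<one>)\<close> off \<open>C\<close> is controlled by the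
  spectral gap; the part on \<open>C\<close> is finitely supported up to a small error and is
  absorbed. One \<open>u\<close> has to serve all pairs \<open>i\<close>, \<open>j\<close>, so
  \<open>absorb\<close> is applied to unions of the finite sets.\<close>

lemma twisted_approx:
  assumes m: "1 \<le> m" and x: "x \<in> {1..m} \<rightarrow>\<^sub>E unit_ball vN" and y: "y \<in> {1..m} \<rightarrow>\<^sub>E unit_ball vN"
    and e: "e > 0"
  obtains u where "u \<in> carrier G"
    "twisted m vN x y (lt u) \<le> 2 * (MAX i\<in>{1..m}. sqrt (chi vN (x i) (lt a) (lt b))) + e"
proof -
  define v where "v i = x i (delta \<one>)" for i
  define w where "w j = y j (delta \<one>)" for j
  have xi: "x i \<in> carrier vN" and yi: "y i \<in> unit_ball vN" and v: "v i \<in> H" and w: "w i \<in> H"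
    if "i \<in> {1..m}" for i
    using x y that vN_ell2[of "x i"] vN_ell2[of "y i"]
    by (auto simp: v_def w_def unit_ball_def PiE_iff)
  have "\<exists>A. finite A \<and> A \<subseteq> C \<and> nrm (\<lambda>g. restr C (v i) g - restr A (v i) g) \<le> e / 4"
    if i: "i \<in> {1..m}" for i
  proof -
    obtain A where A: "finite A" "nrm (\<lambda>g. restr C (v i) g - restr A (restr C (v i)) g) \<le> e / 4"
      using ell2_finite_approx[OF ell2_restr(1)[OF v[OF i], of C], of "e / 4"] e by auto
    moreover have "restr A (restr C (v i)) = restr (A \<inter> C) (v i)"
      by (auto simp: restr_def)
    ultimately show ?thesis by (intro exI[of _ "A \<inter> C"]) auto
  qed
  then obtain A where A: "\<And>i. i \<in> {1..m} \<Longrightarrow> finite (A i) \<and> A i \<subseteq> C \<and>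
      nrm (\<lambda>g. restr C (v i) g - restr (A i) (v i) g) \<le> e / 4"
    by metis
  \<comment> \<open>The error in \<open>y j\<close> gets multiplied by the sum of the coefficients
    on \<open>A i\<close>. Hence the \<open>A i\<close> are chosen first and \<open>E j\<close> with
    precision \<open>e / (4 * K)\<close>; the summand 1 keeps \<open>K\<close> positive.\<close>
  define K where "K = (\<Sum>i\<in>{1..m}. \<Sum>h\<in>A i. cmod (v i h)) + 1"
  have K: "K > 0" by (simp add: K_def add_nonneg_pos sum_nonneg)
  have K_le: "(\<Sum>h\<in>A i. cmod (v i h)) \<le> K" if "i \<in> {1..m}" for i
  proof -
    have "(\<Sum>h\<in>A i. cmod (v i h)) \<le> (\<Sum>i\<in>{1..m}. \<Sum>h\<in>A i. cmod (v i h))"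
      using that by (intro member_le_sum) (auto intro: sum_nonneg)
    then show ?thesis by (simp add: K_def)
  qed
  have "\<exists>E. finite E \<and> E \<subseteq> carrier G \<and> nrm (\<lambda>g. w j g - restr E (w j) g) \<le> e / (4 * K)"
    if "j \<in> {1..m}" for j
    using ell2_finite_approx[OF w[OF that], of "e / (4 * K)"] e K by auto
  then obtain E where E: "\<And>j. j \<in> {1..m} \<Longrightarrow> finite (E j) \<and> E j \<subseteq> carrier G \<and>
      nrm (\<lambda>g. w j g - restr (E j) (w j) g) \<le> e / (4 * K)"
    by metis
  have A': "finite (\<Union>i\<in>{1..m}. A i)" "(\<Union>i\<in>{1..m}. A i) \<subseteq> C"
    using A by (simp_all add: UN_subset_iff)
  have E': "finite (\<Union>j\<in>{1..m}. E j)" "(\<Union>j\<in>{1..m}. E j) \<subseteq> carrier G"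
    using E by (simp_all add: UN_subset_iff)
  obtain u where u: "u \<in> carrier G" and u_comm: "\<forall>h\<in>(\<Union>i\<in>{1..m}. A i). \<forall>f\<in>(\<Union>j\<in>{1..m}. E j).
      conj_by G u h \<otimes> f = f \<otimes> conj_by G u h"
    using absorb[OF A' E'] by (elim bexE)
  have comm: "conj_by G u h \<otimes> f = f \<otimes> conj_by G u h"
    if "i \<in> {1..m}" "j \<in> {1..m}" "h \<in> A i" "f \<in> E j" for i j h f
    by (rule bspec[OF bspec[OF u_comm]]) (use that in auto)
  have "norm2 vN (commutator vN (lt u \<otimes>\<^bsub>vN\<^esub> x i \<otimes>\<^bsub>vN\<^esub> star vN (lt u)) (y j)) \<le>
      2 * (MAX i\<in>{1..m}. sqrt (chi vN (x i) (lt a) (lt b))) + e"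
    if i: "i \<in> {1..m}" and j: "j \<in> {1..m}" for i j
  proof -
    let ?R = "restr (carrier G - C) (v i)" and ?D = "\<lambda>g. restr C (v i) g - restr (A i) (v i) g"
    have Ai: "finite (A i)" "A i \<subseteq> C" "nrm ?D \<le> e / 4" using A[OF i] by auto
    have Ej: "finite (E j)" "E j \<subseteq> carrier G" "nrm (\<lambda>g. w j g - restr (E j) (w j) g) \<le> e / (4 * K)"
      using E[OF j] by auto
    \<comment> \<open>The remainder consists of the part off \<open>C\<close> and the part in
      \<open>C\<close> missed by \<open>A i\<close>. Doubled, the latter costs \<open>e / 2\<close>;
      the error from \<open>E j\<close> costs the other \<open>e / 2\<close>.\<close>
    have "(\<lambda>g. v i g - restr (A i) (v i) g) = (\<lambda>g. ?R g + ?D g)"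
      using Ai C ell2_zero_outside[OF v[OF i]] by (auto simp: restr_def fun_eq_iff)
    then have "nrm (\<lambda>g. v i g - restr (A i) (v i) g) \<le> nrm ?R + nrm ?D"
      using ell2_add(2)[of ?R "carrier G" ?D] ell2_restr(1)[OF v[OF i]] ell2_diff(1) by metis
    moreover have "nrm ?R \<le> sqrt (chi vN (x i) (lt a) (lt b))"
      unfolding v_def by (rule gap_chi[OF xi[OF i]])
    moreover have "\<dots> \<le> (MAX i\<in>{1..m}. sqrt (chi vN (x i) (lt a) (lt b)))"
      using i by (intro Max_ge) auto
    moreover have "(\<Sum>h\<in>A i. cmod (v i h)) * (2 * nrm (\<lambda>g. w j g - restr (E j) (w j) g)) \<le>
        K * (2 * (e / (4 * K)))"
      using K_le[OF i] Ej(3) K by (intro mult_mono) auto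
    moreover have "K * (2 * (e / (4 * K))) = e / 2" using K by simp
    moreover have "norm2 vN (commutator vN (lt u \<otimes>\<^bsub>vN\<^esub> x i \<otimes>\<^bsub>vN\<^esub> star vN (lt u)) (y j)) \<le>
        2 * nrm (\<lambda>g. v i g - restr (A i) (v i) g) +
        (\<Sum>h\<in>A i. cmod (v i h)) * (2 * nrm (\<lambda>g. w j g - restr (E j) (w j) g))"
      unfolding v_def w_def using Ai(2) C
      by (intro commutator_estimate[OF yi[OF j] xi[OF i] u Ai(1) _ Ej(1,2) comm[OF i j]]) auto
    ultimately show ?thesis using Ai(3) by linarith
  qed
  then have "twisted m vN x y (lt u) \<le> 2 * (MAX i\<in>{1..m}. sqrt (chi vN (x i) (lt a) (lt b))) + e"
    unfolding twisted_le_iff[OF m] by blast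
  with u that show ?thesis by blast
qed

lemma psi_zero:
  assumes m: "1 \<le> m"
  shows "psi m vN (lt a) (lt b) = 0"
proof -
  let ?B = "{1..m} \<rightarrow>\<^sub>E unit_ball vN"
  have zero: "monus (INF u\<in>unitaries vN. twisted m vN x y u)
         (2 * (MAX i\<in>{1..m}. sqrt (chi vN (x i) (lt a) (lt b)))) = 0"
    if x: "x \<in> ?B" and y: "y \<in> ?B" for x y
  proof -
    have "(INF u\<in>unitaries vN. twisted m vN x y u) \<le>
        2 * (MAX i\<in>{1..m}. sqrt (chi vN (x i) (lt a) (lt b))) + e" if e: "e > 0" for e
    proof -
      obtain u where u: "u \<in> carrier G" and le: "twisted m vN x y (lt u) \<le>
          2 * (MAX i\<in>{1..m}. sqrt (chi vN (x i) (lt a) (lt b))) + e"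
        using twisted_approx[OF m x y e] by blast
      have "(INF u\<in>unitaries vN. twisted m vN x y u) \<le> twisted m vN x y (lt u)"
        using twisted_nonneg[OF m x y] u by (intro cINF_lower lt_unitary bdd_belowI2[of _ 0]) auto
      with le show ?thesis by linarith
    qed
    then have "(INF u\<in>unitaries vN. twisted m vN x y u) \<le>
        2 * (MAX i\<in>{1..m}. sqrt (chi vN (x i) (lt a) (lt b)))"
      by (rule field_le_epsilon)
    then show ?thesis by (simp add: monus_def)
  qed
  have "(\<lambda>k\<in>{1..m}. (\<lambda>f\<in>H. f)) \<in> ?B" using id_in_unit_ball by auto
  then have "?B \<times> ?B \<noteq> {}" by blast
  moreover have "psi m vN (lt a) (lt b) = (SUP p \<in> ?B \<times> ?B. 0)"
    unfolding psi_eq by (intro SUP_cong) (auto simp only: mem_Times_iff split_beta intro!: zero)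
  ultimately show ?thesis by simp
qed

theorem tau_zero:
  assumes m: "1 \<le> m"
  shows "tau m vN = 0"
proof (rule antisym)
  have "tau m vN \<le> (\<lambda>(va, vb). psi m vN va vb) (lt a, lt b)"
    unfolding tau_def using psi_nonneg[OF m] a b
    by (intro cINF_lower bdd_belowI2[of _ 0]) (auto simp: lt_unitary)
  then show "tau m vN \<le> 0" by (simp add: psi_zero[OF m])
  show "0 \<le> tau m vN"
    unfolding tau_def using psi_nonneg[OF m] a b lt_unitary by (intro cINF_greatest) auto
qed

end

subsection \<open>Normal forms for stable letters centralizing subgroups\<close>

text \<open>\<open>Syl t j n w\<close> stands for the product of \<open>t\<close>, the
  \<open>n\<close>-th power of the stable letter with index \<open>j\<close>, and
  \<open>w\<close>.\<close>

datatype 'k nf = End 'k | Syl 'k nat int "'k nf"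

text \<open>The data of a multiple HNN extension of \<open>K\<close> in which the letter with index
  \<open>j\<close> centralizes \<open>N j\<close>.\<close>

locale stable_letters = group K for K (structure) +
  fixes N :: "nat \<Rightarrow> 'a set"
  assumes sub: "subgroup (N j) K"
begin

lemma N_carrier: "n \<in> N j \<Longrightarrow> n \<in> carrier K"
  using subgroup.mem_carrier[OF sub] .

lemma N_one: "\<one> \<in> N j" by (rule subgroup.one_closed[OF sub])

lemma N_mult: "m \<in> N j \<Longrightarrow> n \<in> N j \<Longrightarrow> m \<otimes> n \<in> N j" by (rule subgroup.m_closed[OF sub])

lemma N_inv: "n \<in> N j \<Longrightarrow> inv n \<in> N j" by (rule subgroup.m_inv_closed[OF sub])

lemma N_mult_right_iff:
  assumes "n \<in> N j" "k \<in> carrier K"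
  shows "k \<otimes> n \<in> N j \<longleftrightarrow> k \<in> N j"
proof
  assume "k \<otimes> n \<in> N j"
  then have "(k \<otimes> n) \<otimes> inv n \<in> N j" by (rule N_mult[OF _ N_inv[OF assms(1)]])
  then show "k \<in> N j" using assms N_carrier[OF assms(1)] by (simp add: m_assoc)
qed (use assms N_mult in blast)

lemma N_mult_left_iff:
  assumes "n \<in> N j" "k \<in> carrier K"
  shows "n \<otimes> k \<in> N j \<longleftrightarrow> k \<in> N j"
proof
  assume "n \<otimes> k \<in> N j"
  then have "inv n \<otimes> (n \<otimes> k) \<in> N j" by (rule N_mult[OF N_inv[OF assms(1)]])
  then show "k \<in> N j" using assms N_carrier[of n j] by (simp add: m_assoc[symmetric])
qed (use assms N_mult in blast)

text \<open>Representatives of the left cosets of \<open>N j\<close>. The predicate under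
  \<open>SOME\<close> depends on the coset alone, and so does the choice. The coset
  \<open>N j\<close> itself gets \<open>\<one>\<close>, so that a leading bare letter can be
  recognized.\<close>

definition rep :: "nat \<Rightarrow> 'a \<Rightarrow> 'a"
  where "rep j k = (if k \<in> N j then \<one> else SOME x. x \<in> carrier K \<and> inv x \<otimes> k \<in> N j)"

lemma rep:
  assumes k: "k \<in> carrier K"
  shows rep_carrier: "rep j k \<in> carrier K" and rep_N: "inv (rep j k) \<otimes> k \<in> N j"
proof -
  have "rep j k \<in> carrier K \<and> inv (rep j k) \<otimes> k \<in> N j"
  proof (cases "k \<in> N j")
    case False
    have "k \<in> carrier K \<and> inv k \<otimes> k \<in> N j" using k N_one by simp
    then have "(SOME x. x \<in> carrier K \<and> inv x \<otimes> k \<in> N j) \<in> carrier K \<and>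
        inv (SOME x. x \<in> carrier K \<and> inv x \<otimes> k \<in> N j) \<otimes> k \<in> N j"
      by (rule someI)
    then show ?thesis using False by (simp add: rep_def)
  qed (use k in \<open>simp add: rep_def\<close>)
  then show "rep j k \<in> carrier K" "inv (rep j k) \<otimes> k \<in> N j" by auto
qed

lemma rep_mult_N:
  assumes k: "k \<in> carrier K" and n: "n \<in> N j"
  shows "rep j (k \<otimes> n) = rep j k"
proof -
  have "(x \<in> carrier K \<and> inv x \<otimes> (k \<otimes> n) \<in> N j) = (x \<in> carrier K \<and> inv x \<otimes> k \<in> N j)" for x
    using k n N_carrier[OF n] N_mult_right_iff[OF n, of "inv x \<otimes> k"] by (auto simp: m_assoc)
  then show ?thesis by (simp add: rep_def N_mult_right_iff[OF n k])
qed

lemma rep_one: "rep j \<one> = \<one>"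
  by (simp add: rep_def N_one)

lemma rep_eq_one_iff:
  assumes "k \<in> carrier K"
  shows "rep j k = \<one> \<longleftrightarrow> k \<in> N j"
  using rep_N[OF assms, of j] assms by (auto simp: rep_def)

lemma rep_rep:
  assumes "k \<in> carrier K"
  shows "rep j (rep j k) = rep j k"
  using rep_mult_N[OF rep_carrier[OF assms, of j] rep_N[OF assms, of j]] assms
    rep_carrier[OF assms, of j]
  by (simp add: m_assoc[symmetric])

section \<open>Reduced normal forms and multiplication on the left\<close>

fun starts :: "nat \<Rightarrow> 'a nf \<Rightarrow> bool"
  where "starts j (End k) = False"
  | "starts j (Syl t i n w) = (i = j \<and> t = \<one>)"

text \<open>The reduced forms of Britton type: every base part before a letter is a coset
  representative, and two powers of one letter separated only by \<open>\<one>\<close> are excluded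
  since they would merge.\<close>

fun wf :: "'a nf \<Rightarrow> bool"
  where "wf (End k) = (k \<in> carrier K)"
  | "wf (Syl t j n w) = (t \<in> carrier K \<and> rep j t = t \<and> n \<noteq> 0 \<and> wf w \<and> \<not> starts j w)"

text \<open>Left multiplication by \<open>k\<close>: the product \<open>k \<otimes> t\<close> is
  split into a representative and an element of \<open>N j\<close>, which commutes with the letter
  and is passed on to \<open>w\<close>.\<close>

fun kact :: "'a \<Rightarrow> 'a nf \<Rightarrow> 'a nf"
  where "kact k (End l) = End (k \<otimes> l)"
  | "kact k (Syl t j n w) = Syl (rep j (k \<otimes> t)) j n (kact (inv (rep j (k \<otimes> t)) \<otimes> (k \<otimes> t)) w)"

fun lact :: "nat \<Rightarrow> int \<Rightarrow> 'a nf \<Rightarrow> 'a nf"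
  where "lact j n (End k) = (if n = 0 then End k else Syl \<one> j n (End k))"
  | "lact j n (Syl t i m w) =
      (if i = j \<and> t = \<one> then (if n + m = 0 then w else Syl \<one> j (n + m) w)
       else (if n = 0 then Syl t i m w else Syl \<one> j n (Syl t i m w)))"

lemma kact_starts:
  assumes "wf w" "n \<in> N j"
  shows "starts j (kact n w) \<longleftrightarrow> starts j w"
proof (cases w)
  case (Syl t i m v)
  then have t: "t \<in> carrier K" "rep i t = t" using assms by auto
  then have "rep j (n \<otimes> t) = \<one> \<longleftrightarrow> t = \<one>" if "i = j"
    using that assms N_carrier rep_eq_one_iff[of "n \<otimes> t" j] rep_eq_one_iff[of t j] N_mult_left_iff[of n j t]
    by auto
  then show ?thesis using Syl by auto
qed simp

lemma kact_wf: "wf w \<Longrightarrow> k \<in> carrier K \<Longrightarrow> wf (kact k w)"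
proof (induction w arbitrary: k)
  case (Syl t j n w)
  then have "k \<otimes> t \<in> carrier K" by simp
  then show ?case
    using Syl rep_carrier rep_N rep_rep kact_starts N_carrier by auto
qed simp

lemma kact_mult:
  "wf w \<Longrightarrow> k \<in> carrier K \<Longrightarrow> l \<in> carrier K \<Longrightarrow> kact k (kact l w) = kact (k \<otimes> l) w"
proof (induction w arbitrary: k l)
  case (Syl t j n w)
  then have t: "t \<in> carrier K" and w: "wf w" by auto
  \<comment> \<open>\<open>s\<close> and \<open>h\<close> are the representative and the remainder
    produced by \<open>l\<close>. As
    \<open>k \<otimes> s \<otimes> h = k \<otimes> l \<otimes> t\<close>, the outer action meets the
    same coset, and its remainder times \<open>h\<close> is that of the combined action.\<close>
  define s where "s = rep j (l \<otimes> t)"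
  define h where "h = inv s \<otimes> (l \<otimes> t)"
  have lt: "l \<otimes> t \<in> carrier K" using Syl.prems t by simp
  have s: "s \<in> carrier K" and h: "h \<in> N j"
    using rep_carrier[OF lt] rep_N[OF lt] by (simp_all add: s_def h_def)
  have hK: "h \<in> carrier K" by (rule N_carrier[OF h])
  have sh: "s \<otimes> h = l \<otimes> t" using s lt by (simp add: h_def m_assoc[symmetric])
  have eq: "k \<otimes> s \<otimes> h = k \<otimes> l \<otimes> t"
    using Syl.prems s hK t by (simp add: m_assoc sh)
  have r: "rep j (k \<otimes> s) = rep j (k \<otimes> l \<otimes> t)"
    using rep_mult_N[of "k \<otimes> s" h j] Syl.prems s h by (simp add: eq)
  define q where "q = rep j (k \<otimes> s)"
  have q: "q \<in> carrier K" unfolding q_def using Syl.prems s by (simp add: rep_carrier)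
  have "inv q \<otimes> (k \<otimes> s) \<otimes> h = inv q \<otimes> (k \<otimes> l \<otimes> t)"
    using q Syl.prems s hK t by (simp add: m_assoc sh)
  then have "kact (inv q \<otimes> (k \<otimes> s)) (kact h w) = kact (inv q \<otimes> (k \<otimes> l \<otimes> t)) w"
    using Syl.IH[OF w, of "inv q \<otimes> (k \<otimes> s)" h] q Syl.prems s hK by simp
  then show ?case by (simp add: s_def[symmetric] h_def[symmetric] q_def[symmetric] r[symmetric])
qed (simp add: m_assoc)

lemma kact_one: "wf w \<Longrightarrow> kact \<one> w = w"
  by (induction w) auto

lemma lact_fresh: "\<not> starts j w \<Longrightarrow> n \<noteq> 0 \<Longrightarrow> lact j n w = Syl \<one> j n w"
  by (cases w) auto

lemma lact_zero: "wf w \<Longrightarrow> lact j 0 w = w"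
  by (cases w) auto

lemma lact_wf: "wf w \<Longrightarrow> wf (lact j n w)"
  by (cases w) (auto simp: rep_one)

lemma lact_add: "wf w \<Longrightarrow> lact j m (lact j n w) = lact j (m + n) w"
proof (cases w)
  case (Syl t i p v)
  assume w: "wf w"
  then have v: "wf v" "\<not> starts i v" "p \<noteq> 0" using Syl by auto
  show ?thesis
  proof (cases "i = j \<and> t = \<one>")
    case True
    then have "lact j m v = (if m = 0 then v else Syl \<one> j m v)"
      using v by (auto simp: lact_fresh lact_zero)
    then show ?thesis using Syl True v by (auto simp: algebra_simps add_eq_0_iff)
  next
    case False
    then show ?thesis using Syl by auto
  qed
qed auto

text \<open>Elements of \<open>N j\<close> keep the representative \<open>\<one>\<close>, so they
  slide past the letter. With \<open>kact_mult\<close> and \<open>lact_add\<close>, all relations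
  hold for the operators on normal forms; this is van der Waerden's method for separating group
  elements.\<close>

lemma lact_kact:
  assumes h: "h \<in> N j" and w: "wf w"
  shows "kact h (lact j n w) = lact j n (kact h w)"
proof -
  have hK: "h \<in> carrier K" by (rule N_carrier[OF h])
  have one: "kact h (Syl \<one> j m v) = Syl \<one> j m (kact h v)" for m v
    using h hK rep_eq_one_iff[OF hK, of j] by simp
  show ?thesis
  proof (cases "starts j w")
    case True
    then obtain m v where "w = Syl \<one> j m v" by (cases w) auto
    then show ?thesis using h hK rep_eq_one_iff[OF hK, of j] by simp
  next
    case False
    then have f: "\<not> starts j (kact h w)" using kact_starts[OF w h] by simp
    show ?thesis
    proof (cases "n = 0")
      case True
      then show ?thesis using w kact_wf[OF w hK] by (simp add: lact_zero)
    next
      case False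
      then show ?thesis
        using lact_fresh[OF f] lact_fresh[OF \<open>\<not> starts j w\<close>] one
          by (simp only: not_False_eq_True)
    qed
  qed
qed

section \<open>First syllables under multiplication on the right\<close>

fun head :: "'a nf \<Rightarrow> ('a \<times> nat) option"
  where "head (End k) = None"
  | "head (Syl t j n w) = Some (t, j)"

lemma starts_head: "starts j w \<longleftrightarrow> head w = Some (\<one>, j)"
  by (cases w) auto

text \<open>The normal form of the product of the element described by the first argument with any
  element having the second argument as normal form.\<close>

fun subst_end :: "'a nf \<Rightarrow> 'a nf \<Rightarrow> 'a nf"
  where "subst_end (End k) v = kact k v"
  | "subst_end (Syl t j n w) v = kact t (lact j n (subst_end w v))"

lemma subst_end_wf: "wf w \<Longrightarrow> wf v \<Longrightarrow> wf (subst_end w v)"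
  by (induction w) (auto simp: kact_wf lact_wf)

lemma kact_lact_fresh:
  assumes "wf (Syl t j n w)" "n \<noteq> 0" "wf v" "\<not> starts j v"
  shows "kact t (lact j n v) = Syl t j n v"
  using assms by (simp add: lact_fresh kact_one)

text \<open>The base element is absorbed by the final \<open>End\<close>, and the syllables before
  it stay reduced.\<close>

lemma head_subst_end_End:
  "wf w \<Longrightarrow> k \<in> carrier K \<Longrightarrow> head (subst_end w (End k)) = head w"
proof (induction w)
  case (Syl t j n w)
  then have "wf w" "\<not> starts j (subst_end w (End k))" by (auto simp: starts_head)
  then show ?case
    using kact_lact_fresh[OF Syl.prems(1), of "subst_end w (End k)"] Syl.prems
    by (simp add: subst_end_wf)
qed simp

text \<open>The new letter interacts with the last syllable at most, merging with it or cancelling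
  it, and what precedes is reduced already. So the head survives unless the only syllable
  cancels.\<close>

lemma head_subst_end_letter:
  assumes "wf (Syl t j n w)" and e: "e \<noteq> 0"
  shows "head (subst_end (Syl t j n w) (Syl \<one> J e (End \<one>))) = Some (t, j) \<or>
    j = J \<and> (\<exists>k. subst_end (Syl t j n w) (Syl \<one> J e (End \<one>)) = End k)"
  using assms(1)
proof (induction w arbitrary: t j n)
  case (End k)
  let ?v = "Syl \<one> J e (End \<one>)"
  have v: "wf ?v" using e by (simp add: rep_one)
  have k: "k \<in> carrier K" and t: "t \<in> carrier K" "rep j t = t" and n: "n \<noteq> 0" using End by auto
  obtain l where l: "kact k ?v = Syl (rep J k) J e (End l)" using k by simp
  show ?case
  proof (cases "starts j (kact k ?v)")
    case False
    then show ?thesis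
      using kact_lact_fresh[OF End n kact_wf[OF v k]] by simp
  next
    case True
    then have "j = J" "rep J k = \<one>" using l by auto
    then show ?thesis using l t by simp
  qed
next
  case (Syl s i p w)
  let ?v = "Syl \<one> J e (End \<one>)"
  have v: "wf ?v" using e by (simp add: rep_one)
  have w: "wf (Syl s i p w)" and f: "\<not> starts j (Syl s i p w)" and n: "n \<noteq> 0"
    using Syl.prems by auto
  have "\<not> starts j (subst_end (Syl s i p w) ?v)"
    using Syl.IH[OF w] f by (auto simp: starts_head)
  then show ?case
    using kact_lact_fresh[OF Syl.prems n subst_end_wf[OF w v]] by simp
qed

text \<open>Under the hypotheses, multiplying by a power of the letter on the right does not bring
  that letter to the front, so the power multiplied on the left stays there uncancelled. This
  becomes the condition \<open>cover\<close>.\<close>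

lemma starts_conj_letter:
  assumes w: "wf w" and e: "e \<noteq> 0" and "\<not> starts J w" and "\<And>k. w = End k \<Longrightarrow> k \<notin> N J"
  shows "starts J (lact J (- e) (subst_end w (Syl \<one> J e (End \<one>))))"
proof -
  have "\<not> starts J (subst_end w (Syl \<one> J e (End \<one>)))"
  proof (cases w)
    case (End k)
    then show ?thesis using assms rep_eq_one_iff[of k J] by simp
  next
    case (Syl t j n v)
    then show ?thesis
      using head_subst_end_letter[of t j n v e J] assms by (auto simp: starts_head)
  qed
  then show ?thesis using e by (simp add: lact_fresh)
qed

text \<open>The factor \<open>l\<close> does not change the head, and \<open>k\<close> replaces its
  representative \<open>\<one>\<close> by \<open>rep J k\<close>. This becomes the two disjointness
  conditions.\<close>

lemma starts_conj_base:
  assumes w: "wf w" and k: "k \<in> carrier K" "l \<in> carrier K" and s: "starts J w"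
  shows "starts J (kact k (subst_end w (End l))) \<longleftrightarrow> k \<in> N J"
proof -
  have "head (subst_end w (End l)) = Some (\<one>, J)"
    using head_subst_end_End[OF w k(2)] s by (simp add: starts_head)
  then obtain n v where "subst_end w (End l) = Syl \<one> J n v"
    by (cases "subst_end w (End l)") auto
  then show ?thesis using k rep_eq_one_iff[OF k(1), of J] by simp
qed

end

subsection \<open>The group \<open>T\<^sub>1(\<Gamma>)\<close> as a group with stable letters\<close>

locale T1_construction =
  fixes \<Gamma> :: "('a, 'b) monoid_scheme"
  assumes \<Gamma>: "group \<Gamma>"
begin

sublocale G: group \<Gamma> by (rule \<Gamma>)

section \<open>The base group and its subgroups \<open>tail j\<close>\<close>

abbreviation "K \<equiv> power_semidirect \<Gamma>"

lemma K_carrier: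
  "k \<in> carrier K \<longleftrightarrow> fst k \<in> ({1..} \<rightarrow>\<^sub>E carrier \<Gamma>) \<and> finite {i \<in> {1..}. fst k i \<noteq> \<one>\<^bsub>\<Gamma>\<^esub>} \<and>
    snd k permutes {1..} \<and> finite {i. snd k i \<noteq> i}"
  by (cases k) (auto simp: power_semidirect_def semidirect_product_def direct_power_def
      carrier_sum_group[OF \<Gamma>] S_infty_def)

lemma K_fst: "k \<in> carrier K \<Longrightarrow> 1 \<le> i \<Longrightarrow> fst k i \<in> carrier \<Gamma>"
  by (auto simp: K_carrier)

lemma K_mult:
  "k \<otimes>\<^bsub>K\<^esub> l = (\<lambda>i\<in>{1..}. fst k i \<otimes>\<^bsub>\<Gamma>\<^esub> fst l (inv_into UNIV (snd k) i), snd k \<circ> snd l)"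
  by (simp add: power_semidirect_def semidirect_product_def direct_power_def S_infty_def
      permute_indices_def split_beta)

lemma K_one: "\<one>\<^bsub>K\<^esub> = (\<lambda>i\<in>{1..}. \<one>\<^bsub>\<Gamma>\<^esub>, id)"
  by (simp add: power_semidirect_def semidirect_product_def direct_power_def S_infty_def)

text \<open>The direct sum of the \<open>\<Gamma>\<^sub>i\<close> with \<open>i \<ge> j\<close>, the
  part of the base that is to commute with the letters \<open>Lam j n\<close>.\<close>

definition tail :: "nat \<Rightarrow> ((nat \<Rightarrow> 'a) \<times> (nat \<Rightarrow> nat)) set"
  where "tail j = {k \<in> carrier K. snd k = id \<and> (\<forall>i. 1 \<le> i \<longrightarrow> i < j \<longrightarrow> fst k i = \<one>\<^bsub>\<Gamma>\<^esub>)}"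

lemma tail_subgroup: "subgroup (tail j) K"
proof -
  interpret K: group K by (rule power_semidirect_group[OF \<Gamma>])
  show ?thesis
  proof (rule K.subgroupI)
    show "tail j \<subseteq> carrier K" by (auto simp: tail_def)
    have "\<one>\<^bsub>K\<^esub> \<in> tail j" by (auto simp: tail_def K_one[symmetric]) (simp_all add: K_one)
    then show "tail j \<noteq> {}" by blast
  next
    fix k assume k: "k \<in> tail j"
    then have kK: "k \<in> carrier K" and s: "snd k = id" by (auto simp: tail_def)
    define l where "l = (\<lambda>i\<in>{1..}. inv\<^bsub>\<Gamma>\<^esub> (fst k i), id :: nat \<Rightarrow> nat)"
    have "{i \<in> {1..}. fst l i \<noteq> \<one>\<^bsub>\<Gamma>\<^esub>} \<subseteq> {i \<in> {1..}. fst k i \<noteq> \<one>\<^bsub>\<Gamma>\<^esub>}"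
      by (auto simp: l_def)
    then have fin: "finite {i \<in> {1..}. fst l i \<noteq> \<one>\<^bsub>\<Gamma>\<^esub>}"
      by (rule finite_subset) (use kK in \<open>simp add: K_carrier\<close>)
    have l: "l \<in> carrier K"
      unfolding K_carrier
      by (intro conjI fin) (use kK in \<open>auto simp: K_carrier l_def permutes_id\<close>)
    have "l \<otimes>\<^bsub>K\<^esub> k = \<one>\<^bsub>K\<^esub>"
      using K_fst[OF kK] s by (auto simp: K_mult K_one l_def intro!: restrict_ext)
    then have "inv\<^bsub>K\<^esub> k = l" using kK l by (rule K.inv_equality)
    then show "inv\<^bsub>K\<^esub> k \<in> tail j"
      using l k by (auto simp: tail_def l_def)
  next
    fix k l assume k: "k \<in> tail j" and l: "l \<in> tail j"
    then have "k \<otimes>\<^bsub>K\<^esub> l \<in> carrier K" by (auto simp: tail_def)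
    then show "k \<otimes>\<^bsub>K\<^esub> l \<in> tail j"
      using k l by (auto simp: tail_def) (auto simp: K_mult)
  qed
qed

sublocale stable_letters K tail
  using power_semidirect_group[OF \<Gamma>] tail_subgroup
  by (simp add: stable_letters_def stable_letters_axioms_def)

text \<open>The supports are disjoint: \<open>k\<close> lives on the indices up to \<open>M\<close>,
  and its permutation maps this block to itself.\<close>

lemma tail_commute:
  assumes h: "h \<in> tail (Suc M)" and k: "k \<in> carrier K"
    and fix_k: "\<And>i. i > M \<Longrightarrow> fst k i = \<one>\<^bsub>\<Gamma>\<^esub> \<and> snd k i = i"
  shows "h \<otimes>\<^bsub>K\<^esub> k = k \<otimes>\<^bsub>K\<^esub> h"
proof -
  have hK: "h \<in> carrier K" and s: "snd h = id"
    and h1: "\<And>i. 1 \<le> i \<Longrightarrow> i \<le> M \<Longrightarrow> fst h i = \<one>\<^bsub>\<Gamma>\<^esub>"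
    using h by (auto simp: tail_def)
  let ?q = "inv_into UNIV (snd k)"
  have p: "snd k permutes {1..}" using k by (simp add: K_carrier)
  have "fst h i \<otimes>\<^bsub>\<Gamma>\<^esub> fst k i = fst k i \<otimes>\<^bsub>\<Gamma>\<^esub> fst h (?q i)" if i: "1 \<le> i" for i
  proof (cases "i \<le> M")
    case True
    have "\<not> ?q i > M"
      using fix_k[of "?q i"] True permutes_inverses(1)[OF p, of i] by force
    moreover have "1 \<le> ?q i" using permutes_in_image[OF permutes_inv[OF p], of i] i by simp
    ultimately have "fst h (?q i) = \<one>\<^bsub>\<Gamma>\<^esub>" "fst h i = \<one>\<^bsub>\<Gamma>\<^esub>" using h1 i True by auto
    then show ?thesis using K_fst[OF k i] by simp
  next
    case False
    then have "?q i = i" "fst k i = \<one>\<^bsub>\<Gamma>\<^esub>"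
      using fix_k[of i] permutes_inverses(2)[OF p, of i] by auto
    then show ?thesis using K_fst[OF hK i] by simp
  qed
  then show ?thesis by (auto simp: K_mult s)
qed

section \<open>Words and their action on normal forms\<close>

lemma Base_word: "k \<in> carrier K \<Longrightarrow> [Base k] \<in> T1_words \<Gamma>"
  and Lam_word: "1 \<le> j \<Longrightarrow> [Lam j n] \<in> T1_words \<Gamma>"
  and append_word: "u \<in> T1_words \<Gamma> \<Longrightarrow> v \<in> T1_words \<Gamma> \<Longrightarrow> u @ v \<in> T1_words \<Gamma>"
  by (auto simp: T1_words_def)

lemma T1_words_induct [consumes 1, case_names Nil Base Lam]:
  assumes "u \<in> T1_words \<Gamma>" and "P []"
    and "\<And>k u. k \<in> carrier K \<Longrightarrow> u \<in> T1_words \<Gamma> \<Longrightarrow> P u \<Longrightarrow> P (Base k # u)"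
    and "\<And>j n u. 1 \<le> j \<Longrightarrow> u \<in> T1_words \<Gamma> \<Longrightarrow> P u \<Longrightarrow> P (Lam j n # u)"
  shows "P u"
  using assms(1)
proof (induction u)
  case (Cons x u)
  then have "u \<in> T1_words \<Gamma>" "x \<in> Base ` carrier K \<union> {Lam j n | j n. 1 \<le> j}"
    by (auto simp: T1_words_def)
  with Cons.IH assms(3,4) show ?case by auto
qed (rule assms(2))

fun letter_act :: "((nat \<Rightarrow> 'a) \<times> (nat \<Rightarrow> nat)) T1_letter \<Rightarrow>
    ((nat \<Rightarrow> 'a) \<times> (nat \<Rightarrow> nat)) nf \<Rightarrow> ((nat \<Rightarrow> 'a) \<times> (nat \<Rightarrow> nat)) nf"
  where "letter_act (Base k) w = kact k w"
  | "letter_act (Lam j n) w = lact j n w"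

abbreviation "word_act \<equiv> foldr letter_act"

lemma word_act_wf: "u \<in> T1_words \<Gamma> \<Longrightarrow> wf w \<Longrightarrow> wf (word_act u w)"
  by (induction rule: T1_words_induct) (auto simp: kact_wf lact_wf)

lemma Gamma_elem_tail: "x \<in> carrier \<Gamma> \<Longrightarrow> j \<le> i \<Longrightarrow> Gamma_elem \<Gamma> i x \<in> tail j"
  using Gamma_elem_carrier[OF \<Gamma>, of x i] by (auto simp: tail_def Gamma_elem_def)

text \<open>Each relation of the presentation was verified for \<open>kact\<close> and
  \<open>lact\<close>, so words act through their classes.\<close>

lemma T1_cong_act: "T1_cong \<Gamma> u v \<Longrightarrow> wf w \<Longrightarrow> word_act u w = word_act v w"
proof (induction arbitrary: w rule: T1_cong.induct)
  case (append u v u' v')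
  then have "wf (word_act v' w)" using T1_cong_words[OF \<Gamma> append(2)] word_act_wf by blast
  with append show ?case by simp
next
  case (commute j i x k)
  then show ?case using lact_kact[OF Gamma_elem_tail[of x j i]] by simp
qed (simp_all add: kact_one kact_mult lact_zero lact_add)

definition cls :: "'a T1_word \<Rightarrow> 'a T1_word set"
  where "cls u = T1_rel \<Gamma> `` {u}"

abbreviation "T \<equiv> T1 \<Gamma>"

sublocale T: group T by (rule T1_group[OF \<Gamma>])

lemma cls_carrier [simp]: "u \<in> T1_words \<Gamma> \<Longrightarrow> cls u \<in> carrier T"
  by (auto simp: T1_def cls_def quotient_def)

lemma T_cases:
  assumes "g \<in> carrier T" obtains u where "u \<in> T1_words \<Gamma>" "g = cls u"
  using assms by (auto simp: T1_def cls_def quotient_def)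

lemma cls_mult: "u \<in> T1_words \<Gamma> \<Longrightarrow> v \<in> T1_words \<Gamma> \<Longrightarrow> cls u \<otimes>\<^bsub>T\<^esub> cls v = cls (u @ v)"
  unfolding cls_def by (rule T1_mult_class[OF \<Gamma>])

lemma cls_Nil: "cls [] = \<one>\<^bsub>T\<^esub>"
  by (simp add: cls_def T1_def)

lemma cls_eq: "T1_cong \<Gamma> u v \<Longrightarrow> cls u = cls v"
  unfolding cls_def by (rule equiv_class_eq[OF T1_rel_equiv[OF \<Gamma>]]) (simp add: T1_rel_def)

text \<open>The representing word is arbitrary; on well-formed normal forms
  \<open>T1_cong_act\<close> makes the choice immaterial.\<close>

definition gact :: "'a T1_word set \<Rightarrow> ((nat \<Rightarrow> 'a) \<times> (nat \<Rightarrow> nat)) nf \<Rightarrow> ((nat \<Rightarrow> 'a) \<times> (nat \<Rightarrow> nat)) nf"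
  where "gact g = word_act (SOME u. u \<in> g)"

lemma gact_cls:
  assumes "u \<in> T1_words \<Gamma>" "wf w"
  shows "gact (cls u) w = word_act u w"
proof -
  have "u \<in> cls u" using assms by (simp add: cls_def T1_rel_def T1_cong.refl)
  then have "(SOME v. v \<in> cls u) \<in> cls u" by (rule someI)
  then have "T1_cong \<Gamma> u (SOME v. v \<in> cls u)" by (simp add: cls_def T1_rel_def)
  then show ?thesis unfolding gact_def using assms(2) by (simp add: T1_cong_act)
qed

lemma gact_wf: "g \<in> carrier T \<Longrightarrow> wf w \<Longrightarrow> wf (gact g w)"
  by (elim T_cases) (simp add: gact_cls word_act_wf)

lemma gact_mult:
  "g \<in> carrier T \<Longrightarrow> h \<in> carrier T \<Longrightarrow> wf w \<Longrightarrow> gact (g \<otimes>\<^bsub>T\<^esub> h) w = gact g (gact h w)"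
  by (elim T_cases) (simp add: cls_mult gact_cls word_act_wf append_word)

section \<open>Generators and relations inside the group\<close>

definition base :: "(nat \<Rightarrow> 'a) \<times> (nat \<Rightarrow> nat) \<Rightarrow> 'a T1_word set"
  where "base k = cls [Base k]"

definition lam :: "nat \<Rightarrow> int \<Rightarrow> 'a T1_word set"
  where "lam j n = cls [Lam j n]"

lemma base_carrier [simp]: "k \<in> carrier K \<Longrightarrow> base k \<in> carrier T"
  and lam_carrier [simp]: "1 \<le> j \<Longrightarrow> lam j n \<in> carrier T"
  by (simp_all add: base_def lam_def Base_word Lam_word)

lemma base_mult: "k \<in> carrier K \<Longrightarrow> l \<in> carrier K \<Longrightarrow> base (k \<otimes>\<^bsub>K\<^esub> l) = base k \<otimes>\<^bsub>T\<^esub> base l"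
  using cls_eq[OF T1_cong.base_mult] by (simp add: base_def cls_mult Base_word)

lemma base_one: "base \<one>\<^bsub>K\<^esub> = \<one>\<^bsub>T\<^esub>"
  using cls_eq[OF T1_cong.base_one] by (simp add: base_def cls_Nil)

lemma base_inv: "k \<in> carrier K \<Longrightarrow> inv\<^bsub>T\<^esub> (base k) = base (inv\<^bsub>K\<^esub> k)"
  by (rule T.inv_equality) (simp_all add: base_mult[symmetric] base_one)

lemma lam_add: "1 \<le> j \<Longrightarrow> lam j (m + n) = lam j m \<otimes>\<^bsub>T\<^esub> lam j n"
  using cls_eq[OF T1_cong.lam_mult[of j \<Gamma> m n]] by (simp add: lam_def cls_mult Lam_word)

lemma lam_zero: "1 \<le> j \<Longrightarrow> lam j 0 = \<one>\<^bsub>T\<^esub>"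
  using cls_eq[OF T1_cong.lam_one[of j \<Gamma>]] by (simp add: lam_def cls_Nil)

lemma lam_inv: "1 \<le> j \<Longrightarrow> inv\<^bsub>T\<^esub> (lam j n) = lam j (- n)"
  by (rule T.inv_equality) (simp_all add: lam_add[symmetric] lam_zero)

lemma gact_base: "k \<in> carrier K \<Longrightarrow> wf w \<Longrightarrow> gact (base k) w = kact k w"
  by (simp add: base_def gact_cls Base_word)

lemma gact_lam: "1 \<le> j \<Longrightarrow> wf w \<Longrightarrow> gact (lam j n) w = lact j n w"
  by (simp add: lam_def gact_cls Lam_word)

text \<open>The presentation provides this for single elements
  \<open>Gamma_elem \<Gamma> i x\<close>. An element of \<open>tail j\<close> is a finite product of
  these, peeled off by induction over a finite set containing its support.\<close>

lemma base_lam_commute: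
  assumes j: "1 \<le> j" and h: "h \<in> tail j"
  shows "base h \<otimes>\<^bsub>T\<^esub> lam j n = lam j n \<otimes>\<^bsub>T\<^esub> base h"
proof -
  have main: "base h \<otimes>\<^bsub>T\<^esub> lam j n = lam j n \<otimes>\<^bsub>T\<^esub> base h"
    if "finite S" "h \<in> tail j" "{i \<in> {1..}. fst h i \<noteq> \<one>\<^bsub>\<Gamma>\<^esub>} \<subseteq> S" for S h
    using that
  proof (induction S arbitrary: h rule: finite_induct)
    case empty
    then have "h = \<one>\<^bsub>K\<^esub>"
      by (auto simp: tail_def K_carrier K_one prod_eq_iff fun_eq_iff PiE_iff extensional_def)
    then show ?case using j by (simp add: base_one)
  next
    case (insert i S)
    have hK: "h \<in> carrier K" and s: "snd h = id" using insert.prems by (auto simp: tail_def)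
    show ?case
    proof (cases "1 \<le> i \<and> fst h i \<noteq> \<one>\<^bsub>\<Gamma>\<^esub>")
      case False
      then have "{i \<in> {1..}. fst h i \<noteq> \<one>\<^bsub>\<Gamma>\<^esub>} \<subseteq> S" using insert.prems by auto
      then show ?thesis using insert by blast
    next
      case True
      then have ij: "j \<le> i" using insert.prems(1) by (auto simp: tail_def not_less[symmetric])
      define x where "x = fst h i"
      have x: "x \<in> carrier \<Gamma>" using True hK by (auto simp: x_def K_carrier)
      \<comment> \<open>Erasing coordinate \<open>i\<close> makes \<open>h\<close> the product of
        \<open>Gamma_elem \<Gamma> i x\<close> and \<open>h'\<close>.\<close>
      define h' where "h' = ((fst h)(i := \<one>\<^bsub>\<Gamma>\<^esub>), snd h)"
      let ?g = "Gamma_elem \<Gamma> i x"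
      have "{k \<in> {1..}. fst h' k \<noteq> \<one>\<^bsub>\<Gamma>\<^esub>} \<subseteq> {k \<in> {1..}. fst h k \<noteq> \<one>\<^bsub>\<Gamma>\<^esub>}"
        by (auto simp: h'_def)
      then have fin: "finite {k \<in> {1..}. fst h' k \<noteq> \<one>\<^bsub>\<Gamma>\<^esub>}"
        by (rule finite_subset) (use hK in \<open>simp add: K_carrier\<close>)
      have h'K: "h' \<in> carrier K"
        unfolding K_carrier
        by (intro conjI fin) (use hK True in \<open>auto simp: K_carrier h'_def PiE_iff extensional_def\<close>)
      then have h': "h' \<in> tail j" using insert.prems(1) by (auto simp: tail_def h'_def)
      have "{k \<in> {1..}. fst h' k \<noteq> \<one>\<^bsub>\<Gamma>\<^esub>} \<subseteq> S" using insert.prems(2) by (auto simp: h'_def)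
      then have IH: "base h' \<otimes>\<^bsub>T\<^esub> lam j n = lam j n \<otimes>\<^bsub>T\<^esub> base h'"
        using insert.IH[OF h'] by simp
      have g: "?g \<in> carrier K" by (rule Gamma_elem_carrier[OF \<Gamma> x])
      have gl: "base ?g \<otimes>\<^bsub>T\<^esub> lam j n = lam j n \<otimes>\<^bsub>T\<^esub> base ?g"
        using cls_eq[OF T1_cong.commute[OF j ij x, of n]] j g
        by (simp add: base_def lam_def cls_mult Base_word Lam_word)
      have "h = ?g \<otimes>\<^bsub>K\<^esub> h'"
        using True hK s x
        by (auto simp: K_mult Gamma_elem_def h'_def x_def prod_eq_iff fun_eq_iff K_carrier PiE_iff extensional_def)
      then have "base h \<otimes>\<^bsub>T\<^esub> lam j n = base ?g \<otimes>\<^bsub>T\<^esub> (base h' \<otimes>\<^bsub>T\<^esub> lam j n)"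
        using g h'K j by (simp add: base_mult T.m_assoc)
      also have "\<dots> = (base ?g \<otimes>\<^bsub>T\<^esub> lam j n) \<otimes>\<^bsub>T\<^esub> base h'"
        using g h'K j by (simp add: IH T.m_assoc)
      also have "\<dots> = lam j n \<otimes>\<^bsub>T\<^esub> base h"
        using g h'K j \<open>h = _\<close> by (simp add: gl base_mult T.m_assoc)
      finally show ?thesis .
    qed
  qed
  have "finite {i \<in> {1..}. fst h i \<noteq> \<one>\<^bsub>\<Gamma>\<^esub>}" using h by (simp add: tail_def K_carrier)
  then show ?thesis using h by (rule main) simp
qed


text \<open>Reads a normal form back as a group element; \<open>ev_normal\<close> recovers every
  element from its normal form.\<close>

fun ev :: "((nat \<Rightarrow> 'a) \<times> (nat \<Rightarrow> nat)) nf \<Rightarrow> 'a T1_word set"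
  where "ev (End k) = base k"
  | "ev (Syl t j n w) = base t \<otimes>\<^bsub>T\<^esub> (lam j n \<otimes>\<^bsub>T\<^esub> ev w)"

text \<open>The letters \<^term>\<open>Lam 0 n\<close> are not part of the presentation, so that \<^const>\<open>wf\<close>
  alone does not make a normal form meaningful in \<open>T\<^sub>1(\<Gamma>)\<close>.\<close>

fun pos :: "((nat \<Rightarrow> 'a) \<times> (nat \<Rightarrow> nat)) nf \<Rightarrow> bool"
  where "pos (End k) = True"
  | "pos (Syl t j n w) = (1 \<le> j \<and> pos w)"

lemma pos_kact: "pos w \<Longrightarrow> pos (kact k w)"
  by (induction w arbitrary: k) auto

lemma pos_lact: "pos w \<Longrightarrow> 1 \<le> j \<Longrightarrow> pos (lact j n w)"
  by (cases w) auto

lemma pos_word_act: "u \<in> T1_words \<Gamma> \<Longrightarrow> pos w \<Longrightarrow> pos (word_act u w)"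
  by (induction rule: T1_words_induct) (auto simp: pos_kact pos_lact)

lemma ev_carrier: "wf w \<Longrightarrow> pos w \<Longrightarrow> ev w \<in> carrier T"
  by (induction w) auto

text \<open>The remainder in \<open>tail j\<close> that \<open>kact\<close> carries past the letter
  also passes it in the group, by \<open>base_lam_commute\<close>.\<close>

lemma ev_kact: "wf w \<Longrightarrow> pos w \<Longrightarrow> k \<in> carrier K \<Longrightarrow> ev (kact k w) = base k \<otimes>\<^bsub>T\<^esub> ev w"
proof (induction w arbitrary: k)
  case (Syl t j n w)
  then have t: "t \<in> carrier K" and w: "wf w" "pos w" and j: "1 \<le> j" by auto
  define s where "s = rep j (k \<otimes>\<^bsub>K\<^esub> t)"
  define h where "h = inv\<^bsub>K\<^esub> s \<otimes>\<^bsub>K\<^esub> (k \<otimes>\<^bsub>K\<^esub> t)"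
  have kt: "k \<otimes>\<^bsub>K\<^esub> t \<in> carrier K" using t Syl.prems by simp
  have s: "s \<in> carrier K" and h: "h \<in> tail j"
    using rep_carrier[OF kt] rep_N[OF kt] by (simp_all add: s_def h_def)
  have hK: "h \<in> carrier K" by (rule N_carrier[OF h])
  have sh: "s \<otimes>\<^bsub>K\<^esub> h = k \<otimes>\<^bsub>K\<^esub> t" using s kt by (simp add: h_def m_assoc[symmetric])
  note c = base_carrier[OF s] base_carrier[OF hK] lam_carrier[OF j, of n] ev_carrier[OF w]
    base_carrier[OF Syl.prems(3)] base_carrier[OF t]
  have "ev (kact k (Syl t j n w)) = base s \<otimes>\<^bsub>T\<^esub> (lam j n \<otimes>\<^bsub>T\<^esub> (base h \<otimes>\<^bsub>T\<^esub> ev w))"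
    using Syl.IH[OF w hK] by (simp add: s_def[symmetric] h_def[symmetric])
  also have "\<dots> = base s \<otimes>\<^bsub>T\<^esub> ((base h \<otimes>\<^bsub>T\<^esub> lam j n) \<otimes>\<^bsub>T\<^esub> ev w)"
    using c by (simp add: base_lam_commute[OF j h] T.m_assoc)
  also have "\<dots> = base (s \<otimes>\<^bsub>K\<^esub> h) \<otimes>\<^bsub>T\<^esub> (lam j n \<otimes>\<^bsub>T\<^esub> ev w)"
    using c by (simp add: base_mult[OF s hK] T.m_assoc)
  also have "\<dots> = base k \<otimes>\<^bsub>T\<^esub> ev (Syl t j n w)"
    using c by (simp add: sh base_mult[OF Syl.prems(3) t] T.m_assoc)
  finally show ?case .
qed (simp add: base_mult)

lemma ev_lact:
  assumes w: "wf w" "pos w" and j: "1 \<le> j"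
  shows "ev (lact j n w) = lam j n \<otimes>\<^bsub>T\<^esub> ev w"
proof (cases "starts j w")
  case True
  then obtain m v where v: "w = Syl \<one>\<^bsub>K\<^esub> j m v" by (cases w) auto
  then have "ev v \<in> carrier T" using w ev_carrier by auto
  then have "lam j n \<otimes>\<^bsub>T\<^esub> ev w = lam j (n + m) \<otimes>\<^bsub>T\<^esub> ev v"
    using j by (simp add: v base_one lam_add T.m_assoc)
  then show ?thesis
    using \<open>ev v \<in> carrier T\<close> j lam_zero[OF j] by (auto simp: v base_one)
next
  case False
  then show ?thesis
    using lact_fresh[OF False] lact_zero[OF w(1)] lam_zero[OF j] ev_carrier[OF w] j
    by (cases "n = 0") (simp_all add: base_one)
qed

lemma ev_word_act:
  assumes "u \<in> T1_words \<Gamma>" "wf w" "pos w"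
  shows "ev (word_act u w) = cls u \<otimes>\<^bsub>T\<^esub> ev w"
  using assms
proof (induction rule: T1_words_induct)
  case Nil
  then show ?case by (simp add: cls_Nil ev_carrier)
next
  case (Base k u)
  have "cls (Base k # u) = base k \<otimes>\<^bsub>T\<^esub> cls u"
    using Base by (simp add: base_def cls_mult Base_word)
  then show ?case
    using Base by (simp add: ev_kact word_act_wf pos_word_act ev_carrier T.m_assoc)
next
  case (Lam j n u)
  have "cls (Lam j n # u) = lam j n \<otimes>\<^bsub>T\<^esub> cls u"
    using Lam by (simp add: lam_def cls_mult Lam_word)
  then show ?case
    using Lam by (simp add: ev_lact word_act_wf pos_word_act ev_carrier T.m_assoc)
qed

lemma gact_ev: "wf w \<Longrightarrow> pos w \<Longrightarrow> wf v \<Longrightarrow> gact (ev w) v = subst_end w v"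
  by (induction w) (simp_all add: gact_base gact_lam gact_mult gact_wf ev_carrier subst_end_wf lact_wf)

section \<open>Normal forms of group elements and their conjugates\<close>

definition normal :: "'a T1_word set \<Rightarrow> ((nat \<Rightarrow> 'a) \<times> (nat \<Rightarrow> nat)) nf"
  where "normal g = gact g (End \<one>\<^bsub>K\<^esub>)"

lemma normal:
  assumes g: "g \<in> carrier T"
  shows normal_wf: "wf (normal g)" and normal_pos: "pos (normal g)" and ev_normal: "ev (normal g) = g"
proof -
  obtain u where u: "u \<in> T1_words \<Gamma>" "g = cls u" using g by (rule T_cases)
  have "normal g = word_act u (End \<one>\<^bsub>K\<^esub>)" using u by (simp add: normal_def gact_cls)
  then show "wf (normal g)" "pos (normal g)" "ev (normal g) = g"
    using u by (simp_all add: word_act_wf pos_word_act ev_word_act base_one)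
qed

text \<open>With \<open>normal_mult\<close> this expresses right multiplication of \<open>g\<close>
  through the syllables of \<open>normal g\<close>, where the head lemmas apply.\<close>

lemma gact_normal: "g \<in> carrier T \<Longrightarrow> wf v \<Longrightarrow> gact g v = subst_end (normal g) v"
  using gact_ev[of "normal g" v] by (simp add: normal)

lemma normal_base: "k \<in> carrier K \<Longrightarrow> normal (base k) = End k"
  by (simp add: normal_def gact_base)

lemma normal_lam: "1 \<le> j \<Longrightarrow> normal (lam j n) = lact j n (End \<one>\<^bsub>K\<^esub>)"
  by (simp add: normal_def gact_lam)

lemma normal_mult: "g \<in> carrier T \<Longrightarrow> h \<in> carrier T \<Longrightarrow> normal (g \<otimes>\<^bsub>T\<^esub> h) = gact g (normal h)"
  by (simp add: normal_def gact_mult)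

lemma starts_normal_conj_base:
  assumes g: "g \<in> carrier T" and k: "k \<in> carrier K" and s: "starts J (normal g)"
  shows "starts J (normal (conj_by T (base k) g)) \<longleftrightarrow> k \<in> tail J"
proof -
  have "normal (conj_by T (base k) g) = kact k (gact g (End (inv\<^bsub>K\<^esub> k)))"
    using g k
    by (simp add: conj_by_def base_inv normal_mult normal_base gact_mult gact_base gact_wf)
  also have "\<dots> = kact k (subst_end (normal g) (End (inv\<^bsub>K\<^esub> k)))"
    using k by (simp add: gact_normal[OF g])
  finally have "normal (conj_by T (base k) g) = kact k (subst_end (normal g) (End (inv\<^bsub>K\<^esub> k)))" .
  then show ?thesis
    using starts_conj_base[OF normal_wf[OF g] k _ s] k by simp
qed

lemma starts_normal_conj_lam:
  assumes g: "g \<in> carrier T" and J: "1 \<le> J"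
    and s: "\<not> starts J (normal g)" and t: "g \<notin> base ` tail J"
  shows "starts J (normal (conj_by T (inv\<^bsub>T\<^esub> (lam J 1)) g))"
proof -
  have "normal (conj_by T (inv\<^bsub>T\<^esub> (lam J 1)) g) =
      lact J (- 1) (gact g (Syl \<one>\<^bsub>K\<^esub> J 1 (End \<one>\<^bsub>K\<^esub>)))"
    using g J
    by (simp add: conj_by_def lam_inv normal_mult normal_lam gact_mult gact_lam gact_wf rep_one)
  also have "\<dots> = lact J (- 1) (subst_end (normal g) (Syl \<one>\<^bsub>K\<^esub> J 1 (End \<one>\<^bsub>K\<^esub>)))"
    by (simp add: gact_normal[OF g] rep_one)
  finally have "normal (conj_by T (inv\<^bsub>T\<^esub> (lam J 1)) g) =
      lact J (- 1) (subst_end (normal g) (Syl \<one>\<^bsub>K\<^esub> J 1 (End \<one>\<^bsub>K\<^esub>)))" .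
  moreover have "k \<notin> tail J" if "normal g = End k" for k
    using that ev_normal[OF g] t by auto
  ultimately show ?thesis
    using starts_conj_letter[OF normal_wf[OF g] _ s, of 1] by simp
qed

section \<open>Permutations and absorption\<close>

definition perm :: "(nat \<Rightarrow> nat) \<Rightarrow> (nat \<Rightarrow> 'a) \<times> (nat \<Rightarrow> nat)"
  where "perm p = (\<lambda>i\<in>{1..}. \<one>\<^bsub>\<Gamma>\<^esub>, p)"

lemma perm_carrier: "p permutes {1..n} \<Longrightarrow> perm p \<in> carrier K"
proof -
  assume p: "p permutes {1..n}"
  have "{i. p i \<noteq> i} \<subseteq> {1..n}" using p by (auto simp: permutes_def)
  then have "finite {i. p i \<noteq> i}" by (rule finite_subset) simp
  moreover have "p permutes {1..}" by (rule permutes_subset[OF p]) auto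
  ultimately show ?thesis by (simp add: K_carrier perm_def)
qed

text \<open>A 3-cycle, because both it and its square have to lie outside \<open>tail 4\<close>; its
  support \<open>{1..3}\<close> makes it commute with \<open>tail 4\<close>.\<close>

definition cycle3 :: "nat \<Rightarrow> nat"
  where "cycle3 = Transposition.transpose 1 2 \<circ> Transposition.transpose 2 3"

lemma cycle3_permutes: "cycle3 permutes {1..3}"
  unfolding cycle3_def by (intro permutes_compose permutes_swap_id) auto

lemma cycle3_values: "cycle3 1 = 2" "cycle3 (cycle3 1) = 3"
  by (simp_all add: cycle3_def Transposition.transpose_def)

text \<open>An involution that pushes everything supported on the first \<open>M\<close> indices
  beyond \<open>M\<close>.\<close>

definition swap :: "nat \<Rightarrow> nat \<Rightarrow> nat"
  where "swap M i = (if 1 \<le> i \<and> i \<le> M then i + M else if M < i \<and> i \<le> 2 * M then i - M else i)"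

lemma swap_swap: "swap M (swap M i) = i"
  by (auto simp: swap_def)

lemma swap_permutes: "swap M permutes {1..2 * M}"
proof (rule bij_imp_permutes)
  show "bij_betw (swap M) {1..2 * M} {1..2 * M}"
    by (rule bij_betw_byWitness[where f' = "swap M"]) (auto simp: swap_swap, auto simp: swap_def split: if_splits)
qed (auto simp: swap_def)

lemma swap_inv: "inv_into UNIV (swap M) = swap M"
  by (rule inv_unique_comp) (auto simp: swap_swap fun_eq_iff)

lemma conj_swap_tail:
  assumes h: "h \<in> tail j" and supp: "\<And>i. i > M \<Longrightarrow> fst h i = \<one>\<^bsub>\<Gamma>\<^esub>"
  shows "\<exists>h'\<in>tail (Suc M). conj_by T (base (perm (swap M))) (base h) = base h'"
proof -
  have hK: "h \<in> carrier K" and s: "snd h = id" using h by (auto simp: tail_def)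
  let ?u = "perm (swap M)"
  have u: "?u \<in> carrier K" by (rule perm_carrier[OF swap_permutes])
  define h' where "h' = ?u \<otimes>\<^bsub>K\<^esub> h \<otimes>\<^bsub>K\<^esub> inv\<^bsub>K\<^esub> ?u"
  define k where "k = (\<lambda>i\<in>{1..}. fst h (swap M i), id :: nat \<Rightarrow> nat)"
  have h'K: "h' \<in> carrier K" unfolding h'_def using u hK by simp
  have ge: "1 \<le> swap M i" if "1 \<le> i" for i using that by (auto simp: swap_def)
  have "k \<otimes>\<^bsub>K\<^esub> ?u = ?u \<otimes>\<^bsub>K\<^esub> h"
    using K_fst[OF hK ge] s by (auto simp: K_mult k_def perm_def swap_inv intro!: restrict_ext)
  have kK: "k \<in> carrier K"
  proof -
    have "{i \<in> {1..}. fst k i \<noteq> \<one>\<^bsub>\<Gamma>\<^esub>} \<subseteq> {1..2 * M}"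
      using supp by (auto simp: k_def swap_def split: if_splits)
    then have fin: "finite {i \<in> {1..}. fst k i \<noteq> \<one>\<^bsub>\<Gamma>\<^esub>}" by (rule finite_subset) simp
    show ?thesis
      unfolding K_carrier
      by (intro conjI fin) (use K_fst[OF hK ge] in \<open>auto simp: k_def permutes_id\<close>)
  qed
  have "h' = k \<otimes>\<^bsub>K\<^esub> ?u \<otimes>\<^bsub>K\<^esub> inv\<^bsub>K\<^esub> ?u"
    unfolding h'_def \<open>k \<otimes>\<^bsub>K\<^esub> ?u = ?u \<otimes>\<^bsub>K\<^esub> h\<close> ..
  also have "\<dots> = k" using kK u by (simp add: m_assoc)
  finally have "h' = k" .
  moreover have "k \<in> tail (Suc M)"
    using kK supp by (auto simp: tail_def) (auto simp: k_def swap_def)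
  moreover have "conj_by T (base ?u) (base h) = base h'"
    unfolding h'_def conj_by_def using u hK by (simp add: base_mult base_inv)
  ultimately show ?thesis by auto
qed

text \<open>For \<open>Lam j n\<close> the condition puts \<open>tail (Suc M)\<close> inside
  \<open>tail j\<close>, whose elements commute with the letter.\<close>

fun letter_bound :: "nat \<Rightarrow> ((nat \<Rightarrow> 'a) \<times> (nat \<Rightarrow> nat)) T1_letter \<Rightarrow> bool"
  where "letter_bound M (Base k) = (\<forall>i>M. fst k i = \<one>\<^bsub>\<Gamma>\<^esub> \<and> snd k i = i)"
  | "letter_bound M (Lam j n) = (j \<le> M)"

lemma letter_bound_mono: "letter_bound M x \<Longrightarrow> M \<le> M' \<Longrightarrow> letter_bound M' x"
  by (cases x) auto

lemma K_bound:
  assumes "k \<in> carrier K"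
  obtains M where "\<And>i. i > M \<Longrightarrow> fst k i = \<one>\<^bsub>\<Gamma>\<^esub> \<and> snd k i = i"
proof -
  let ?S = "{i \<in> {1..}. fst k i \<noteq> \<one>\<^bsub>\<Gamma>\<^esub>} \<union> {i. snd k i \<noteq> i}"
  have "finite ?S" using assms by (simp add: K_carrier)
  then obtain M where M: "\<And>i. i \<in> ?S \<Longrightarrow> i \<le> M" using finite_nat_set_iff_bounded_le by auto
  have "fst k i = \<one>\<^bsub>\<Gamma>\<^esub> \<and> snd k i = i" if "i > M" for i
    using M[of i] that by auto
  then show ?thesis by (rule that)
qed

lemma word_bound: "u \<in> T1_words \<Gamma> \<Longrightarrow> \<exists>M. \<forall>x\<in>set u. letter_bound M x"
proof (induction rule: T1_words_induct)
  case (Base k u)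
  then obtain M M' where "\<forall>x\<in>set u. letter_bound M x" "letter_bound M' (Base k)"
    by (metis K_bound letter_bound.simps(1))
  then show ?case
    by (intro exI[of _ "max M M'"]) (auto intro: letter_bound_mono simp del: letter_bound.simps)
next
  case (Lam j n u)
  then obtain M where "\<forall>x\<in>set u. letter_bound M x" by blast
  then show ?case
    by (intro exI[of _ "max M j"]) (auto intro: letter_bound_mono)
qed simp

lemma tail_word_commute:
  assumes u: "u \<in> T1_words \<Gamma>" and h: "h \<in> tail (Suc M)" and "\<forall>x\<in>set u. letter_bound M x"
  shows "base h \<otimes>\<^bsub>T\<^esub> cls u = cls u \<otimes>\<^bsub>T\<^esub> base h"
  using u assms(3)
proof (induction rule: T1_words_induct)
  case Nil
  then show ?case using N_carrier[OF h] by (simp add: cls_Nil)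
next
  case (Base k u)
  have hK: "h \<in> carrier K" by (rule N_carrier[OF h])
  have "h \<otimes>\<^bsub>K\<^esub> k = k \<otimes>\<^bsub>K\<^esub> h"
    using Base by (intro tail_commute[OF h]) auto
  then have c: "base h \<otimes>\<^bsub>T\<^esub> base k = base k \<otimes>\<^bsub>T\<^esub> base h"
    using hK Base by (simp add: base_mult[symmetric])
  have "cls (Base k # u) = base k \<otimes>\<^bsub>T\<^esub> cls u"
    using Base by (simp add: base_def cls_mult Base_word)
  moreover have "base h \<otimes>\<^bsub>T\<^esub> (base k \<otimes>\<^bsub>T\<^esub> cls u) = base k \<otimes>\<^bsub>T\<^esub> (base h \<otimes>\<^bsub>T\<^esub> cls u)"
    using hK Base.hyps by (simp add: c T.m_assoc[symmetric])
  ultimately show ?case using hK Base by (simp add: T.m_assoc)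
next
  case (Lam j n u)
  have hK: "h \<in> carrier K" by (rule N_carrier[OF h])
  have "h \<in> tail j" using h Lam by (auto simp: tail_def)
  then have c: "base h \<otimes>\<^bsub>T\<^esub> lam j n = lam j n \<otimes>\<^bsub>T\<^esub> base h"
    using Lam by (intro base_lam_commute) auto
  have "cls (Lam j n # u) = lam j n \<otimes>\<^bsub>T\<^esub> cls u"
    using Lam by (simp add: lam_def cls_mult Lam_word)
  moreover have "base h \<otimes>\<^bsub>T\<^esub> (lam j n \<otimes>\<^bsub>T\<^esub> cls u) = lam j n \<otimes>\<^bsub>T\<^esub> (base h \<otimes>\<^bsub>T\<^esub> cls u)"
    using hK Lam.hyps by (simp add: c T.m_assoc[symmetric])
  ultimately show ?case using hK Lam by (simp add: T.m_assoc)
qed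

text \<open>Exchanging large enough blocks moves \<open>A\<close> beyond every index involved in
  chosen words for \<open>E\<close>, and then \<open>tail_word_commute\<close> applies.\<close>

lemma absorption:
  assumes A: "finite A" "A \<subseteq> base ` tail j" and E: "finite E" "E \<subseteq> carrier T"
  shows "\<exists>u\<in>carrier T. \<forall>h\<in>A. \<forall>e\<in>E. conj_by T u h \<otimes>\<^bsub>T\<^esub> e = e \<otimes>\<^bsub>T\<^esub> conj_by T u h"
proof -
  have "\<exists>k M. k \<in> tail j \<and> g = base k \<and> (\<forall>i>M. fst k i = \<one>\<^bsub>\<Gamma>\<^esub>)" if "g \<in> A" for g
  proof -
    obtain k where k: "k \<in> tail j" "g = base k" using \<open>g \<in> A\<close> A by blast
    moreover obtain M where "\<And>i. i > M \<Longrightarrow> fst k i = \<one>\<^bsub>\<Gamma>\<^esub> \<and> snd k i = i"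
      using K_bound[OF N_carrier[OF k(1)]] by blast
    ultimately show ?thesis by blast
  qed
  then obtain k M where k: "\<And>g. g \<in> A \<Longrightarrow> k g \<in> tail j \<and> g = base (k g) \<and> (\<forall>i>M g. fst (k g) i = \<one>\<^bsub>\<Gamma>\<^esub>)"
    by metis
  have "\<exists>u L. u \<in> T1_words \<Gamma> \<and> e = cls u \<and> (\<forall>x\<in>set u. letter_bound L x)" if "e \<in> E" for e
  proof -
    obtain u where "u \<in> T1_words \<Gamma>" "e = cls u" using \<open>e \<in> E\<close> E T_cases by blast
    then show ?thesis using word_bound by blast
  qed
  then obtain u L where u: "\<And>e. e \<in> E \<Longrightarrow> u e \<in> T1_words \<Gamma> \<and> e = cls (u e) \<and> (\<forall>x\<in>set (u e). letter_bound (L e) x)"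
    by metis
  \<comment> \<open>\<open>R\<close> bounds the supports in \<open>A\<close> and the indices in the
    words for \<open>E\<close>; the inserted 0 keeps the set nonempty when both are empty.\<close>
  define R where "R = Max (insert 0 (M ` A \<union> L ` E))"
  have fin: "finite (insert 0 (M ` A \<union> L ` E))" using A E by simp
  have RM: "M g \<le> R" if "g \<in> A" for g
    unfolding R_def using that by (intro Max_ge[OF fin]) auto
  have RL: "L e \<le> R" if "e \<in> E" for e
    unfolding R_def using that by (intro Max_ge[OF fin]) auto
  let ?u = "base (perm (swap R))"
  have "conj_by T ?u g \<otimes>\<^bsub>T\<^esub> e = e \<otimes>\<^bsub>T\<^esub> conj_by T ?u g" if g: "g \<in> A" and e: "e \<in> E" for g e
  proof -
    have "fst (k g) i = \<one>\<^bsub>\<Gamma>\<^esub>" if "i > R" for i using k[OF g] RM[OF g] that by simp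
    then obtain h where h: "h \<in> tail (Suc R)" "conj_by T ?u (base (k g)) = base h"
      using conj_swap_tail[of "k g" j R] k[OF g] by blast
    have "\<forall>x\<in>set (u e). letter_bound R x"
      using u[OF e] letter_bound_mono[OF _ RL[OF e]] by blast
    then have "base h \<otimes>\<^bsub>T\<^esub> cls (u e) = cls (u e) \<otimes>\<^bsub>T\<^esub> base h"
      using u[OF e] h(1) by (intro tail_word_commute) auto
    moreover have "conj_by T ?u g = base h" using h(2) k[OF g] by simp
    moreover have "e = cls (u e)" using u[OF e] by blast
    ultimately show ?thesis by simp
  qed
  then show ?thesis
    by (intro bexI[of _ ?u] ballI base_carrier perm_carrier[OF swap_permutes])
qed

lemma base_tail_commute:
  "h \<in> base ` tail 4 \<Longrightarrow> base (perm cycle3) \<otimes>\<^bsub>T\<^esub> h = h \<otimes>\<^bsub>T\<^esub> base (perm cycle3)"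
  "h \<in> base ` tail 4 \<Longrightarrow> lam 4 n \<otimes>\<^bsub>T\<^esub> h = h \<otimes>\<^bsub>T\<^esub> lam 4 n"
proof -
  assume "h \<in> base ` tail 4"
  then obtain k where k: "k \<in> tail 4" "h = base k" by auto
  have p: "perm cycle3 \<in> carrier K" by (rule perm_carrier[OF cycle3_permutes])
  have "k \<otimes>\<^bsub>K\<^esub> perm cycle3 = perm cycle3 \<otimes>\<^bsub>K\<^esub> k"
    by (rule tail_commute[where M = 3])
      (use k p permutes_not_in[OF cycle3_permutes] in \<open>auto simp: perm_def\<close>)
  then show "base (perm cycle3) \<otimes>\<^bsub>T\<^esub> h = h \<otimes>\<^bsub>T\<^esub> base (perm cycle3)"
    using N_carrier[OF k(1)] p by (simp add: k(2) base_mult[symmetric])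
  show "lam 4 n \<otimes>\<^bsub>T\<^esub> h = h \<otimes>\<^bsub>T\<^esub> lam 4 n"
    using base_lam_commute[of 4 k n] k by simp
qed

theorem T1_conj_paradox:
  "conj_paradox T (base ` tail 4) {g \<in> carrier T. starts 4 (normal g)} (base (perm cycle3)) (lam 4 1)"
proof
  have p: "perm cycle3 \<in> carrier K" by (rule perm_carrier[OF cycle3_permutes])
  have p1: "perm cycle3 \<notin> tail 4"
    using cycle3_values(1) by (auto simp: tail_def perm_def)
  have p2: "perm cycle3 \<otimes>\<^bsub>K\<^esub> perm cycle3 \<notin> tail 4"
  proof
    assume "perm cycle3 \<otimes>\<^bsub>K\<^esub> perm cycle3 \<in> tail 4"
    then have "cycle3 \<circ> cycle3 = id" by (simp add: tail_def K_mult perm_def)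
    then have "cycle3 (cycle3 1) = 1" by (metis comp_apply id_apply)
    then show False using cycle3_values(2) by simp
  qed
  show "base (perm cycle3) \<in> carrier T" "lam 4 1 \<in> carrier T" using p by simp_all
  show "base ` tail 4 \<subseteq> carrier T" using N_carrier by auto
  show "{g \<in> carrier T. starts 4 (normal g)} \<subseteq> carrier T - base ` tail 4"
    using N_carrier by (auto simp: normal_base)
  show "base (perm cycle3) \<otimes>\<^bsub>T\<^esub> h = h \<otimes>\<^bsub>T\<^esub> base (perm cycle3)" if "h \<in> base ` tail 4" for h
    by (rule base_tail_commute(1)[OF that])
  show "conj_by T (inv\<^bsub>T\<^esub> (lam 4 1)) g \<in> {g \<in> carrier T. starts 4 (normal g)}"
    if "g \<in> carrier T" "g \<notin> base ` tail 4" "g \<notin> {g \<in> carrier T. starts 4 (normal g)}" for g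
    using that starts_normal_conj_lam[of g 4] by auto
  show "conj_by T (base (perm cycle3)) g \<notin> {g \<in> carrier T. starts 4 (normal g)}"
    if "g \<in> {g \<in> carrier T. starts 4 (normal g)}" for g
    using that starts_normal_conj_base[OF _ p] p1 by auto
  \<comment> \<open>Two conjugations amount to one by the square of the 3-cycle, which is outside
    \<open>tail 4\<close> by \<open>p2\<close>.\<close>
  show "conj_by T (base (perm cycle3)) (conj_by T (base (perm cycle3)) g) \<notin> {g \<in> carrier T. starts 4 (normal g)}"
    if "g \<in> {g \<in> carrier T. starts 4 (normal g)}" for g
    using that p starts_normal_conj_base[of g "perm cycle3 \<otimes>\<^bsub>K\<^esub> perm cycle3" 4] p2
    by (auto simp: T.conj_by_mult base_mult)
  show "\<exists>u\<in>carrier T. \<forall>h\<in>A. \<forall>e\<in>E. conj_by T u h \<otimes>\<^bsub>T\<^esub> e = e \<otimes>\<^bsub>T\<^esub> conj_by T u h"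
    if "finite A" "A \<subseteq> base ` tail 4" "finite E" "E \<subseteq> carrier T" for A E
    by (rule absorption[OF that])
qed

end

subsection \<open>Finite direct sums\<close>

lemma conj_by_sum_group:
  assumes "\<And>i. i \<in> I \<Longrightarrow> group (G i)" "u \<in> carrier (sum_group I G)"
  shows "conj_by (sum_group I G) u g = (\<lambda>i\<in>I. conj_by (G i) (u i) (g i))"
  using assms by (auto simp: conj_by_def fun_eq_iff)

lemma carrier_sum_group_finite:
  assumes "\<And>i. i \<in> I \<Longrightarrow> group (G i)" "finite I"
  shows "carrier (sum_group I G) = (\<Pi>\<^sub>E i\<in>I. carrier (G i))"
  using assms by (auto simp: carrier_sum_group)

text \<open>An element belongs to the new paradoxical set if its first coordinate outside
  \<open>C\<close> lies in \<open>F\<close>. The constant tuples of \<open>a\<close> and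
  \<open>b\<close> commute with coordinates in \<open>C\<close>, for \<open>b\<close> by
  \<open>b_C\<close>; so the coordinates before that index stay in \<open>C\<close>, and the
  original conditions apply at the index.\<close>

lemma (in conj_paradox) conj_paradox_power:
  fixes t :: nat
  assumes b_C: "\<And>h. h \<in> C \<Longrightarrow> b \<otimes> h = h \<otimes> b"
  shows "conj_paradox (sum_group {1..t} (\<lambda>_. G)) {g \<in> carrier (sum_group {1..t} (\<lambda>_. G)). \<forall>i\<in>{1..t}. g i \<in> C}
    {g \<in> carrier (sum_group {1..t} (\<lambda>_. G)). \<exists>i\<in>{1..t}. g i \<in> F \<and> (\<forall>k\<in>{1..<i}. g k \<in> C)}
    (\<lambda>i\<in>{1..t}. a) (\<lambda>i\<in>{1..t}. b)"
    (is "conj_paradox ?S ?C ?F ?a ?b")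
proof -
  have G: "group G" by (rule is_group)
  have carrier: "carrier ?S = ({1..t} \<rightarrow>\<^sub>E carrier G)"
    by (rule carrier_sum_group_finite) (simp_all add: G)
  have group: "group ?S" using G by simp
  have aS: "?a \<in> carrier ?S" and bS: "?b \<in> carrier ?S"
    unfolding carrier using a b by auto
  have conj: "conj_by ?S u g i = conj_by G (u i) (g i)" if "u \<in> carrier ?S" "i \<in> {1..t}" for u g i
    using that G by (simp add: conj_by_sum_group)
  have conj_S: "conj_by ?S u g \<in> carrier ?S" if "u \<in> carrier ?S" "g \<in> carrier ?S" for u g
    by (rule group.conj_by_closed[OF group that])
  have gi: "g i \<in> carrier G" if "g \<in> carrier ?S" "i \<in> {1..t}" for g i
    using that unfolding carrier by blast
  have FC: "g \<in> F \<Longrightarrow> g \<notin> C" for g using F by auto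
  \<comment> \<open>As \<open>F\<close> is disjoint from \<open>C\<close>, an index witnessing
    membership is the first coordinate outside \<open>C\<close>. Elements with the same coordinates
    in \<open>C\<close> therefore share it.\<close>
  have first: "i = j" if "g i \<in> F" "h j \<in> F" "\<forall>k\<in>{1..<i}. g k \<in> C" "\<forall>k\<in>{1..<j}. h k \<in> C"
    "i \<in> {1..t}" "j \<in> {1..t}" and iff: "\<And>k. k \<in> {1..t} \<Longrightarrow> g k \<in> C \<longleftrightarrow> h k \<in> C"
    for g h :: "nat \<Rightarrow> 'a" and i j
  proof (rule ccontr)
    assume "i \<noteq> j"
    then consider "i < j" | "j < i" by linarith
    then show False
    proof cases
      case 1
      then have "h i \<in> C" using that by auto
      then show False using FC that iff by blast
    next
      case 2
      then have "g j \<in> C" using that by auto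
      then show False using FC that iff by blast
    qed
  qed
  have disj: "h \<notin> ?F" if g: "g \<in> ?F"
    and iff: "\<And>k. k \<in> {1..t} \<Longrightarrow> g k \<in> C \<longleftrightarrow> h k \<in> C"
    and nF: "\<And>k. k \<in> {1..t} \<Longrightarrow> g k \<in> F \<Longrightarrow> h k \<notin> F" for g h
  proof
    assume "h \<in> ?F"
    then obtain j where j: "j \<in> {1..t}" "h j \<in> F" "\<forall>k\<in>{1..<j}. h k \<in> C" by blast
    obtain i where i: "i \<in> {1..t}" "g i \<in> F" "\<forall>k\<in>{1..<i}. g k \<in> C" using g by blast
    have "i = j" by (rule first[OF i(2) j(2) i(3) j(3) i(1) j(1) iff])
    then show False using nF[OF i(1,2)] j(2) by simp
  qed
  have a_iff: "conj_by ?S ?a g k \<in> C \<longleftrightarrow> g k \<in> C" if "g \<in> carrier ?S" "k \<in> {1..t}" for g k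
    using conj[OF aS that(2), of g] conj_a_C_iff[OF gi[OF that]] that(2) by simp
  show ?thesis
  proof (intro conj_paradox.intro conj_paradox_axioms.intro group aS bS)
    show "?C \<subseteq> carrier ?S" by auto
    show "?F \<subseteq> carrier ?S - ?C" using FC by blast
    show "?a \<otimes>\<^bsub>?S\<^esub> h = h \<otimes>\<^bsub>?S\<^esub> ?a" if "h \<in> ?C" for h
      using that a_C by (auto intro!: restrict_ext)
  next
    fix g assume g: "g \<in> carrier ?S" "g \<notin> ?C" "g \<notin> ?F"
    \<comment> \<open>The first coordinate outside \<open>C\<close> witnesses covering: it enters
      \<open>F\<close> after conjugation, while the earlier coordinates are fixed.\<close>
    define i where "i = (LEAST i. i \<in> {1..t} \<and> g i \<notin> C)"
    have "\<exists>i. i \<in> {1..t} \<and> g i \<notin> C" using g by blast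
    then have i: "i \<in> {1..t}" "g i \<notin> C" unfolding i_def by (metis (mono_tags, lifting) LeastI_ex)+
    have lt: "g k \<in> C" if "k \<in> {1..<i}" for k
      using not_less_Least[of k "\<lambda>i. i \<in> {1..t} \<and> g i \<notin> C"] that i(1) unfolding i_def[symmetric] by auto
    have inv_b: "inv\<^bsub>?S\<^esub> ?b = (\<lambda>i\<in>{1..t}. inv b)"
      using G bS by (auto simp: fun_eq_iff)
    define g' where "g' = conj_by ?S (inv\<^bsub>?S\<^esub> ?b) g"
    have c: "g' k = conj_by G (inv b) (g k)" if "k \<in> {1..t}" for k
      unfolding g'_def conj[OF group.inv_closed[OF group bS] that] unfolding inv_b using that by simp
    have "g i \<notin> F" using g(1,3) i(1) lt by blast
    then have "conj_by G (inv b) (g i) \<in> F" by (rule cover[OF gi[OF g(1) i(1)] i(2)])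
    moreover have "conj_by G (inv b) (g k) \<in> C" if "k \<in> {1..<i}" for k
    proof -
      have "g k \<in> carrier G" using lt[OF that] C by blast
      then have "conj_by G (inv b) (g k) = inv b \<otimes> (b \<otimes> g k)"
        using b_C[OF lt[OF that]] b by (simp add: conj_by_def m_assoc)
      also have "\<dots> = g k"
        using \<open>g k \<in> carrier G\<close> b by (simp add: m_assoc[symmetric])
      finally show ?thesis using lt[OF that] by simp
    qed
    ultimately have "g' i \<in> F \<and> (\<forall>k\<in>{1..<i}. g' k \<in> C)"
      using i(1) by (auto simp: c)
    moreover have "g' \<in> carrier ?S"
      unfolding g'_def by (rule conj_S[OF group.inv_closed[OF group bS] g(1)])
    ultimately show "conj_by ?S (inv\<^bsub>?S\<^esub> ?b) g \<in> ?F"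
      unfolding g'_def[symmetric] using i(1) by blast
  next
    fix g assume g: "g \<in> ?F"
    then have gS: "g \<in> carrier ?S" by blast
    show "conj_by ?S ?a g \<notin> ?F"
      by (rule disj[OF g]) (use a_iff[OF gS] conj[OF aS, of _ g] disj1 in auto)
    show "conj_by ?S ?a (conj_by ?S ?a g) \<notin> ?F"
      by (rule disj[OF g])
        (use a_iff[OF gS] a_iff[OF conj_S[OF aS gS]] conj[OF aS] disj2 in auto)
  next
    fix A E assume A: "finite A" "A \<subseteq> ?C" and E: "finite E" "E \<subseteq> carrier ?S"
    \<comment> \<open>Absorption is applied to the projections of \<open>A\<close> and
      \<open>E\<close> to each coordinate, and the conjugators are assembled into a tuple.\<close>
    have "\<exists>u. u \<in> carrier G \<and> (\<forall>h\<in>A. \<forall>e\<in>E. conj_by G u (h i) \<otimes> e i = e i \<otimes> conj_by G u (h i))"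
      if i: "i \<in> {1..t}" for i
    proof -
      have "(\<lambda>h. h i) ` A \<subseteq> C" "(\<lambda>e. e i) ` E \<subseteq> carrier G"
        using A(2) E(2) i gi by blast+
      then show ?thesis
        using absorb[of "(\<lambda>h. h i) ` A" "(\<lambda>e. e i) ` E"] A(1) E(1) by auto
    qed
    then obtain u where u: "\<And>i. i \<in> {1..t} \<Longrightarrow> u i \<in> carrier G \<and>
        (\<forall>h\<in>A. \<forall>e\<in>E. conj_by G (u i) (h i) \<otimes> e i = e i \<otimes> conj_by G (u i) (h i))"
      by metis
    let ?u = "\<lambda>i\<in>{1..t}. u i"
    have uS: "?u \<in> carrier ?S" unfolding carrier using u by auto
    have "conj_by ?S ?u h \<otimes>\<^bsub>?S\<^esub> e = e \<otimes>\<^bsub>?S\<^esub> conj_by ?S ?u h" if "h \<in> A" "e \<in> E" for h e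
      using u that conj[OF uS, of _ h] by (auto intro!: restrict_ext)
    then show "\<exists>u\<in>carrier ?S. \<forall>h\<in>A. \<forall>e\<in>E. conj_by ?S u h \<otimes>\<^bsub>?S\<^esub> e = e \<otimes>\<^bsub>?S\<^esub> conj_by ?S u h"
      using uS by (intro bexI[of _ ?u] ballI)
  qed
qed

theorem proposition3p3:
  fixes \<Gamma> :: "('a, 'b) monoid_scheme" and t m :: nat
  assumes "group \<Gamma>" and "countable (carrier \<Gamma>)"
    and "1 \<le> t" and "1 \<le> m"
  shows "tau m (group_vN_algebra (sum_group {1..t} (\<lambda>_. T1 \<Gamma>))) = 0"
proof -
  interpret T1_construction \<Gamma> by (rule T1_construction.intro[OF assms(1)])
  interpret P: conj_paradox "T1 \<Gamma>" "base ` tail 4" "{g \<in> carrier (T1 \<Gamma>). starts 4 (normal g)}"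
    "base (perm cycle3)" "lam 4 1"
    by (rule T1_conj_paradox)
  show ?thesis
    \<comment> \<open>The remaining hypothesis \<open>b_C\<close> holds because
      \<open>lam 4 1\<close> commutes with the image of \<open>tail 4\<close>.\<close>
    by (rule conj_paradox.tau_zero[OF P.conj_paradox_power assms(4)]) (rule base_tail_commute(2))
qed

end
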